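(* Let $d=2^n$, let $\rho$ be any density operator on $\mathbb{C}^d$ and $H$ any Hermitian operator on $\mathbb{C}^d$. For a unitary $U\in U(d)$ consider the probe state $\sigma=U\rho U^\dagger$ and the family $\sigma_\theta=e^{-i\theta H}\sigma e^{i\theta H}$. Then the sub-QFI $\mathcal{I}(U\rho U^\dagger)$ and the QFI $I(U\rho U^\dagger)$, viewed as functions of $U\in U(d)$, are maximized by the same state preparation: there is a unitary $$U_*=\operatorname{argmax}_{U\in U(d)}\mathcal{I}(U\rho U^\dagger)=\operatorname{argmax}_{U\in U(d)} I(U\rho U^\dagger),$$ i.e. $U_*\rho U_*^\dagger$ maximizes both quantities simultaneously.
   Context: For density operators $\rho,\sigma$: Uhlmann fidelity $F(\rho,\sigma)=\|\sqrt{\rho}\sqrt{\sigma}\|_1$ (trace norm), and super-fidelity $G(\rho,\sigma)=\mathrm{Tr}[\rho\sigma]+\sqrt{(1-\mathrm{Tr}[\rho^2])(1-\mathrm{Tr}[\sigma^2])}$. For a probe state $\sigma$ with $\sigma_\theta=e^{-i\theta H}\sigma e^{i\theta H}$, the QFI is $I(\sigma)=8\lim_{\delta\to0}\frac{1-F(\sigma_\theta,\sigma_{\theta+\delta})}{\delta^2}$ and the sub-QFI is $\mathcal{I}(\sigma)=8\lim_{\delta\to0}\frac{1-\sqrt{G(\sigma_\theta,\sigma_{\theta+\delta})}}{\delta^2}$ (both are independent of $\theta$). *)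

theory Defs
  imports Complex_Main "Jordan_Normal_Form.Matrix"
begin

definition adj :: "complex mat \<Rightarrow> complex mat" where
  "adj A = mat (dim_col A) (dim_row A) (\<lambda>(i,j). cnj (A $$ (j,i)))"

definition mtrace :: "complex mat \<Rightarrow> complex" where
  "mtrace A = (\<Sum>i<dim_row A. A $$ (i,i))"

definition hermitian :: "nat \<Rightarrow> complex mat \<Rightarrow> bool" where
  "hermitian d A \<longleftrightarrow> A \<in> carrier_mat d d \<and> adj A = A"

definition psd :: "nat \<Rightarrow> complex mat \<Rightarrow> bool" where
  "psd d A \<longleftrightarrow> hermitian d A \<and>
     (\<forall>v \<in> carrier_vec d. 0 \<le> Re ((A *\<^sub>v v) \<bullet>c v))"

definition density_op :: "nat \<Rightarrow> complex mat \<Rightarrow> bool" where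
  "density_op d \<rho> \<longleftrightarrow> psd d \<rho> \<and> mtrace \<rho> = 1"

definition unitary_mat :: "nat \<Rightarrow> complex mat \<Rightarrow> bool" where
  "unitary_mat d U \<longleftrightarrow> U \<in> carrier_mat d d \<and> adj U * U = 1\<^sub>m d"

definition mat_exp :: "complex mat \<Rightarrow> complex mat" where
  "mat_exp A = mat (dim_row A) (dim_col A)
     (\<lambda>(i,j). \<Sum>k. (A ^\<^sub>m k) $$ (i,j) / of_nat (fact k))"

definition msqrt :: "complex mat \<Rightarrow> complex mat" where
  "msqrt A = (THE B. psd (dim_row A) B \<and> B * B = A)"

definition trace_norm :: "complex mat \<Rightarrow> real" where
  "trace_norm A = Re (mtrace (msqrt (adj A * A)))"

definition fidelity :: "complex mat \<Rightarrow> complex mat \<Rightarrow> real" where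
  "fidelity \<rho> \<sigma> = trace_norm (msqrt \<rho> * msqrt \<sigma>)"

definition super_fidelity :: "complex mat \<Rightarrow> complex mat \<Rightarrow> real" where
  "super_fidelity \<rho> \<sigma> = Re (mtrace (\<rho> * \<sigma>))
     + sqrt ((1 - Re (mtrace (\<rho> * \<rho>))) * (1 - Re (mtrace (\<sigma> * \<sigma>))))"

definition evolve :: "complex mat \<Rightarrow> real \<Rightarrow> complex mat \<Rightarrow> complex mat" where
  "evolve H \<theta> \<sigma> = mat_exp ((- \<i> * complex_of_real \<theta>) \<cdot>\<^sub>m H) * \<sigma>
                      * mat_exp ((\<i> * complex_of_real \<theta>) \<cdot>\<^sub>m H)"

definition QFI :: "complex mat \<Rightarrow> complex mat \<Rightarrow> real \<Rightarrow> real" where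
  "QFI H \<sigma> \<theta> = 8 * Lim (at (0::real))
     (\<lambda>\<delta>. (1 - fidelity (evolve H \<theta> \<sigma>) (evolve H (\<theta> + \<delta>) \<sigma>)) / \<delta>\<^sup>2)"

definition subQFI :: "complex mat \<Rightarrow> complex mat \<Rightarrow> real \<Rightarrow> real" where
  "subQFI H \<sigma> \<theta> = 8 * Lim (at (0::real))
     (\<lambda>\<delta>. (1 - sqrt (super_fidelity (evolve H \<theta> \<sigma>) (evolve H (\<theta> + \<delta>) \<sigma>))) / \<delta>\<^sup>2)"

end

(* Write rho = V diag(p) V^dag, H = K diag(h) K^dag with p and h decreasing, and let R be the unitary
   that expresses the eigenbasis of H in the eigenbasis of U rho U^dag. Both quantities then have the
   form 2 sum_ij f(i,j) |H'_ij|^2 with H' = R diag(h) R^dag, where f(i,j) = (p_i - p_j)^2 for the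
   sub-QFI and f(i,j) = (p_i - p_j)^2 / (p_i + p_j) for the QFI.

   The second formula comes from squeezing F(sigma, N sigma N^dag) = ||sqrt(sigma) N sqrt(sigma)||_1,
   N = exp(-i delta H): from below by testing the trace norm against the unitaries exp(i delta Z)
   with Z_ij = 2 sqrt(p_i p_j) H'_ij / (p_i + p_j), from above by the classical fidelity of
   measurement outcomes in the eigenbasis of the symmetric logarithmic derivative. Neither side
   needs rho to be invertible.

   Both weights f satisfy a Monge inequality, so their upper triangles, like that of (h_m - h_n)^2,
   are nonnegative combinations of indicators of the rectangles {i <= k} x {j > l}. This reduces an
   upper bound for sum_ij f(i,j) |H'_ij|^2 to bounding, for coordinate projections E, E' in one
   basis and P, Q in the other with EE' = 0 = PQ, the number -Re tr(E P E' Q)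
   <= ||E (P - Q) E'||^2 / 4 by a quarter of the smallest of the four ranks. The bound is attained,
   for both weights at once, when the eigenvectors of the state are (e_i +- e_{d-1-i}) / sqrt 2 in
   the eigenbasis of H. *)

theory Submission
  imports Defs "Jordan_Normal_Form.Spectral_Radius" "HOL-Analysis.L2_Norm"
begin

section \<open>Adjoints, unitaries and unitary conjugates of diagonal matrices\<close>

text \<open>The two weights have in common little more than the order of \<open>p\<close>, so the
  maximizer may depend on the ranks of the eigenvalues but not on their sizes, and the bound on a
  weighted sum may use only the Monge inequality. The obstacle is that the coefficients of (h_m -
  h_n)^2 in |H'_ij|^2 have both signs: no entrywise bound works, only their sums over rectangles are
  controlled. Pairing i with d-1-i is optimal because it meets every rectangle with k <= l in as
  many pairs as its shorter side allows, and the pairs common to two such rectangles form the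
  shorter of two initial segments. So all rectangle bounds are tight together. The fidelity is
  squeezed rather than differentiated because the matrix square root is not differentiable at
  singular matrices. The two sides agree to second order for two reasons: measuring in the
  eigenbasis of the symmetric logarithmic derivative loses no Fisher information, and Z minimizes
  the Frobenius norm of Z sqrt(rho) - sqrt(rho) H' among Hermitian matrices.\<close>

lemma adj_dim [simp]: "dim_row (adj A) = dim_col A" "dim_col (adj A) = dim_row A"
  by (simp_all add: adj_def)

lemma adj_carrier [simp]: "A \<in> carrier_mat n m \<Longrightarrow> adj A \<in> carrier_mat m n"
  by (auto simp: adj_def)

lemma adj_index [simp]: "i < dim_col A \<Longrightarrow> j < dim_row A \<Longrightarrow> adj A $$ (i, j) = cnj (A $$ (j, i))"
  by (simp add: adj_def)

lemma adj_adj [simp]: "adj (adj A) = A"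
  by (rule eq_matI) auto

lemma mult_index:
  assumes "A \<in> carrier_mat n m" "B \<in> carrier_mat m p" "i < n" "j < p"
  shows "(A * B) $$ (i, j) = (\<Sum>k<m. A $$ (i, k) * B $$ (k, j))"
  using assms by (auto simp: scalar_prod_def lessThan_atLeast0 intro!: sum.cong)

lemma square_assoc:
  "A \<in> carrier_mat d d \<Longrightarrow> B \<in> carrier_mat d d \<Longrightarrow> C \<in> carrier_mat d d \<Longrightarrow> A * B * C = A * (B * C)"
  by (rule assoc_mult_mat)

lemma square_closed:
  "A \<in> carrier_mat d d \<Longrightarrow> B \<in> carrier_mat d d \<Longrightarrow> A * B \<in> carrier_mat d d"
  by (rule mult_carrier_mat)

lemma adj_mult:
  assumes "A \<in> carrier_mat n m" "B \<in> carrier_mat m p"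
  shows "adj (A * B) = adj B * adj A"
proof (rule eq_matI)
  fix i j assume "i < dim_row (adj B * adj A)" "j < dim_col (adj B * adj A)"
  hence "i < p" "j < n" using assms by auto
  then show "adj (A * B) $$ (i, j) = (adj B * adj A) $$ (i, j)"
    using assms by (simp add: mult_index[of _ n m _ p] mult_index[of _ p m _ n] mult.commute del: index_mult_mat(1))
qed (use assms in auto)

lemma mtrace_mult:
  assumes "A \<in> carrier_mat n m" "B \<in> carrier_mat m n"
  shows "mtrace (A * B) = (\<Sum>i<n. \<Sum>j<m. A $$ (i, j) * B $$ (j, i))"
  using assms unfolding mtrace_def by (auto simp: mult_index[of _ n m _ n] simp del: index_mult_mat(1) intro!: sum.cong)

lemma mtrace_mult_commute:
  assumes "A \<in> carrier_mat n m" "B \<in> carrier_mat m n"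
  shows "mtrace (A * B) = mtrace (B * A)"
  unfolding mtrace_mult[OF assms] mtrace_mult[OF assms(2,1)]
  by (subst sum.swap) (simp only: mult.commute)

lemma unitary_matD:
  assumes "unitary_mat d U"
  shows "U \<in> carrier_mat d d" "adj U * U = 1\<^sub>m d" "U * adj U = 1\<^sub>m d"
  using assms mat_mult_left_right_inverse[of "adj U" d U] unfolding unitary_mat_def by auto

lemma unitary_mat_one: "unitary_mat d (1\<^sub>m d)"
proof -
  have "adj (1\<^sub>m d) = 1\<^sub>m d" by (rule eq_matI) auto
  then show ?thesis by (simp add: unitary_mat_def)
qed

lemma unitary_mat_adj:
  assumes "unitary_mat d U"
  shows "unitary_mat d (adj U)"
  using unitary_matD[OF assms] by (simp add: unitary_mat_def)

lemma unitary_mat_mult: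
  assumes "unitary_mat d U" "unitary_mat d V"
  shows "unitary_mat d (U * V)"
proof -
  note U = unitary_matD[OF assms(1)] and V = unitary_matD[OF assms(2)]
  have "adj (U * V) * (U * V) = adj V * (adj U * U) * V"
    using U(1) V(1) by (simp only: adj_mult[OF U(1) V(1)] square_assoc[of _ d] square_closed[of _ d] adj_carrier)
  then show ?thesis using U V by (simp add: unitary_mat_def)
qed

text \<open>Products are normalised to right-nested form by \<open>square_assoc\<close>. There
  \<open>adj U * U\<close> is no longer a subterm, so the cancellation is stated with the tail
  \<open>A\<close> of the product.\<close>

lemma unitary_cancel:
  assumes "unitary_mat d U" "A \<in> carrier_mat d m"
  shows "adj U * (U * A) = A" "U * (adj U * A) = A"
proof -
  note U = unitary_matD[OF assms(1)]
  have "adj U * (U * A) = adj U * U * A"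
    by (rule assoc_mult_mat[symmetric, OF adj_carrier[OF U(1)] U(1) assms(2)])
  then show "adj U * (U * A) = A" using U(2) assms(2) by simp
  have "U * (adj U * A) = U * adj U * A"
    by (rule assoc_mult_mat[symmetric, OF U(1) adj_carrier[OF U(1)] assms(2)])
  then show "U * (adj U * A) = A" using U(3) assms(2) by simp
qed

lemma unitary_cols:
  assumes "unitary_mat d U" "i < d" "j < d"
  shows "(\<Sum>k<d. cnj (U $$ (k, i)) * U $$ (k, j)) = (if i = j then 1 else 0)"
proof -
  note U = unitary_matD[OF assms(1)]
  have "(adj U * U) $$ (i, j) = (\<Sum>k<d. cnj (U $$ (k, i)) * U $$ (k, j))"
    using U(1) assms by (simp add: mult_index[of _ d d _ d] del: index_mult_mat(1))
  then show ?thesis using U(2) assms by simp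
qed

lemma unitary_rows:
  assumes "unitary_mat d U" "i < d" "j < d"
  shows "(\<Sum>k<d. U $$ (i, k) * cnj (U $$ (j, k))) = (if i = j then 1 else 0)"
  using unitary_cols[OF unitary_mat_adj[OF assms(1)] assms(2,3)] unitary_matD(1)[OF assms(1)] assms(2,3)
  by simp

text \<open>Complex values of \<open>f\<close> let one notion cover states and Hamiltonians (real
  \<open>f\<close>), propagators (\<open>cis\<close>) and square roots; functions of an operator
  then act on \<open>f\<close> alone, with the eigenbasis \<open>V\<close> kept.\<close>

definition conj_diag :: "complex mat \<Rightarrow> (nat \<Rightarrow> complex) \<Rightarrow> complex mat" where
  "conj_diag V f = V * mat_diag (dim_col V) f * adj V"

lemma conj_diag_carrier [simp]: "V \<in> carrier_mat d d \<Longrightarrow> conj_diag V f \<in> carrier_mat d d"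
  by (auto simp: conj_diag_def)

lemma conj_diag_dim [simp]: "dim_row (conj_diag V f) = dim_row V" "dim_col (conj_diag V f) = dim_row V"
  by (auto simp: conj_diag_def)

lemma conj_diag_index:
  assumes "V \<in> carrier_mat n d" "i < n" "j < n"
  shows "conj_diag V f $$ (i, j) = (\<Sum>k<d. V $$ (i, k) * f k * cnj (V $$ (j, k)))"
  using assms unfolding conj_diag_def
  by (simp add: mat_diag_mult_right[of V n d] mult_index[of _ n d _ n] del: index_mult_mat(1))

lemma conj_diag_mult:
  assumes "unitary_mat d V"
  shows "conj_diag V f * conj_diag V g = conj_diag V (\<lambda>k. f k * g k)"
proof -
  note V = unitary_matD[OF assms]
  have "conj_diag V f * conj_diag V g
      = V * (mat_diag d f * (adj V * V) * mat_diag d g) * adj V"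
    using V(1) by (simp only: conj_diag_def square_assoc[of _ d] square_closed[of _ d] adj_carrier mat_diag_dim carrier_matD)
  then show ?thesis using V by (simp add: conj_diag_def right_mult_one_mat[of _ d d])
qed

lemma conj_diag_one:
  assumes "unitary_mat d V"
  shows "conj_diag V (\<lambda>k. 1) = 1\<^sub>m d"
  using unitary_matD[OF assms] by (simp add: conj_diag_def)

lemma adj_conj_diag: "adj (conj_diag V f) = conj_diag V (\<lambda>k. cnj (f k))"
proof (rule eq_matI)
  have V: "V \<in> carrier_mat (dim_row V) (dim_col V)" by simp
  fix i j assume "i < dim_row (conj_diag V (\<lambda>k. cnj (f k)))" "j < dim_col (conj_diag V (\<lambda>k. cnj (f k)))"
  then show "adj (conj_diag V f) $$ (i, j) = conj_diag V (\<lambda>k. cnj (f k)) $$ (i, j)"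
    by (simp add: conj_diag_index[OF V] mult_ac)
qed auto

lemma conj_diag_conj:
  assumes "A \<in> carrier_mat d d" "V \<in> carrier_mat d d"
  shows "A * conj_diag V f * adj A = conj_diag (A * V) f"
  using assms by (simp only: conj_diag_def adj_mult[OF assms] index_mult_mat square_assoc[of _ d] square_closed[of _ d] adj_carrier mat_diag_dim carrier_matD)

lemma mtrace_conj_diag:
  assumes "unitary_mat d V"
  shows "mtrace (conj_diag V f) = (\<Sum>k<d. f k)"
proof -
  note V = unitary_matD[OF assms]
  have "mtrace (conj_diag V f) = (\<Sum>i<d. \<Sum>k<d. f k * (cnj (V $$ (i, k)) * V $$ (i, k)))"
    using V(1) unfolding mtrace_def by (auto simp: conj_diag_index[OF V(1)] mult_ac)
  also have "\<dots> = (\<Sum>k<d. f k * (\<Sum>i<d. cnj (V $$ (i, k)) * V $$ (i, k)))"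
    by (subst sum.swap) (simp only: sum_distrib_left)
  also have "\<dots> = (\<Sum>k<d. f k)"
    by (intro sum.cong refl) (simp add: unitary_cols[OF assms])
  finally show ?thesis .
qed

lemma unitary_conj_diag:
  assumes "unitary_mat d V" "\<And>k. cmod (f k) = 1"
  shows "unitary_mat d (conj_diag V f)"
proof -
  have "cnj (f k) * f k = 1" for k
    using complex_norm_square[of "f k"] assms(2)[of k] by (simp add: mult.commute)
  then show ?thesis
    using assms(1) unitary_matD(1)[OF assms(1)]
    by (simp add: unitary_mat_def adj_conj_diag conj_diag_mult conj_diag_one)
qed

lemma hermitian_conj_diag:
  assumes "V \<in> carrier_mat d d"
  shows "hermitian d (conj_diag V (\<lambda>k. of_real (f k)))"
  using assms by (simp add: hermitian_def adj_conj_diag)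

lemma pow_conj_diag:
  assumes "unitary_mat d V"
  shows "(c \<cdot>\<^sub>m conj_diag V f) ^\<^sub>m n = conj_diag V (\<lambda>k. (c * f k) ^ n)"
proof (induction n)
  case 0
  then show ?case using conj_diag_one[OF assms] unitary_matD(1)[OF assms] by simp
next
  case (Suc n)
  have "c \<cdot>\<^sub>m conj_diag V f = conj_diag V (\<lambda>k. c * f k)"
    using unitary_matD(1)[OF assms]
    by (intro eq_matI) (auto simp: conj_diag_index[of V d d] sum_distrib_left mult_ac)
  with Suc show ?case
    by (simp add: conj_diag_mult[OF assms] mult.commute)
qed

text \<open>\<open>mat_exp\<close> is an entrywise series. Each entry of a power is a finite
  combination of scalar powers with coefficients independent of the exponent, so the scalar
  exponential series can be summed inside.\<close>

lemma mat_exp_conj_diag: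
  assumes V: "unitary_mat d V"
  shows "mat_exp (c \<cdot>\<^sub>m conj_diag V f) = conj_diag V (\<lambda>k. exp (c * f k))"
proof (rule eq_matI)
  note Vc = unitary_matD(1)[OF V]
  fix i j assume "i < dim_row (conj_diag V (\<lambda>k. exp (c * f k)))" "j < dim_col (conj_diag V (\<lambda>k. exp (c * f k)))"
  hence ij: "i < d" "j < d" using Vc by auto
  have "(\<lambda>n. V $$ (i, k) * ((c * f k) ^ n /\<^sub>R fact n) * cnj (V $$ (j, k)))
      sums (V $$ (i, k) * exp (c * f k) * cnj (V $$ (j, k)))" for k
    by (intro sums_mult sums_mult2 exp_converges)
  hence "(\<lambda>n. \<Sum>k<d. V $$ (i, k) * ((c * f k) ^ n /\<^sub>R fact n) * cnj (V $$ (j, k)))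
      sums (\<Sum>k<d. V $$ (i, k) * exp (c * f k) * cnj (V $$ (j, k)))"
    by (intro sums_sum)
  also have "(\<lambda>n. \<Sum>k<d. V $$ (i, k) * ((c * f k) ^ n /\<^sub>R fact n) * cnj (V $$ (j, k)))
      = (\<lambda>n. ((c \<cdot>\<^sub>m conj_diag V f) ^\<^sub>m n) $$ (i, j) / of_nat (fact n))"
    unfolding pow_conj_diag[OF V] using ij
    by (auto simp: conj_diag_index[OF Vc] sum_distrib_left scaleR_conv_of_real divide_inverse mult_ac)
  finally show "mat_exp (c \<cdot>\<^sub>m conj_diag V f) $$ (i, j) = conj_diag V (\<lambda>k. exp (c * f k)) $$ (i, j)"
    using ij Vc by (simp add: mat_exp_def conj_diag_index[OF Vc] sums_iff)
qed (auto simp: mat_exp_def)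

section \<open>The spectral theorem and matrix square roots\<close>

text \<open>Complete \<open>v\<close> to a basis, orthogonalise, and divide by the lengths
  \<open>sqrt (r j)\<close>. Gram-Schmidt keeps the first vector, so after normalisation the first
  column is \<open>v\<close> up to the scalar \<open>c\<close>.\<close>

lemma exists_unitary_first_col:
  fixes v :: "complex vec"
  assumes v: "v \<in> carrier_vec n" "v \<noteq> 0\<^sub>v n"
  obtains W c where "unitary_mat n W" "\<And>i. i < n \<Longrightarrow> W $$ (i, 0) = c * v $ i"
proof -
  interpret cof_vec_space n "TYPE(complex)" .
  define b where "b = basis_completion v"
  define ws where "ws = gram_schmidt n b"
  from basis_completion[OF v, folded b_def]
  have b: "set b \<subseteq> carrier_vec n" "distinct b" "\<not> lin_dep (set b)" "hd b = v" "length b = n"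
    by auto
  have n: "n > 0"
  proof (rule ccontr)
    assume "\<not> n > 0"
    hence "v = 0\<^sub>v n" using v(1) by (intro eq_vecI) auto
    with v(2) show False by simp
  qed
  obtain vs where bv: "b = v # vs" using b n by (cases b) auto
  from gram_schmidt_result[OF b(1-3) refl, folded ws_def]
  have ws: "set ws \<subseteq> carrier_vec n" "corthogonal ws" and len: "length ws = n"
    using b(5) by auto
  have hd: "ws ! 0 = v"
    using gram_schmidt_hd[OF v(1), of vs, folded bv, folded ws_def] len n by (cases ws) auto
  have wsc: "ws ! i \<in> carrier_vec n" if "i < n" for i using ws(1) len that nth_mem by blast
  define r where "r j = Re (ws ! j \<bullet>c ws ! j)" for j
  have ip: "ws ! i \<bullet>c ws ! j = (\<Sum>k<n. ws ! i $ k * cnj (ws ! j $ k))" if "i < n" "j < n" for i j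
    using wsc[OF that(1)] wsc[OF that(2)] by (auto simp: scalar_prod_def lessThan_atLeast0 intro!: sum.cong)
  have rr: "ws ! j \<bullet>c ws ! j = complex_of_real (r j)" "r j > 0" if "j < n" for j
  proof -
    have eq: "ws ! j \<bullet>c ws ! j = complex_of_real (\<Sum>k<n. (cmod (ws ! j $ k))\<^sup>2)"
      unfolding ip[OF that that] of_real_sum complex_norm_square ..
    then show 1: "ws ! j \<bullet>c ws ! j = complex_of_real (r j)" unfolding r_def by simp
    have "ws ! j \<bullet>c ws ! j \<noteq> 0" using corthogonalD[OF ws(2), of j j] that len by auto
    then have "r j \<noteq> 0" unfolding 1 by simp
    moreover have "r j \<ge> 0" unfolding r_def eq by (simp add: sum_nonneg)
    ultimately show "r j > 0" by simp
  qed
  define W where "W = mat n n (\<lambda>(i, j). ws ! j $ i / complex_of_real (sqrt (r j)))"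
  have "adj W * W = 1\<^sub>m n"
  proof (rule eq_matI)
    fix i j assume "i < dim_row (1\<^sub>m n)" "j < dim_col (1\<^sub>m n)"
    hence ij: "i < n" "j < n" by auto
    have "(adj W * W) $$ (i, j) = (\<Sum>k<n. cnj (ws ! i $ k) * ws ! j $ k / (complex_of_real (sqrt (r i)) * complex_of_real (sqrt (r j))))"
      using ij by (subst mult_index[of _ n n _ n]) (auto simp: W_def)
    also have "\<dots> = (ws ! j \<bullet>c ws ! i) / (complex_of_real (sqrt (r i)) * complex_of_real (sqrt (r j)))"
      using ij by (simp add: ip sum_divide_distrib mult.commute)
    also have "\<dots> = 1\<^sub>m n $$ (i, j)"
    proof (cases "i = j")
      case True
      have "complex_of_real (sqrt (r j)) * complex_of_real (sqrt (r j)) = complex_of_real (r j)"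
        using rr(2)[OF ij(2)] by (simp flip: of_real_mult)
      then show ?thesis using True ij rr[OF ij(2)] by simp
    next
      case False
      then show ?thesis using corthogonalD[OF ws(2), of j i] ij len by auto
    qed
    finally show "(adj W * W) $$ (i, j) = 1\<^sub>m n $$ (i, j)" .
  qed (auto simp: W_def)
  hence "unitary_mat n W" by (simp add: unitary_mat_def W_def)
  moreover have "W $$ (i, 0) = inverse (complex_of_real (sqrt (r 0))) * v $ i" if "i < n" for i
    using that n hd by (simp add: W_def divide_inverse mult.commute)
  ultimately show thesis by (rule that)
qed

lemma hermitian_unitary_conj:
  assumes "hermitian d A" "W \<in> carrier_mat d d"
  shows "hermitian d (adj W * A * W)"
proof -
  have A: "A \<in> carrier_mat d d" "adj A = A" using assms(1) by (auto simp: hermitian_def)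
  have "adj (adj W * A * W) = adj W * (adj A * adj (adj W))"
    using A(1) assms(2) by (simp only: adj_mult[of _ d d _ d] adj_carrier square_closed)
  also have "\<dots> = adj W * A * W"
    using A assms(2) by (simp only: adj_adj square_assoc[of _ d] adj_carrier)
  finally show ?thesis using A assms(2) unfolding hermitian_def by (simp add: square_closed[of _ d])
qed

text \<open>Deflation: in an orthonormal basis starting with an eigenvector, the first column of
  \<open>B\<close> is \<open>e\<close> times the first unit vector. Hermitian symmetry clears the
  first row as well, and the induction hypothesis diagonalises the remaining block
  \<open>C\<close>.\<close>

lemma hermitian_spectral:
  assumes "hermitian n A"
  shows "\<exists>V f. unitary_mat n V \<and> A = conj_diag V (\<lambda>k. complex_of_real (f k))"
  using assms
proof (induction n arbitrary: A)
  case 0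
  then have "A = conj_diag (1\<^sub>m 0) (\<lambda>k. complex_of_real 0)"
    by (intro eq_matI) (auto simp: hermitian_def)
  then show ?case using unitary_mat_one
    by (intro exI[of _ "1\<^sub>m 0"] exI[of _ "\<lambda>k. 0"] conjI) auto
next
  case (Suc m)
  let ?n = "Suc m"
  have A: "A \<in> carrier_mat ?n ?n" using Suc.prems by (simp add: hermitian_def)
  from spectrum_non_empty[OF A] obtain e where "eigenvalue A e" unfolding spectrum_def by auto
  then obtain v where v: "v \<in> carrier_vec ?n" "v \<noteq> 0\<^sub>v ?n" "A *\<^sub>v v = e \<cdot>\<^sub>v v"
    using A unfolding eigenvalue_def eigenvector_def by auto
  obtain W c where W: "unitary_mat ?n W" "\<And>i. i < ?n \<Longrightarrow> W $$ (i, 0) = c * v $ i"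
    using exists_unitary_first_col[OF v(1,2)] by blast
  note Wc = unitary_matD[OF W(1)]
  define B where "B = adj W * A * W"
  have Bh: "hermitian ?n B" unfolding B_def by (rule hermitian_unitary_conj[OF Suc.prems Wc(1)])
  hence B: "B \<in> carrier_mat ?n ?n" "adj B = B" by (auto simp: hermitian_def)
  have Bcnj: "B $$ (i, j) = cnj (B $$ (j, i))" if "i < ?n" "j < ?n" for i j
    using adj_index[of i B j] B that by simp
  have AW: "(A * W) $$ (i, 0) = e * W $$ (i, 0)" if "i < ?n" for i
  proof -
    have "(A * W) $$ (i, 0) = c * (\<Sum>k<?n. A $$ (i, k) * v $ k)"
      using that by (subst mult_index[OF A Wc(1)]) (auto simp: W(2) sum_distrib_left mult_ac simp del: sum.lessThan_Suc)
    also have "(\<Sum>k<?n. A $$ (i, k) * v $ k) = (A *\<^sub>v v) $ i"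
      using A v(1) that by (auto simp: scalar_prod_def lessThan_atLeast0 simp del: sum.lessThan_Suc intro!: sum.cong)
    also have "\<dots> = e * v $ i" using v that by simp
    finally show ?thesis using that by (simp add: W(2) mult_ac)
  qed
  have B0: "B $$ (i, 0) = (if i = 0 then e else 0)" if "i < ?n" for i
  proof -
    have "B = adj W * (A * W)" unfolding B_def using A Wc(1) by (simp only: square_assoc[of _ ?n] adj_carrier)
    hence "B $$ (i, 0) = (\<Sum>k<?n. cnj (W $$ (k, i)) * (e * W $$ (k, 0)))"
      using that AW Wc(1) A by (simp add: mult_index[of _ ?n ?n _ ?n] del: index_mult_mat(1) sum.lessThan_Suc)
    also have "\<dots> = e * (\<Sum>k<?n. cnj (W $$ (k, i)) * W $$ (k, 0))"
      by (simp only: sum_distrib_left mult_ac)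
    finally show ?thesis using unitary_cols[OF W(1) that, of 0] by (simp del: sum.lessThan_Suc)
  qed
  \<comment> \<open>The eigenvalue is a diagonal entry of the Hermitian matrix \<open>B\<close>,
    hence real.\<close>
  have e: "e = complex_of_real (Re e)"
    using Bcnj[of 0 0] B0[of 0] by (simp add: complex_eq_iff)
  define C where "C = mat m m (\<lambda>(i, j). B $$ (Suc i, Suc j))"
  have "hermitian m C" unfolding hermitian_def C_def
    by (auto intro!: eq_matI simp: Bcnj[symmetric])
  from Suc.IH[OF this] obtain V f where V: "unitary_mat m V" "C = conj_diag V (\<lambda>k. complex_of_real (f k))"
    by blast
  note Vc = unitary_matD(1)[OF V(1)]
  define V' where "V' = mat ?n ?n (\<lambda>(i, j). if i = 0 then (if j = 0 then 1 else 0)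
    else if j = 0 then 0 else V $$ (i - 1, j - 1))"
  have V'c: "V' \<in> carrier_mat ?n ?n" by (simp add: V'_def)
  define f' where "f' k = (if k = 0 then Re e else f (k - 1))" for k
  have "adj V' * V' = 1\<^sub>m ?n"
  proof (rule eq_matI)
    fix i j assume ij: "i < dim_row (1\<^sub>m ?n)" "j < dim_col (1\<^sub>m ?n)"
    hence "(adj V' * V') $$ (i, j) = (\<Sum>k<?n. cnj (V' $$ (k, i)) * V' $$ (k, j))"
      using V'c by (simp add: mult_index[of _ ?n ?n _ ?n] del: index_mult_mat(1) sum.lessThan_Suc)
    also have "\<dots> = 1\<^sub>m ?n $$ (i, j)"
      using ij unitary_cols[OF V(1), of "i - 1" "j - 1"]
      unfolding sum.lessThan_Suc_shift by (cases i; cases j) (auto simp: V'_def)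
    finally show "(adj V' * V') $$ (i, j) = 1\<^sub>m ?n $$ (i, j)" .
  qed (use V'c in auto)
  hence V': "unitary_mat ?n V'" using V'c by (simp add: unitary_mat_def)
  have "B = conj_diag V' (\<lambda>k. complex_of_real (f' k))"
  proof (rule eq_matI)
    fix i j assume "i < dim_row (conj_diag V' (\<lambda>k. complex_of_real (f' k)))"
      "j < dim_col (conj_diag V' (\<lambda>k. complex_of_real (f' k)))"
    hence ij: "i < ?n" "j < ?n" using V'c by auto
    have "conj_diag V' (\<lambda>k. complex_of_real (f' k)) $$ (i, j)
      = (\<Sum>k<?n. V' $$ (i, k) * complex_of_real (f' k) * cnj (V' $$ (j, k)))"
      by (rule conj_diag_index[OF V'c ij])
    also have "\<dots> = B $$ (i, j)"
    proof (cases "i = 0 \<or> j = 0")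
      case True
      then show ?thesis
        using ij B0[of i] B0[of j] Bcnj[of i j] e unfolding sum.lessThan_Suc_shift
        by (cases i; cases j) (auto simp: V'_def f'_def)
    next
      case False
      then obtain a b where ab: "i = Suc a" "j = Suc b" by (meson not0_implies_Suc)
      hence "B $$ (i, j) = C $$ (a, b)" using ij by (simp add: C_def)
      also have "\<dots> = (\<Sum>k<m. V $$ (a, k) * complex_of_real (f k) * cnj (V $$ (b, k)))"
        unfolding V(2) by (rule conj_diag_index[OF Vc]) (use ij ab in auto)
      finally show ?thesis using ij ab unfolding sum.lessThan_Suc_shift by (simp add: V'_def f'_def)
    qed
    finally show "B $$ (i, j) = conj_diag V' (\<lambda>k. complex_of_real (f' k)) $$ (i, j)" by simp
  qed (use B V'c in auto)
  moreover have "A = W * B * adj W"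
  proof -
    have "W * B * adj W = W * (adj W * (A * (W * adj W)))"
      unfolding B_def using A Wc(1) by (simp only: square_assoc[of _ ?n] square_closed[of _ ?n] adj_carrier)
    also have "\<dots> = A" using A Wc unitary_cancel(2)[OF W(1) A] by simp
    finally show ?thesis by simp
  qed
  ultimately have "A = conj_diag (W * V') (\<lambda>k. complex_of_real (f' k))"
    using conj_diag_conj[OF Wc(1) V'c] by simp
  then show ?case using unitary_mat_mult[OF W(1) V']
    by (intro exI[of _ "W * V'"] exI[of _ f'] conjI)
qed

text \<open>Permuting the columns of \<open>V\<close> along a list sorted by \<open>- f\<close>
  permutes the eigenvalues with them. The decreasing order is what makes the later weights
  Monge.\<close>

lemma hermitian_spectral_sorted:
  assumes "hermitian n A"
  obtains V f where "unitary_mat n V" "A = conj_diag V (\<lambda>k. complex_of_real (f k))"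
    "antimono_on {..<n} f"
proof -
  obtain V f where V: "unitary_mat n V" and A: "A = conj_diag V (\<lambda>k. complex_of_real (f k))"
    using hermitian_spectral[OF assms] by (elim exE conjE)
  note Vc = unitary_matD(1)[OF V]
  define xs where "xs = sort_key (\<lambda>i. - f i) [0..<n]"
  have len: "length xs = n" and dist: "distinct xs" and set: "set xs = {..<n}"
    by (auto simp: xs_def)
  have bij: "bij_betw ((!) xs) {..<n} {..<n}"
    by (rule bij_betw_nth[OF dist]) (auto simp: len set)
  have lt: "xs ! i < n" if "i < n" for i using bij that by (auto dest: bij_betwE)
  have mono: "f (xs ! j) \<le> f (xs ! i)" if "i \<le> j" "j < n" for i j
  proof -
    have "sorted (map (\<lambda>i. - f i) xs)" by (simp add: xs_def)
    from sorted_nth_mono[OF this that(1)] show ?thesis using that len by simp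
  qed
  define W where "W = mat n n (\<lambda>(i, j). V $$ (i, xs ! j))"
  have Wc: "W \<in> carrier_mat n n" by (simp add: W_def)
  have "adj W * W = 1\<^sub>m n"
  proof (rule eq_matI)
    fix i j assume ij: "i < dim_row (1\<^sub>m n)" "j < dim_col (1\<^sub>m n)"
    hence "(adj W * W) $$ (i, j) = (\<Sum>k<n. cnj (V $$ (k, xs ! i)) * V $$ (k, xs ! j))"
      by (subst mult_index[of _ n n _ n]) (auto simp: W_def)
    also have "\<dots> = 1\<^sub>m n $$ (i, j)"
      using ij lt unitary_cols[OF V] nth_eq_iff_index_eq[OF dist] len by simp
    finally show "(adj W * W) $$ (i, j) = 1\<^sub>m n $$ (i, j)" .
  qed (use Wc in auto)
  hence W: "unitary_mat n W" using Wc by (simp add: unitary_mat_def)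
  have "A = conj_diag W (\<lambda>k. complex_of_real (f (xs ! k)))"
  proof (rule eq_matI)
    fix i j assume "i < dim_row (conj_diag W (\<lambda>k. complex_of_real (f (xs ! k))))"
      "j < dim_col (conj_diag W (\<lambda>k. complex_of_real (f (xs ! k))))"
    hence ij: "i < n" "j < n" by (auto simp: W_def)
    have "A $$ (i, j) = (\<Sum>k<n. V $$ (i, k) * f k * cnj (V $$ (j, k)))"
      unfolding A by (rule conj_diag_index[OF Vc ij])
    also have "\<dots> = (\<Sum>k<n. V $$ (i, xs ! k) * f (xs ! k) * cnj (V $$ (j, xs ! k)))"
      by (rule sum.reindex_bij_betw[OF bij, symmetric])
    also have "\<dots> = conj_diag W (\<lambda>k. complex_of_real (f (xs ! k))) $$ (i, j)"
      unfolding conj_diag_index[OF Wc ij] using ij by (auto simp: W_def)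
    finally show "A $$ (i, j) = conj_diag W (\<lambda>k. complex_of_real (f (xs ! k))) $$ (i, j)" .
  qed (use Vc in \<open>auto simp: A W_def\<close>)
  moreover have "antimono_on {..<n} (\<lambda>k. f (xs ! k))"
    by (rule monotone_onI) (use mono in auto)
  ultimately show thesis by (rule that[OF W])
qed

section \<open>Positivity and the uniqueness of the positive square root\<close>

lemma quadratic_form_conj_diag:
  assumes V: "V \<in> carrier_mat d d" and v: "v \<in> carrier_vec d"
  shows "(conj_diag V (\<lambda>k. complex_of_real (f k)) *\<^sub>v v) \<bullet>c v
    = complex_of_real (\<Sum>k<d. f k * (cmod (\<Sum>i<d. cnj (V $$ (i, k)) * v $ i))\<^sup>2)"
proof -
  have "(conj_diag V (\<lambda>k. complex_of_real (f k)) *\<^sub>v v) \<bullet>c v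
      = (\<Sum>i<d. (\<Sum>j<d. conj_diag V (\<lambda>k. complex_of_real (f k)) $$ (i, j) * v $ j) * cnj (v $ i))"
    using V v by (auto simp: scalar_prod_def lessThan_atLeast0 intro!: sum.cong)
  also have "\<dots> = (\<Sum>i<d. \<Sum>j<d. \<Sum>k<d. f k * ((cnj (V $$ (j, k)) * v $ j) * cnj (cnj (V $$ (i, k)) * v $ i)))"
    by (auto simp: conj_diag_index[OF V] sum_distrib_left sum_distrib_right mult_ac intro!: sum.cong)
  also have "\<dots> = (\<Sum>i<d. \<Sum>k<d. \<Sum>j<d. f k * ((cnj (V $$ (j, k)) * v $ j) * cnj (cnj (V $$ (i, k)) * v $ i)))"
    by (intro sum.cong refl sum.swap)
  also have "\<dots> = (\<Sum>k<d. \<Sum>i<d. \<Sum>j<d. f k * ((cnj (V $$ (j, k)) * v $ j) * cnj (cnj (V $$ (i, k)) * v $ i)))"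
    by (rule sum.swap)
  also have "\<dots> = (\<Sum>k<d. \<Sum>j<d. \<Sum>i<d. f k * ((cnj (V $$ (j, k)) * v $ j) * cnj (cnj (V $$ (i, k)) * v $ i)))"
    by (intro sum.cong refl sum.swap)
  also have "\<dots> = (\<Sum>k<d. f k * ((\<Sum>j<d. cnj (V $$ (j, k)) * v $ j) * cnj (\<Sum>i<d. cnj (V $$ (i, k)) * v $ i)))"
    by (simp only: sum_product cnj_sum) (simp only: sum_distrib_left)
  finally show ?thesis by (simp only: of_real_sum of_real_mult complex_norm_square)
qed

lemma psd_conj_diag:
  assumes "V \<in> carrier_mat d d" "\<And>k. k < d \<Longrightarrow> 0 \<le> f k"
  shows "psd d (conj_diag V (\<lambda>k. complex_of_real (f k)))"
  using assms hermitian_conj_diag[OF assms(1), of f]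
  by (auto simp: psd_def quadratic_form_conj_diag intro!: sum_nonneg)

text \<open>The test vector is column \<open>k\<close> of \<open>V\<close>, a unit eigenvector for
  \<open>f k\<close>.\<close>

lemma psd_conj_diag_nonneg:
  assumes "psd d (conj_diag V (\<lambda>k. complex_of_real (f k)))" and V: "unitary_mat d V" and k: "k < d"
  shows "0 \<le> f k"
proof -
  note Vc = unitary_matD(1)[OF V]
  have c: "col V k \<in> carrier_vec d" using Vc k by auto
  have "(conj_diag V (\<lambda>k. complex_of_real (f k)) *\<^sub>v col V k) \<bullet>c col V k
      = complex_of_real (\<Sum>l<d. f l * (cmod (\<Sum>i<d. cnj (V $$ (i, l)) * V $$ (i, k)))\<^sup>2)"
    unfolding quadratic_form_conj_diag[OF Vc c] using Vc k by simp
  also have "(\<Sum>l<d. f l * (cmod (\<Sum>i<d. cnj (V $$ (i, l)) * V $$ (i, k)))\<^sup>2)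
      = (\<Sum>l<d. if l = k then f l else 0)"
    by (intro sum.cong refl) (simp add: unitary_cols[OF V] k)
  also have "\<dots> = f k" using k by simp
  finally show ?thesis using assms(1) c by (auto simp: psd_def)
qed

text \<open>Multiplying by \<open>adj V\<close> on the left and by \<open>W\<close> on the right
  turns the equation into one between a diagonal matrix times G and G times a diagonal matrix, G =
  \<open>adj V * W\<close>. It says that \<open>f i\<close> and \<open>g j\<close> agree wherever G
  has a nonzero entry, a condition inherited by functions of the eigenvalues.\<close>

lemma conj_diag_eq_iff:
  assumes V: "unitary_mat d V" and W: "unitary_mat d W"
  shows "conj_diag V f = conj_diag W g \<longleftrightarrow>
    (\<forall>i<d. \<forall>j<d. f i * (adj V * W) $$ (i, j) = (adj V * W) $$ (i, j) * g j)"
proof -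
  note Vc = unitary_matD[OF V] and Wc = unitary_matD[OF W]
  define G where "G = adj V * W"
  have G: "G \<in> carrier_mat d d" unfolding G_def using Vc(1) Wc(1) by (simp add: square_closed)
  have VG: "V * G = W" and GW: "G * adj W = adj V"
    unfolding G_def using unitary_cancel(2)[OF V Wc(1)] Vc(1) Wc(1,3)
    by (simp_all only: square_assoc[of _ d] adj_carrier) simp
  have 1: "mat_diag d f * G = adj V * conj_diag V f * W"
    using Vc(1) Wc(1) unitary_cancel(1)[OF V, of "mat_diag d f * G" d] G unfolding conj_diag_def G_def
    by (simp only: carrier_matD square_assoc[of _ d] square_closed[of _ d] adj_carrier mat_diag_dim)
  have 2: "G * mat_diag d g = adj V * conj_diag W g * W"
    using Vc(1) Wc(1,2) unfolding conj_diag_def G_def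
    by (simp only: carrier_matD square_assoc[of _ d] square_closed[of _ d] adj_carrier mat_diag_dim right_mult_one_mat[of _ d d])
  have 3: "conj_diag V f = V * (mat_diag d f * G) * adj W"
    using Vc(1) Wc(1) G GW unfolding conj_diag_def
    by (simp only: carrier_matD square_assoc[of _ d] square_closed[of _ d] adj_carrier mat_diag_dim)
  have 4: "conj_diag W g = V * (G * mat_diag d g) * adj W"
    using Vc(1) Wc(1) G unfolding conj_diag_def VG[symmetric]
    by (simp only: carrier_matD square_assoc[of _ d] square_closed[of _ d] adj_carrier mat_diag_dim index_mult_mat)
  have "conj_diag V f = conj_diag W g \<longleftrightarrow> mat_diag d f * G = G * mat_diag d g"
    using 1 2 3 4 by metis
  also have "\<dots> \<longleftrightarrow> (\<forall>i<d. \<forall>j<d. f i * G $$ (i, j) = G $$ (i, j) * g j)"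
    unfolding mat_diag_mult_left[OF G] mat_diag_mult_right[OF G] by (auto simp: mat_eq_iff)
  finally show ?thesis unfolding G_def .
qed

text \<open>\<open>msqrt\<close> is a definite description, so uniqueness is the main point. A
  second root is diagonalised in its own basis \<open>W\<close>; wherever \<open>adj V * W\<close>
  is nonzero, \<open>p i\<close> is the square of the nonnegative \<open>b j\<close>, so the two
  roots agree by \<open>conj_diag_eq_iff\<close>.\<close>

lemma msqrt_conj_diag:
  assumes V: "unitary_mat d V" and p: "\<And>k. k < d \<Longrightarrow> 0 \<le> p k"
  shows "msqrt (conj_diag V (\<lambda>k. complex_of_real (p k))) = conj_diag V (\<lambda>k. complex_of_real (sqrt (p k)))"
  (is "msqrt ?A = ?R")
  unfolding msqrt_def
proof (rule the_equality)
  note Vc = unitary_matD(1)[OF V]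
  have d: "dim_row ?A = d" using Vc by simp
  have "?R * ?R = ?A"
    unfolding conj_diag_mult[OF V]
    by (rule eq_matI) (use Vc p in \<open>auto simp: conj_diag_index[OF Vc] simp flip: of_real_mult intro!: sum.cong\<close>)
  then show "psd (dim_row ?A) ?R \<and> ?R * ?R = ?A"
    unfolding d using psd_conj_diag[OF Vc, of "\<lambda>k. sqrt (p k)"] p by simp
  fix B assume "psd (dim_row ?A) B \<and> B * B = ?A"
  hence B: "psd d B" "B * B = ?A" unfolding d by auto
  then obtain W b where W: "unitary_mat d W" and Bd: "B = conj_diag W (\<lambda>k. complex_of_real (b k))"
    using hermitian_spectral[of d B] unfolding psd_def by blast
  have b: "b k \<ge> 0" if "k < d" for k
    using psd_conj_diag_nonneg[OF _ W that, of b] B(1) Bd by simp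
  have "conj_diag V (\<lambda>k. complex_of_real (p k)) = conj_diag W (\<lambda>k. complex_of_real (b k) * complex_of_real (b k))"
    using B(2) unfolding Bd conj_diag_mult[OF W] by simp
  then have eq: "complex_of_real (p i) * (adj V * W) $$ (i, j) = (adj V * W) $$ (i, j) * (complex_of_real (b j) * complex_of_real (b j))"
    if "i < d" "j < d" for i j
    unfolding conj_diag_eq_iff[OF V W] using that by blast
  have "?R = B" unfolding Bd conj_diag_eq_iff[OF V W]
  proof (intro allI impI)
    fix i j assume ij: "i < d" "j < d"
    show "complex_of_real (sqrt (p i)) * (adj V * W) $$ (i, j) = (adj V * W) $$ (i, j) * complex_of_real (b j)"
    proof (cases "(adj V * W) $$ (i, j) = 0")
      case False
      with eq[OF ij] have "complex_of_real (p i) = complex_of_real (b j * b j)" by simp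
      hence "p i = b j * b j" by (simp only: of_real_eq_iff)
      then show ?thesis using b[OF ij(2)] by simp
    qed simp
  qed
  then show "B = ?R" by simp
qed

section \<open>Trace norm bounds\<close>

lemma complex_cauchy_schwarz:
  fixes a b :: "'i \<Rightarrow> complex"
  shows "cmod (\<Sum>i\<in>I. a i * b i) \<le> sqrt (\<Sum>i\<in>I. (cmod (a i))\<^sup>2) * sqrt (\<Sum>i\<in>I. (cmod (b i))\<^sup>2)"
proof -
  have "cmod (\<Sum>i\<in>I. a i * b i) \<le> (\<Sum>i\<in>I. \<bar>cmod (a i)\<bar> * \<bar>cmod (b i)\<bar>)"
    by (rule order_trans[OF norm_sum]) (simp add: norm_mult)
  then show ?thesis
    using L2_set_mult_ineq[of "\<lambda>i. cmod (a i)" "\<lambda>i. cmod (b i)" I] unfolding L2_set_def by linarith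
qed

text \<open>Expand the squared norm of \<open>b - y\<close>, where \<open>y\<close> is the candidate
  projection of \<open>b\<close>. The squared lengths \<open>e i\<close> may be below 1 because the
  normalised singular vectors to which this is applied are zero where the singular value is
  zero.\<close>

lemma bessel:
  fixes F :: "nat \<Rightarrow> nat \<Rightarrow> complex" and e :: "nat \<Rightarrow> real"
  assumes F: "\<And>i j. i < d \<Longrightarrow> j < d \<Longrightarrow>
      (\<Sum>k<d. cnj (F k i) * F k j) = (if i = j then complex_of_real (e i) else 0)"
    and e: "\<And>i. i < d \<Longrightarrow> e i \<le> 1"
  shows "(\<Sum>i<d. (cmod (\<Sum>k<d. cnj (F k i) * b k))\<^sup>2) \<le> (\<Sum>k<d. (cmod (b k))\<^sup>2)"
proof -
  define x where "x i = (\<Sum>k<d. cnj (F k i) * b k)" for i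
  define y where "y k = (\<Sum>i<d. F k i * x i)" for k
  have yb: "(\<Sum>k<d. cnj (y k) * b k) = complex_of_real (\<Sum>i<d. (cmod (x i))\<^sup>2)"
  proof -
    have "(\<Sum>k<d. cnj (y k) * b k) = (\<Sum>k<d. \<Sum>i<d. cnj (x i) * (cnj (F k i) * b k))"
      by (simp add: y_def sum_distrib_left sum_distrib_right mult_ac)
    also have "\<dots> = (\<Sum>i<d. x i * cnj (x i))"
      by (subst sum.swap) (simp only: sum_distrib_left[symmetric] x_def[symmetric], simp only: mult.commute)
    finally show ?thesis by (simp only: of_real_sum complex_norm_square)
  qed
  have yy: "(\<Sum>k<d. cnj (y k) * y k) = complex_of_real (\<Sum>i<d. e i * (cmod (x i))\<^sup>2)"
  proof -
    have "(\<Sum>k<d. cnj (y k) * y k)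
        = (\<Sum>k<d. \<Sum>i<d. \<Sum>j<d. cnj (x i) * x j * (cnj (F k i) * F k j))"
      unfolding y_def cnj_sum sum_product by (intro sum.cong refl) (simp add: mult_ac)
    also have "\<dots> = (\<Sum>i<d. \<Sum>j<d. \<Sum>k<d. cnj (x i) * x j * (cnj (F k i) * F k j))"
      by (rule trans[OF sum.swap sum.cong[OF refl sum.swap]])
    also have "\<dots> = (\<Sum>i<d. \<Sum>j<d. if i = j then e i * (x i * cnj (x i)) else 0)"
      unfolding sum_distrib_left[symmetric] using F by (intro sum.cong refl) simp
    finally show ?thesis by (simp only: of_real_sum complex_norm_square of_real_mult) simp
  qed
  have "complex_of_real (\<Sum>k<d. (cmod (b k - y k))\<^sup>2)
      = (\<Sum>k<d. b k * cnj (b k)) - (\<Sum>k<d. cnj (y k) * b k) - cnj (\<Sum>k<d. cnj (y k) * b k) + (\<Sum>k<d. cnj (y k) * y k)"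
    unfolding of_real_sum complex_norm_square cnj_sum sum.distrib[symmetric] sum_subtractf[symmetric]
    by (intro sum.cong refl) (simp add: algebra_simps)
  also have "\<dots> = complex_of_real ((\<Sum>k<d. (cmod (b k))\<^sup>2) - 2 * (\<Sum>i<d. (cmod (x i))\<^sup>2) + (\<Sum>i<d. e i * (cmod (x i))\<^sup>2))"
  proof -
    have bb: "(\<Sum>k<d. b k * cnj (b k)) = complex_of_real (\<Sum>k<d. (cmod (b k))\<^sup>2)"
      by (simp only: of_real_sum complex_norm_square)
    have "complex_of_real B - complex_of_real X - cnj (complex_of_real X) + complex_of_real T
      = complex_of_real (B - 2 * X + T)" for B X T :: real
      by simp
    then show ?thesis unfolding yb yy bb .
  qed
  finally have "(\<Sum>k<d. (cmod (b k - y k))\<^sup>2)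
      = (\<Sum>k<d. (cmod (b k))\<^sup>2) - 2 * (\<Sum>i<d. (cmod (x i))\<^sup>2) + (\<Sum>i<d. e i * (cmod (x i))\<^sup>2)"
    by (simp only: of_real_eq_iff)
  moreover have "(\<Sum>i<d. e i * (cmod (x i))\<^sup>2) \<le> (\<Sum>i<d. (cmod (x i))\<^sup>2)"
    by (intro sum_mono) (use mult_right_mono[OF e] in fastforce)
  moreover have "0 \<le> (\<Sum>k<d. (cmod (b k - y k))\<^sup>2)" by (simp add: sum_nonneg)
  ultimately show ?thesis unfolding x_def by linarith
qed

text \<open>The right half of a singular value decomposition: \<open>E\<close> diagonalises
  \<open>adj A * A\<close>, so the columns of \<open>A * E\<close> are orthogonal with lengths
  \<open>s i\<close>. Left singular vectors are left out, being undetermined where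
  \<open>s i = 0\<close>.\<close>

lemma trace_norm_svd:
  assumes A: "A \<in> carrier_mat d d"
  obtains E s where "unitary_mat d E" "\<And>k. 0 \<le> s k" "trace_norm A = (\<Sum>k<d. s k)"
    "\<And>i j. i < d \<Longrightarrow> j < d \<Longrightarrow> (\<Sum>k<d. cnj ((A * E) $$ (k, i)) * (A * E) $$ (k, j))
       = (if i = j then complex_of_real ((s i)\<^sup>2) else 0)"
proof -
  have AA: "adj A * A \<in> carrier_mat d d" using A by (simp add: square_closed)
  have "hermitian d (adj A * A)"
    using AA A unfolding hermitian_def by (simp add: adj_mult[of _ d d _ d])
  then obtain E f where E: "unitary_mat d E" and f: "adj A * A = conj_diag E (\<lambda>k. complex_of_real (f k))"
    using hermitian_spectral by blast
  note Ec = unitary_matD[OF E]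
  have AE: "A * E \<in> carrier_mat d d" using A Ec by (simp add: square_closed)
  have "adj (A * E) * (A * E) = adj E * (adj A * A) * E"
    using A Ec(1) by (simp only: adj_mult[of _ d d _ d] square_assoc[of _ d] square_closed[of _ d] adj_carrier)
  also have "\<dots> = mat_diag d (\<lambda>k. complex_of_real (f k)) * (adj E * E)"
    unfolding f conj_diag_def using Ec(1) unitary_cancel(1)[OF E, of "mat_diag d (\<lambda>k. complex_of_real (f k)) * (adj E * E)" d]
    by (simp only: carrier_matD square_assoc[of _ d] square_closed[of _ d] adj_carrier mat_diag_dim)
  also have "\<dots> = mat_diag d (\<lambda>k. complex_of_real (f k))"
    using Ec(2) by (simp add: right_mult_one_mat[of _ d d])
  finally have "(adj (A * E) * (A * E)) $$ (i, j) = (if i = j then complex_of_real (f i) else 0)" if "i < d" "j < d" for i j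
    using that by (simp add: mat_diag_def)
  then have orth: "(\<Sum>k<d. cnj ((A * E) $$ (k, i)) * (A * E) $$ (k, j)) = (if i = j then complex_of_real (f i) else 0)"
    if "i < d" "j < d" for i j
    using that AE A Ec(1) mult_index[of "adj (A * E)" d d "A * E" d i j] by (simp del: index_mult_mat(1))
  have f0: "f k \<ge> 0" if "k < d" for k
  proof -
    have "complex_of_real (f k) = complex_of_real (\<Sum>l<d. (cmod ((A * E) $$ (l, k)))\<^sup>2)"
      unfolding of_real_sum complex_norm_square using orth[OF that that] by (simp only: mult.commute) simp
    then show ?thesis by (simp only: of_real_eq_iff) (simp add: sum_nonneg)
  qed
  \<comment> \<open>The absolute value makes \<open>s\<close> nonnegative at every index;
    \<open>f\<close> is controlled only below \<open>d\<close>.\<close>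
  define s where "s k = sqrt \<bar>f k\<bar>" for k
  have "msqrt (adj A * A) = conj_diag E (\<lambda>k. complex_of_real (sqrt (f k)))"
    unfolding f by (rule msqrt_conj_diag[OF E f0])
  then have "trace_norm A = (\<Sum>k<d. s k)"
    unfolding trace_norm_def by (simp add: mtrace_conj_diag[OF E] s_def f0)
  from that[OF E _ this] show thesis using orth f0 by (simp add: s_def)
qed

text \<open>By cyclicity the trace is that of \<open>X * (A * E)\<close> with \<open>X\<close>
  unitary. Its i-th diagonal entry pairs a unit row of \<open>X\<close> with a column of length
  \<open>s i\<close>, and Cauchy-Schwarz gives at most \<open>s i\<close>.\<close>

lemma trace_norm_ge:
  assumes A: "A \<in> carrier_mat d d" and W: "unitary_mat d W"
  shows "Re (mtrace (W * A)) \<le> trace_norm A"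
proof -
  obtain E s where E: "unitary_mat d E" and s: "\<And>k. 0 \<le> s k" and tn: "trace_norm A = (\<Sum>k<d. s k)"
    and orth: "\<And>i j. i < d \<Longrightarrow> j < d \<Longrightarrow> (\<Sum>k<d. cnj ((A * E) $$ (k, i)) * (A * E) $$ (k, j))
       = (if i = j then complex_of_real ((s i)\<^sup>2) else 0)"
    using trace_norm_svd[OF A] by blast
  note Ec = unitary_matD[OF E] and Wc = unitary_matD[OF W]
  define X where "X = adj E * W"
  have X: "unitary_mat d X" unfolding X_def by (rule unitary_mat_mult[OF unitary_mat_adj[OF E] W])
  note Xc = unitary_matD(1)[OF X]
  have AE: "A * E \<in> carrier_mat d d" using A Ec by (simp add: square_closed)
  have "W * A = E * (X * A)"
    unfolding X_def using A Ec(1) Wc(1) unitary_cancel(2)[OF E, of "W * A" d]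
    by (simp only: square_assoc[of _ d] square_closed[of _ d] adj_carrier)
  then have "mtrace (W * A) = mtrace (X * A * E)"
    using mtrace_mult_commute[of E d d "X * A"] Ec(1) Xc A by (simp only: square_closed)
  also have "X * A * E = X * (A * E)" using A Ec(1) Xc by (simp only: square_assoc[of _ d])
  also have "mtrace (X * (A * E)) = (\<Sum>i<d. \<Sum>k<d. X $$ (i, k) * (A * E) $$ (k, i))"
    by (rule mtrace_mult[OF Xc AE])
  finally have "Re (mtrace (W * A)) = (\<Sum>i<d. Re (\<Sum>k<d. X $$ (i, k) * (A * E) $$ (k, i)))" by simp
  also have "\<dots> \<le> (\<Sum>i<d. s i)"
  proof (rule sum_mono)
    fix i assume "i \<in> {..<d}"
    hence i: "i < d" by simp
    have "complex_of_real (\<Sum>k<d. (cmod ((A * E) $$ (k, i)))\<^sup>2) = complex_of_real ((s i)\<^sup>2)"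
      unfolding of_real_sum complex_norm_square using orth[OF i i] by (simp only: mult.commute) simp
    hence 1: "(\<Sum>k<d. (cmod ((A * E) $$ (k, i)))\<^sup>2) = (s i)\<^sup>2" by (simp only: of_real_eq_iff)
    have "complex_of_real (\<Sum>k<d. (cmod (X $$ (i, k)))\<^sup>2) = 1"
      unfolding of_real_sum complex_norm_square using unitary_rows[OF X i i] by simp
    hence 2: "(\<Sum>k<d. (cmod (X $$ (i, k)))\<^sup>2) = 1" by (simp only: of_real_eq_1_iff)
    have "Re (\<Sum>k<d. X $$ (i, k) * (A * E) $$ (k, i)) \<le> cmod (\<Sum>k<d. X $$ (i, k) * (A * E) $$ (k, i))"
      by (rule complex_Re_le_cmod)
    also have "\<dots> \<le> sqrt 1 * sqrt ((s i)\<^sup>2)"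
      unfolding 1[symmetric] 2[symmetric] by (rule complex_cauchy_schwarz)
    finally show "Re (\<Sum>k<d. X $$ (i, k) * (A * E) $$ (k, i)) \<le> s i" using s[of i] by simp
  qed
  finally show ?thesis using tn by simp
qed

text \<open>In effect the triangle inequality for \<open>B * C\<close> as a sum over
  \<open>a\<close> of the rank-one products (column \<open>a\<close> of \<open>B\<close>) times (row
  \<open>a\<close> of \<open>C\<close>). The trace norm is written with the singular vectors of the
  product, the sums are exchanged, and for each \<open>a\<close> Cauchy-Schwarz and Bessel
  apply.\<close>

lemma trace_norm_mult_le:
  assumes B: "B \<in> carrier_mat d d" and C: "C \<in> carrier_mat d d"
  shows "trace_norm (B * C)
    \<le> (\<Sum>a<d. sqrt (\<Sum>i<d. (cmod (B $$ (i, a)))\<^sup>2) * sqrt (\<Sum>j<d. (cmod (C $$ (a, j)))\<^sup>2))"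
proof -
  have BC: "B * C \<in> carrier_mat d d" using B C by (simp add: square_closed)
  obtain E s where E: "unitary_mat d E" and s: "\<And>k. 0 \<le> s k" and tn: "trace_norm (B * C) = (\<Sum>k<d. s k)"
    and orth: "\<And>i j. i < d \<Longrightarrow> j < d \<Longrightarrow> (\<Sum>k<d. cnj ((B * C * E) $$ (k, i)) * (B * C * E) $$ (k, j))
       = (if i = j then complex_of_real ((s i)\<^sup>2) else 0)"
    using trace_norm_svd[OF BC] by blast
  note Ec = unitary_matD[OF E]
  define Y where "Y k i = (B * C * E) $$ (k, i)" for k i
  define Z where "Z = C * E"
  have Z: "Z \<in> carrier_mat d d" unfolding Z_def using C Ec by (simp add: square_closed)
  have Y: "Y k i = (\<Sum>a<d. B $$ (k, a) * Z $$ (a, i))" if "k < d" "i < d" for k i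
    unfolding Y_def square_assoc[OF B C Ec(1)] using mult_index[OF B Z that] unfolding Z_def .
  \<comment> \<open>Left singular vectors; where \<open>s i = 0\<close>, division by zero gives the
    zero vector.\<close>
  define F where "F k i = Y k i / complex_of_real (s i)" for k i
  have FY: "(\<Sum>k<d. cnj (F k i) * Y k i) = s i" if "i < d" for i
  proof -
    have "(\<Sum>k<d. cnj (F k i) * Y k i) = (\<Sum>k<d. cnj (Y k i) * Y k i) / s i"
      by (simp add: F_def sum_divide_distrib)
    also have "(\<Sum>k<d. cnj (Y k i) * Y k i) = complex_of_real ((s i)\<^sup>2)"
      using orth[OF that that] by (simp add: Y_def)
    finally show ?thesis by (simp add: power2_eq_square)
  qed
  have FF: "(\<Sum>k<d. cnj (F k i) * F k j) = (if i = j then complex_of_real (if s i = 0 then 0 else 1) else 0)"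
    if "i < d" "j < d" for i j
  proof -
    have "(\<Sum>k<d. cnj (F k i) * F k j) = (\<Sum>k<d. cnj (Y k i) * Y k j) / (s i * s j)"
      by (simp add: F_def sum_divide_distrib)
    also have "(\<Sum>k<d. cnj (Y k i) * Y k j) = (if i = j then complex_of_real ((s i)\<^sup>2) else 0)"
      using orth[OF that] by (simp add: Y_def)
    finally show ?thesis by (simp add: power2_eq_square)
  qed
  define X where "X i a = (\<Sum>k<d. cnj (F k i) * B $$ (k, a))" for i a
  have sX: "complex_of_real (s i) = (\<Sum>a<d. X i a * Z $$ (a, i))" if "i < d" for i
  proof -
    have "complex_of_real (s i) = (\<Sum>k<d. \<Sum>a<d. cnj (F k i) * B $$ (k, a) * Z $$ (a, i))"
      unfolding FY[OF that, symmetric] using that by (simp add: Y sum_distrib_left mult_ac)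
    then show ?thesis by (subst (asm) sum.swap) (simp add: X_def sum_distrib_right)
  qed
  have "complex_of_real (trace_norm (B * C)) = (\<Sum>i<d. \<Sum>a<d. X i a * Z $$ (a, i))"
    unfolding tn of_real_sum by (intro sum.cong refl) (simp add: sX)
  also have "\<dots> = (\<Sum>a<d. \<Sum>i<d. X i a * Z $$ (a, i))" by (rule sum.swap)
  finally have "trace_norm (B * C) = Re (\<Sum>a<d. \<Sum>i<d. X i a * Z $$ (a, i))"
    by (metis Re_complex_of_real)
  also have "\<dots> = (\<Sum>a<d. Re (\<Sum>i<d. X i a * Z $$ (a, i)))" by simp
  also have "\<dots> \<le> (\<Sum>a<d. sqrt (\<Sum>i<d. (cmod (B $$ (i, a)))\<^sup>2) * sqrt (\<Sum>j<d. (cmod (C $$ (a, j)))\<^sup>2))"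
  proof (rule sum_mono)
    fix a assume "a \<in> {..<d}"
    hence a: "a < d" by simp
    have 1: "(\<Sum>i<d. (cmod (X i a))\<^sup>2) \<le> (\<Sum>i<d. (cmod (B $$ (i, a)))\<^sup>2)"
      unfolding X_def by (rule bessel[OF FF]) auto
    have "(\<Sum>i<d. (cmod (Z $$ (a, i)))\<^sup>2) = (\<Sum>i<d. (cmod (\<Sum>j<d. cnj (cnj (E $$ (j, i))) * C $$ (a, j)))\<^sup>2)"
      unfolding Z_def using a
      by (intro sum.cong refl) (simp add: mult_index[OF C Ec(1)] mult.commute del: index_mult_mat(1))
    also have "\<dots> \<le> (\<Sum>j<d. (cmod (C $$ (a, j)))\<^sup>2)"
    proof (rule bessel[where e = "\<lambda>_. 1"])
      fix i j assume ij: "i < d" "j < d"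
      have "(\<Sum>k<d. cnj (cnj (E $$ (k, i))) * cnj (E $$ (k, j))) = cnj (\<Sum>k<d. cnj (E $$ (k, i)) * E $$ (k, j))"
        by simp
      also have "\<dots> = (if i = j then complex_of_real 1 else 0)"
        unfolding unitary_cols[OF E ij] by simp
      finally show "(\<Sum>k<d. cnj (cnj (E $$ (k, i))) * cnj (E $$ (k, j))) = (if i = j then complex_of_real 1 else 0)" .
    qed auto
    finally have 2: "(\<Sum>i<d. (cmod (Z $$ (a, i)))\<^sup>2) \<le> (\<Sum>j<d. (cmod (C $$ (a, j)))\<^sup>2)" .
    have "Re (\<Sum>i<d. X i a * Z $$ (a, i)) \<le> cmod (\<Sum>i<d. X i a * Z $$ (a, i))"
      by (rule complex_Re_le_cmod)
    also have "\<dots> \<le> sqrt (\<Sum>i<d. (cmod (X i a))\<^sup>2) * sqrt (\<Sum>i<d. (cmod (Z $$ (a, i)))\<^sup>2)"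
      by (rule complex_cauchy_schwarz)
    also have "\<dots> \<le> sqrt (\<Sum>i<d. (cmod (B $$ (i, a)))\<^sup>2) * sqrt (\<Sum>j<d. (cmod (C $$ (a, j)))\<^sup>2)"
      by (intro mult_mono real_sqrt_le_mono 1 2) (auto intro: sum_nonneg)
    finally show "Re (\<Sum>i<d. X i a * Z $$ (a, i))
      \<le> sqrt (\<Sum>i<d. (cmod (B $$ (i, a)))\<^sup>2) * sqrt (\<Sum>j<d. (cmod (C $$ (a, j)))\<^sup>2)" .
  qed
  finally show ?thesis .
qed

section \<open>Rearrangement bounds for Monge weights\<close>

lemma sum_swap3:
  "(\<Sum>i\<in>I. \<Sum>k\<in>K. \<Sum>l\<in>L. f i k l) = (\<Sum>k\<in>K. \<Sum>l\<in>L. \<Sum>i\<in>I. f i k l)"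
  by (rule trans[OF sum.swap sum.cong[OF refl sum.swap]])

lemma sum_swap4:
  "(\<Sum>i\<in>I. \<Sum>j\<in>J. \<Sum>k\<in>K. \<Sum>l\<in>L. f i j k l) = (\<Sum>k\<in>K. \<Sum>l\<in>L. \<Sum>i\<in>I. \<Sum>j\<in>J. f i j k l)"
  by (rule trans[OF sum.cong[OF refl sum_swap3] sum_swap3])

text \<open>Summing the mixed second difference over the rectangle \<open>k >= i\<close>,
  \<open>l < j\<close> leaves boundary values in column 0 and row \<open>d\<close>. These lie on or
  below the diagonal, where \<open>w\<close> vanishes.\<close>

lemma monge_double_telescope:
  fixes w :: "nat \<Rightarrow> nat \<Rightarrow> real"
  assumes low: "\<And>i j. j \<le> i \<Longrightarrow> w i j = 0" and i: "i < d" and j: "j < d"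
  shows "w i j = (\<Sum>k<d. \<Sum>l<d-1. if i \<le> k \<and> l < j
           then w k (Suc l) - w (Suc k) (Suc l) - (w k l - w (Suc k) l) else 0)"
proof -
  have inner: "(\<Sum>l<j. w k (Suc l) - w (Suc k) (Suc l) - (w k l - w (Suc k) l)) = w k j - w (Suc k) j" for k
    using sum_lessThan_telescope[of "\<lambda>l. w k l - w (Suc k) l" j] low by simp
  have "(\<Sum>k<d. \<Sum>l<d-1. if i \<le> k \<and> l < j
           then w k (Suc l) - w (Suc k) (Suc l) - (w k l - w (Suc k) l) else 0)
      = (\<Sum>k<d. if i \<le> k then w k j - w (Suc k) j else 0)"
  proof (intro sum.cong refl)
    fix k
    have "(\<Sum>l<d-1. if l < j then w k (Suc l) - w (Suc k) (Suc l) - (w k l - w (Suc k) l) else 0)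
        = (\<Sum>l<j. w k (Suc l) - w (Suc k) (Suc l) - (w k l - w (Suc k) l))"
      using j by (intro sum.mono_neutral_cong_right) auto
    with inner[of k] show "(\<Sum>l<d-1. if i \<le> k \<and> l < j
           then w k (Suc l) - w (Suc k) (Suc l) - (w k l - w (Suc k) l) else 0)
      = (if i \<le> k then w k j - w (Suc k) j else 0)"
      by simp
  qed
  also have "\<dots> = (\<Sum>k=i..<d. w k j - w (Suc k) j)"
    by (intro sum.mono_neutral_cong_right) auto
  also have "\<dots> = w i j - w d j"
    using sum_Suc_diff'[of i d "\<lambda>k. - w k j"] i by simp
  finally show ?thesis using low[of j d] j by simp
qed

text \<open>Both sides are linear in \<open>w\<close>, which is a nonnegative combination of the indicators of the
  rectangles \<open>{..k} \<times> {l<..<d}\<close>; \<open>rect\<close> is the claim for these indicators.\<close>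

lemma monge_sum_le:
  fixes w A :: "nat \<Rightarrow> nat \<Rightarrow> real" and c :: "nat \<Rightarrow> real"
  assumes low: "\<And>i j. j \<le> i \<Longrightarrow> w i j = 0"
    and monge: "\<And>k l. k \<le> l \<Longrightarrow> Suc l < d \<Longrightarrow> w k l + w (Suc k) (Suc l) \<le> w k (Suc l) + w (Suc k) l"
    and rect: "\<And>k l. k \<le> l \<Longrightarrow> Suc l < d \<Longrightarrow>
        (\<Sum>i\<in>{..k}. \<Sum>j\<in>{l<..<d}. A i j) \<le> (\<Sum>i<d. if i \<le> k \<and> l < d - 1 - i then c i else 0)"
  shows "(\<Sum>i<d. \<Sum>j<d. w i j * A i j) \<le> (\<Sum>i<d. w i (d - 1 - i) * c i)"
proof -
  define \<mu> where "\<mu> k l = w k (Suc l) - w (Suc k) (Suc l) - (w k l - w (Suc k) l)" for k l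
  have w: "w i j = (\<Sum>k<d. \<Sum>l<d-1. if i \<le> k \<and> l < j then \<mu> k l else 0)" if "i < d" "j < d" for i j
    unfolding \<mu>_def by (rule monge_double_telescope) (use low that in auto)
  have "(\<Sum>i<d. \<Sum>j<d. w i j * A i j)
      = (\<Sum>i<d. \<Sum>j<d. \<Sum>k<d. \<Sum>l<d-1. if i \<le> k \<and> l < j then \<mu> k l * A i j else 0)"
    by (intro sum.cong refl) (auto simp: w sum_distrib_right if_distrib[of "\<lambda>x. x * _"] cong: if_cong)
  also have "\<dots> = (\<Sum>k<d. \<Sum>l<d-1. \<Sum>i<d. \<Sum>j<d. if i \<le> k \<and> l < j then \<mu> k l * A i j else 0)"
    by (rule sum_swap4)
  also have "\<dots> = (\<Sum>k<d. \<Sum>l<d-1. \<mu> k l * (\<Sum>i\<in>{..k}. \<Sum>j\<in>{l<..<d}. A i j))"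
  proof (intro sum.cong refl)
    fix k l assume "k \<in> {..<d}"
    hence "(\<Sum>i<d. \<Sum>j<d. if i \<le> k \<and> l < j then \<mu> k l * A i j else 0)
      = (\<Sum>i\<le>k. \<Sum>j<d. if l < j then \<mu> k l * A i j else 0)"
      by (intro sum.mono_neutral_cong_right) auto
    also have "\<dots> = (\<Sum>i\<le>k. \<Sum>j\<in>{l<..<d}. \<mu> k l * A i j)"
      by (intro sum.cong refl sum.mono_neutral_cong_right) auto
    finally show "(\<Sum>i<d. \<Sum>j<d. if i \<le> k \<and> l < j then \<mu> k l * A i j else 0)
        = \<mu> k l * (\<Sum>i\<in>{..k}. \<Sum>j\<in>{l<..<d}. A i j)"
      by (simp add: sum_distrib_left)
  qed
  also have "\<dots> \<le> (\<Sum>k<d. \<Sum>l<d-1. \<mu> k l * (\<Sum>i<d. if i \<le> k \<and> l < d - 1 - i then c i else 0))"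
  proof (intro sum_mono)
    fix k l assume kl: "k \<in> {..<d}" "l \<in> {..<d-1}"
    show "\<mu> k l * (\<Sum>i\<in>{..k}. \<Sum>j\<in>{l<..<d}. A i j)
      \<le> \<mu> k l * (\<Sum>i<d. if i \<le> k \<and> l < d - 1 - i then c i else 0)"
    proof (cases "k \<le> l")
      case True
      have "\<mu> k l \<ge> 0" using monge[OF True] kl unfolding \<mu>_def by (simp add: less_diff_conv)
      then show ?thesis using rect[OF True] kl by (intro mult_left_mono) (auto simp: less_diff_conv)
    next
      case False
      \<comment> \<open>For l < k all four entries in the difference lie on or below the diagonal.
        Hence only rectangles with disjoint row and column ranges have to be tested.\<close>
      hence "\<mu> k l = 0" by (simp add: \<mu>_def low)
      then show ?thesis by simp
    qed
  qed
  also have "\<dots> = (\<Sum>k<d. \<Sum>l<d-1. \<Sum>i<d. if i \<le> k \<and> l < d - 1 - i then \<mu> k l * c i else 0)"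
    by (intro sum.cong refl) (auto simp: sum_distrib_left intro!: sum.cong)
  also have "\<dots> = (\<Sum>i<d. \<Sum>k<d. \<Sum>l<d-1. if i \<le> k \<and> l < d - 1 - i then \<mu> k l * c i else 0)"
    by (rule sum_swap3[symmetric])
  \<comment> \<open>The decomposition of \<open>w\<close> read backwards, at the antidiagonal
    positions (i, d-1-i).\<close>
  also have "\<dots> = (\<Sum>i<d. w i (d - 1 - i) * c i)"
    by (intro sum.cong refl) (auto simp: w sum_distrib_right if_distrib[of "\<lambda>x. x * _"] cong: if_cong)
  finally show ?thesis .
qed


text \<open>A function of two indices instead of a matrix, so that transposing is a swap of
  arguments and bounds for rows carry over to columns.\<close>

definition orthonormal_cols :: "nat \<Rightarrow> (nat \<Rightarrow> nat \<Rightarrow> complex) \<Rightarrow> bool" where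
  "orthonormal_cols d G \<longleftrightarrow>
     (\<forall>i<d. \<forall>j<d. (\<Sum>m<d. G m i * cnj (G m j)) = (if i = j then 1 else 0))"

lemma parseval_cols:
  assumes G: "orthonormal_cols d G" and K: "K \<subseteq> {..<d}"
  shows "(\<Sum>m<d. (cmod (\<Sum>i\<in>K. a i * G m i))\<^sup>2) = (\<Sum>i\<in>K. (cmod (a i))\<^sup>2)"
proof -
  have fin: "finite K" using K finite_subset by blast
  have "complex_of_real (\<Sum>m<d. (cmod (\<Sum>i\<in>K. a i * G m i))\<^sup>2)
      = (\<Sum>m<d. \<Sum>i\<in>K. \<Sum>j\<in>K. a i * cnj (a j) * (G m i * cnj (G m j)))"
    by (simp only: of_real_sum complex_norm_square cnj_sum sum_product complex_cnj_mult mult_ac)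
  also have "\<dots> = (\<Sum>i\<in>K. \<Sum>j\<in>K. a i * cnj (a j) * (\<Sum>m<d. G m i * cnj (G m j)))"
    by (subst sum_swap3) (simp only: sum_distrib_left)
  also have "\<dots> = (\<Sum>i\<in>K. \<Sum>j\<in>K. if i = j then a i * cnj (a j) else 0)"
    using K G unfolding orthonormal_cols_def by (intro sum.cong refl) (auto simp: subset_iff)
  also have "\<dots> = complex_of_real (\<Sum>i\<in>K. (cmod (a i))\<^sup>2)"
    using fin by (simp only: of_real_sum complex_norm_square) simp
  finally show ?thesis by (simp only: of_real_eq_iff)
qed

text \<open>With E_m the coordinate projections and P_i the projections onto the columns of
  \<open>G\<close>, this is - Re tr(E_m P_i E_n P_j), a four-point phase invariant. It is the
  coefficient of (h_m - h_n)^2 in an off-diagonal |H'_ij|^2.\<close>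

definition cross_term :: "(nat \<Rightarrow> nat \<Rightarrow> complex) \<Rightarrow> nat \<Rightarrow> nat \<Rightarrow> nat \<Rightarrow> nat \<Rightarrow> real" where
  "cross_term G i j m n = - Re (G m i * cnj (G n i) * G n j * cnj (G m j))"

lemma cross_term_swap: "cross_term G i j n m = cross_term G i j m n"
proof -
  have "G n i * cnj (G m i) * G m j * cnj (G n j) = cnj (G m i * cnj (G n i) * G n j * cnj (G m j))"
    by (simp add: mult_ac)
  then show ?thesis unfolding cross_term_def by (simp only: cnj.sel)
qed

lemma cross_term_transpose: "cross_term (\<lambda>i m. G m i) m n i j = cross_term G i j m n"
  unfolding cross_term_def by (simp add: mult_ac)

text \<open>Polarization with the term in \<open>p + q\<close> dropped; the factor 1/4 of the final
  bound comes from here.\<close>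

lemma neg_Re_mult_cnj_le: "- Re (p * cnj q) \<le> (cmod (p - q))\<^sup>2 / 4"
proof -
  have "4 * - Re (p * cnj q) = (cmod (p - q))\<^sup>2 - (cmod (p + q))\<^sup>2"
    unfolding cmod_power2 by (simp add: power2_eq_square algebra_simps)
  also have "\<dots> \<le> (cmod (p - q))\<^sup>2" by simp
  finally show ?thesis by simp
qed

text \<open>With \<open>P\<close>, \<open>Q\<close> the projections onto the columns \<open>I\<close>, \<open>J\<close> of \<open>G\<close>, the sum is
  \<open>- Re tr(E P E' Q)\<close>, and the rows of \<open>P - Q\<close> have norm at most 1.\<close>

lemma cross_term_rectangle_le_card:
  assumes G: "orthonormal_cols d G" and G': "orthonormal_cols d (\<lambda>i m. G m i)"
    and I: "I \<subseteq> {..<d}" and J: "J \<subseteq> {..<d}" and IJ: "I \<inter> J = {}"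
    and M: "M \<subseteq> {..<d}" and N: "N \<subseteq> {..<d}"
  shows "(\<Sum>m\<in>M. \<Sum>n\<in>N. \<Sum>i\<in>I. \<Sum>j\<in>J. cross_term G i j m n) \<le> card M / 4"
proof -
  have fin: "finite I" "finite J" using I J finite_subset by blast+
  define P where "P m n = (\<Sum>i\<in>I. G m i * cnj (G n i))" for m n
  define Q where "Q m n = (\<Sum>j\<in>J. G m j * cnj (G n j))" for m n
  \<comment> \<open>With a sign flip on \<open>J\<close>, the difference of the projections is one
    signed sum over the disjoint union of \<open>I\<close> and \<open>J\<close>. By Parseval a row
    of it has the squared norm of part of a unit row of \<open>G\<close>.\<close>
  define \<epsilon> where "\<epsilon> i = (if i \<in> I then 1 else - 1 :: complex)" for i
  have PQ: "P m n - Q m n = (\<Sum>i\<in>I\<union>J. \<epsilon> i * G m i * cnj (G n i))" for m n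
  proof -
    have "(\<Sum>i\<in>J. \<epsilon> i * G m i * cnj (G n i)) = (\<Sum>i\<in>J. - (G m i * cnj (G n i)))"
      using IJ by (intro sum.cong refl) (auto simp: \<epsilon>_def)
    then show ?thesis using fin IJ
      by (simp add: sum.union_disjoint P_def Q_def \<epsilon>_def sum_negf)
  qed
  have one: "(\<Sum>i<d. (cmod (G m i))\<^sup>2) = 1" if "m < d" for m
  proof -
    have "complex_of_real (\<Sum>i<d. (cmod (G m i))\<^sup>2) = 1"
      using G' that unfolding orthonormal_cols_def
      by (simp only: of_real_sum complex_norm_square) simp
    then show ?thesis by (simp only: of_real_eq_1_iff)
  qed
  have row: "(\<Sum>n<d. (cmod (P m n - Q m n))\<^sup>2) \<le> 1" if "m < d" for m
  proof -
    have "(\<Sum>n<d. (cmod (P m n - Q m n))\<^sup>2)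
        = (\<Sum>n<d. (cmod (\<Sum>i\<in>I\<union>J. cnj (\<epsilon> i * G m i) * G n i))\<^sup>2)"
      unfolding PQ
      by (subst complex_mod_cnj[symmetric], simp only: cnj_sum complex_cnj_mult complex_cnj_cnj)
    also have "\<dots> = (\<Sum>i\<in>I\<union>J. (cmod (cnj (\<epsilon> i * G m i)))\<^sup>2)"
      by (rule parseval_cols[OF G]) (use I J in auto)
    also have "\<dots> = (\<Sum>i\<in>I\<union>J. (cmod (G m i))\<^sup>2)"
      by (intro sum.cong refl) (simp add: \<epsilon>_def norm_mult)
    also have "\<dots> \<le> (\<Sum>i<d. (cmod (G m i))\<^sup>2)"
      by (rule sum_mono2) (use I J in auto)
    finally show ?thesis using one[OF that] by simp
  qed
  have "(\<Sum>m\<in>M. \<Sum>n\<in>N. \<Sum>i\<in>I. \<Sum>j\<in>J. cross_term G i j m n)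
      = (\<Sum>m\<in>M. \<Sum>n\<in>N. - Re (P m n * cnj (Q m n)))"
    by (intro sum.cong refl)
       (simp add: P_def Q_def cross_term_def sum_product cnj_sum sum_negf mult_ac del: times_complex.sel)
  also have "\<dots> \<le> (\<Sum>m\<in>M. \<Sum>n\<in>N. (cmod (P m n - Q m n))\<^sup>2 / 4)"
    by (intro sum_mono neg_Re_mult_cnj_le)
  also have "\<dots> \<le> (\<Sum>m\<in>M. 1 / 4)"
  proof (rule sum_mono)
    fix m assume "m \<in> M"
    hence "(\<Sum>n\<in>N. (cmod (P m n - Q m n))\<^sup>2) \<le> 1"
      using order_trans[OF sum_mono2[OF _ N] row[of m]] M by fastforce
    then show "(\<Sum>n\<in>N. (cmod (P m n - Q m n))\<^sup>2 / 4) \<le> 1 / 4"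
      by (simp add: sum_divide_distrib[symmetric])
  qed
  finally show ?thesis by simp
qed

text \<open>One cardinality bound gives all four through the symmetries of
  \<open>cross_term\<close>: exchanging m and n brings in \<open>N\<close>, transposing
  \<open>G\<close> brings in \<open>I\<close>, and both together bring in \<open>J\<close>.\<close>

lemma cross_term_rectangle_le:
  assumes G: "orthonormal_cols d G" and G': "orthonormal_cols d (\<lambda>i m. G m i)"
    and I: "I \<subseteq> {..<d}" and J: "J \<subseteq> {..<d}" and IJ: "I \<inter> J = {}"
    and M: "M \<subseteq> {..<d}" and N: "N \<subseteq> {..<d}" and MN: "M \<inter> N = {}"
  shows "(\<Sum>m\<in>M. \<Sum>n\<in>N. \<Sum>i\<in>I. \<Sum>j\<in>J. cross_term G i j m n)
    \<le> Min {card M, card N, card I, card J} / 4" (is "?S M N I J \<le> _")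
proof -
  have M': "?S M N I J \<le> card M / 4"
    by (rule cross_term_rectangle_le_card) (use assms in auto)
  have "?S M N I J = ?S N M I J"
    by (subst sum.swap) (intro sum.cong refl cross_term_swap)
  also have "\<dots> \<le> card N / 4"
    by (rule cross_term_rectangle_le_card) (use assms in auto)
  finally have N': "?S M N I J \<le> card N / 4" .
  have T: "?S M N I J = (\<Sum>i\<in>I. \<Sum>j\<in>J. \<Sum>m\<in>M. \<Sum>n\<in>N. cross_term (\<lambda>i m. G m i) m n i j)"
    by (subst sum_swap4) (intro sum.cong refl cross_term_transpose[symmetric])
  also have "\<dots> \<le> card I / 4"
    by (rule cross_term_rectangle_le_card) (use assms in auto)
  finally have I': "?S M N I J \<le> card I / 4" .
  have "?S M N I J = (\<Sum>j\<in>J. \<Sum>i\<in>I. \<Sum>m\<in>M. \<Sum>n\<in>N. cross_term (\<lambda>i m. G m i) m n j i)"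
    unfolding T by (subst sum.swap) (intro sum.cong refl cross_term_swap)
  also have "\<dots> \<le> card J / 4"
    by (rule cross_term_rectangle_le_card) (use assms in auto)
  finally have J': "?S M N I J \<le> card J / 4" .
  show ?thesis using M' N' I' J' by (simp add: min_def)
qed


text \<open>Expanding gives minus the sum of \<open>h m * h n * T m n\<close>. Columns
  \<open>i\<close> and \<open>j\<close> are orthogonal, so all row and column sums of
  \<open>T\<close> vanish; therefore - h_m h_n may be replaced by (h_m - h_n)^2 / 2. Symmetry of
  \<open>T\<close> then folds the double sum onto m < n, where the Monge decomposition
  applies.\<close>

lemma norm_sq_offdiag_eq:
  fixes h :: "nat \<Rightarrow> real"
  assumes G: "orthonormal_cols d G" and ij: "i < d" "j < d" "i \<noteq> j"
  shows "(cmod (\<Sum>m<d. h m * cnj (G m i) * G m j))\<^sup>2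
    = (\<Sum>m<d. \<Sum>n<d. (if m < n then (h m - h n)\<^sup>2 else 0) * cross_term G i j m n)"
proof -
  define T where "T m n = cross_term G i j m n" for m n
  have zero: "(\<Sum>n<d. T m n) = 0" for m
  proof -
    have "(\<Sum>n<d. T m n) = - Re (\<Sum>n<d. G m i * cnj (G m j) * (G n j * cnj (G n i)))"
      unfolding T_def cross_term_def Re_sum sum_negf by (simp only: mult_ac)
    also have "(\<Sum>n<d. G m i * cnj (G m j) * (G n j * cnj (G n i))) = 0"
      unfolding sum_distrib_left[symmetric] using G ij by (simp add: orthonormal_cols_def)
    finally show ?thesis by simp
  qed
  have sym: "T n m = T m n" for m n unfolding T_def by (rule cross_term_swap)
  have "complex_of_real ((cmod (\<Sum>m<d. h m * cnj (G m i) * G m j))\<^sup>2)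
      = (\<Sum>m<d. \<Sum>n<d. complex_of_real (h m * h n) * cnj (G m i * cnj (G n i) * G n j * cnj (G m j)))"
    unfolding complex_norm_square cnj_sum sum_product
    by (intro sum.cong refl) (simp add: mult_ac)
  hence "(cmod (\<Sum>m<d. h m * cnj (G m i) * G m j))\<^sup>2
      = Re (\<Sum>m<d. \<Sum>n<d. complex_of_real (h m * h n) * cnj (G m i * cnj (G n i) * G n j * cnj (G m j)))"
    by (metis Re_complex_of_real)
  also have "\<dots> = (\<Sum>m<d. \<Sum>n<d. - (h m * h n * T m n))"
    unfolding Re_sum T_def cross_term_def
    by (intro sum.cong refl) (simp only: scaleR_conv_of_real[symmetric] scaleR_complex.sel cnj.sel mult_minus_right minus_minus)
  finally have 1: "(cmod (\<Sum>m<d. h m * cnj (G m i) * G m j))\<^sup>2 = - (\<Sum>m<d. \<Sum>n<d. h m * h n * T m n)"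
    by (simp add: sum_negf)
  have a: "(\<Sum>m<d. \<Sum>n<d. (h m)\<^sup>2 * T m n) = 0"
    by (simp add: sum_distrib_left[symmetric] zero)
  have "(\<Sum>m<d. \<Sum>n<d. (h n)\<^sup>2 * T m n) = (\<Sum>n<d. \<Sum>m<d. (h n)\<^sup>2 * T n m)"
    by (subst sum.swap) (simp only: sym)
  with a have b: "(\<Sum>m<d. \<Sum>n<d. (h n)\<^sup>2 * T m n) = 0" by simp
  have "(\<Sum>m<d. \<Sum>n<d. (h m - h n)\<^sup>2 * T m n)
      = (\<Sum>m<d. \<Sum>n<d. (h m)\<^sup>2 * T m n) + (\<Sum>m<d. \<Sum>n<d. (h n)\<^sup>2 * T m n)
        - 2 * (\<Sum>m<d. \<Sum>n<d. h m * h n * T m n)"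
    unfolding sum_distrib_left sum.distrib[symmetric] sum_subtractf[symmetric]
    by (intro sum.cong refl) (simp add: power2_eq_square algebra_simps)
  with a b have 2: "(\<Sum>m<d. \<Sum>n<d. (h m - h n)\<^sup>2 * T m n) = - 2 * (\<Sum>m<d. \<Sum>n<d. h m * h n * T m n)"
    by simp
  define g where "g m n = (if m < n then (h m - h n)\<^sup>2 else 0)" for m n :: nat
  have g: "(h m - h n)\<^sup>2 = g m n + g n m" for m n
    by (cases m n rule: linorder_cases) (auto simp: g_def power2_commute)
  have "(\<Sum>m<d. \<Sum>n<d. g n m * T m n) = (\<Sum>m<d. \<Sum>n<d. g m n * T m n)"
    by (subst sum.swap) (simp only: sym)
  hence "(\<Sum>m<d. \<Sum>n<d. (h m - h n)\<^sup>2 * T m n) = 2 * (\<Sum>m<d. \<Sum>n<d. g m n * T m n)"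
    by (simp add: g distrib_right sum.distrib)
  with 1 2 show ?thesis unfolding g_def T_def by simp
qed

text \<open>\<open>monge_sum_le\<close> is used twice: for the weight \<open>w\<close> on the
  indices of the state, and inside it for the weight \<open>g\<close> on the indices of
  \<open>h\<close>. What remains is a sum of \<open>cross_term\<close> over a product of two
  rectangles, bounded by a quarter of the smallest side.\<close>

lemma weighted_offdiag_le:
  fixes h :: "nat \<Rightarrow> real"
  assumes G: "orthonormal_cols d G" and G': "orthonormal_cols d (\<lambda>i m. G m i)"
    and low: "\<And>i j. j \<le> i \<Longrightarrow> w i j = 0"
    and monge: "\<And>k l. k \<le> l \<Longrightarrow> Suc l < d \<Longrightarrow> w k l + w (Suc k) (Suc l) \<le> w k (Suc l) + w (Suc k) l"
    and h: "\<And>i j. i \<le> j \<Longrightarrow> j < d \<Longrightarrow> h j \<le> h i"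
  shows "(\<Sum>i<d. \<Sum>j<d. w i j * (cmod (\<Sum>m<d. h m * cnj (G m i) * G m j))\<^sup>2)
    \<le> (\<Sum>i<d. w i (d - 1 - i) * ((h i - h (d - 1 - i))\<^sup>2 / 4))"
proof -
  define g where "g m n = (if m < n then (h m - h n)\<^sup>2 else 0)" for m n :: nat
  define A where "A i j = (\<Sum>m<d. \<Sum>n<d. g m n * cross_term G i j m n)" for i j
  have glow: "g m n = 0" if "n \<le> m" for m n using that by (simp add: g_def)
  have gmonge: "g k l + g (Suc k) (Suc l) \<le> g k (Suc l) + g (Suc k) l" if "k \<le> l" "Suc l < d" for k l
  proof (cases "k = l")
    case True then show ?thesis by (simp add: g_def)
  next
    case False
    \<comment> \<open>If \<open>Suc k = l\<close>, the last position is on the diagonal, where the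
      cutoff and the square are both 0.\<close>
    hence "g k l = (h k - h l)\<^sup>2" "g (Suc k) (Suc l) = (h (Suc k) - h (Suc l))\<^sup>2"
      "g k (Suc l) = (h k - h (Suc l))\<^sup>2" "g (Suc k) l = (h (Suc k) - h l)\<^sup>2"
      using that False by (auto simp: g_def not_less le_less_Suc_eq dest!: le_neq_implies_less antisym[of l])
    moreover have "0 \<le> 2 * (h k - h (Suc k)) * (h l - h (Suc l))"
      using h[of k "Suc k"] h[of l "Suc l"] that by simp
    ultimately show ?thesis by (simp add: power2_eq_square algebra_simps)
  qed
  have "(\<Sum>i<d. \<Sum>j<d. w i j * (cmod (\<Sum>m<d. h m * cnj (G m i) * G m j))\<^sup>2)
      = (\<Sum>i<d. \<Sum>j<d. w i j * A i j)"
  proof (intro sum.cong refl)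
    fix i j assume "i \<in> {..<d}" "j \<in> {..<d}"
    then show "w i j * (cmod (\<Sum>m<d. h m * cnj (G m i) * G m j))\<^sup>2 = w i j * A i j"
      using norm_sq_offdiag_eq[OF G, of i j h] low[of j i] by (cases "i = j") (auto simp: A_def g_def)
  qed
  also have "\<dots> \<le> (\<Sum>i<d. w i (d - 1 - i) * (g i (d - 1 - i) / 4))"
  proof (rule monge_sum_le[where w = w, OF low monge], assumption+)
    fix k l assume kl: "k \<le> l" "Suc l < d"
    \<comment> \<open>The target value of the inner application: 1/4 for each antidiagonal pair
      inside the outer rectangle.\<close>
    define c where "c i = (if i \<le> k \<and> l < d - 1 - i then 1 / 4 else 0 :: real)" for i
    have "(\<Sum>i\<in>{..k}. \<Sum>j\<in>{l<..<d}. A i j)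
        = (\<Sum>m<d. \<Sum>n<d. g m n * (\<Sum>i\<in>{..k}. \<Sum>j\<in>{l<..<d}. cross_term G i j m n))"
      unfolding A_def by (subst sum_swap4) (simp only: sum_distrib_left)
    also have "\<dots> \<le> (\<Sum>m<d. g m (d - 1 - m) * c m)"
    proof (rule monge_sum_le[where w = g, OF glow gmonge], assumption+)
      fix s t assume st: "s \<le> t" "Suc t < d"
      have "(\<Sum>m\<in>{..s}. \<Sum>n\<in>{t<..<d}. \<Sum>i\<in>{..k}. \<Sum>j\<in>{l<..<d}. cross_term G i j m n)
        \<le> Min {card {..s}, card {t<..<d}, card {..k}, card {l<..<d}} / 4"
        by (rule cross_term_rectangle_le[OF G G']) (use kl st in auto)
      \<comment> \<open>All four conditions on i are upper bounds, so the antidiagonal pairs lying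
        in both rectangles form an initial segment, with the smallest side as its length.\<close>
      also have "Min {card {..s}, card {t<..<d}, card {..k}, card {l<..<d}}
          = card {i. i < d \<and> i \<le> s \<and> t < d - 1 - i \<and> i \<le> k \<and> l < d - 1 - i}"
      proof -
        have "{i. i < d \<and> i \<le> s \<and> t < d - 1 - i \<and> i \<le> k \<and> l < d - 1 - i}
          = {..<Min {card {..s}, card {t<..<d}, card {..k}, card {l<..<d}}}"
          using kl st by auto
        then show ?thesis by simp
      qed
      also have "real \<dots> / 4 = (\<Sum>i\<in>{i. i < d \<and> i \<le> s \<and> t < d - 1 - i \<and> i \<le> k \<and> l < d - 1 - i}. c i)"
        by (simp add: c_def)
      also have "\<dots> = (\<Sum>i<d. if i \<le> s \<and> t < d - 1 - i then c i else 0)"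
        by (intro sum.mono_neutral_cong_left) (auto simp: c_def)
      finally show "(\<Sum>m\<in>{..s}. \<Sum>n\<in>{t<..<d}. \<Sum>i\<in>{..k}. \<Sum>j\<in>{l<..<d}. cross_term G i j m n)
        \<le> (\<Sum>i<d. if i \<le> s \<and> t < d - 1 - i then c i else 0)" .
    qed
    also have "\<dots> = (\<Sum>i<d. if i \<le> k \<and> l < d - 1 - i then g i (d - 1 - i) / 4 else 0)"
      by (intro sum.cong refl) (simp add: c_def)
    finally show "(\<Sum>i\<in>{..k}. \<Sum>j\<in>{l<..<d}. A i j)
      \<le> (\<Sum>i<d. if i \<le> k \<and> l < d - 1 - i then g i (d - 1 - i) / 4 else 0)" .
  qed
  also have "\<dots> = (\<Sum>i<d. w i (d - 1 - i) * ((h i - h (d - 1 - i))\<^sup>2 / 4))"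
    using low by (intro sum.cong refl) (auto simp: g_def)
  finally show ?thesis .
qed

text \<open>Since (x-y)^2/(x+y) = (x+y) - 4xy/(x+y), the linear parts cancel. It remains that
  xc/(x+c) - xe/(x+e) = (c-e) (x/(x+c)) (x/(x+e)) increases with x. The case \<open>b = 0\<close> is
  separate because quotients 0/0 occur there.\<close>

lemma qfi_weight_monge:
  fixes a b c e :: real
  assumes "a \<ge> b" "b \<ge> c" "c \<ge> e" "e \<ge> 0"
  shows "(a - c)\<^sup>2 / (a + c) + (b - e)\<^sup>2 / (b + e) \<le> (a - e)\<^sup>2 / (a + e) + (b - c)\<^sup>2 / (b + c)"
proof (cases "b = 0")
  case True
  hence "c = 0" "e = 0" using assms by linarith+
  then show ?thesis using True by simp
next
  case False
  hence b: "b > 0" and a: "a > 0" using assms by linarith+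
  have w: "(x - y)\<^sup>2 / (x + y) = (x + y) - 4 * (x * y / (x + y))" if "x > 0" "y \<ge> 0" for x y :: real
    using that by (simp add: field_simps power2_eq_square add_nonneg_eq_0_iff)
  have f: "x * c / (x + c) - x * e / (x + e) = (c - e) * ((x / (x + c)) * (x / (x + e)))" if "x > 0" for x
  proof -
    have "x + c \<noteq> 0" "x + e \<noteq> 0" using that assms by linarith+
    then show ?thesis by (simp add: field_simps)
  qed
  have r: "b / (b + y) \<le> a / (a + y)" if "y \<ge> 0" for y
    using that a b assms by (simp add: divide_le_eq le_divide_eq field_simps mult_mono)
  have "(c - e) * ((b / (b + c)) * (b / (b + e))) \<le> (c - e) * ((a / (a + c)) * (a / (a + e)))"
    using r[of c] r[of e] assms a b by (intro mult_left_mono mult_mono) auto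
  then have "b * c / (b + c) - b * e / (b + e) \<le> a * c / (a + c) - a * e / (a + e)"
    using f[OF a] f[OF b] by simp
  then show ?thesis using assms a b w[of a c] w[of b e] w[of a e] w[of b c] by simp
qed

section \<open>Fidelity of unitarily related states\<close>

lemma mtrace_unitary_conj:
  assumes U: "unitary_mat d U" and X: "X \<in> carrier_mat d d"
  shows "mtrace (U * X * adj U) = mtrace X"
proof -
  note Uc = unitary_matD[OF U]
  have "mtrace (U * X * adj U) = mtrace (adj U * (U * X))"
    by (rule mtrace_mult_commute[of _ d d]) (use Uc(1) X in \<open>simp_all add: square_closed\<close>)
  then show ?thesis using unitary_cancel(1)[OF U X] by simp
qed

lemma col_norm_unitary:
  assumes U: "unitary_mat d U" and X: "X \<in> carrier_mat d d" and a: "a < d"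
  shows "(\<Sum>i<d. (cmod ((U * X) $$ (i, a)))\<^sup>2) = (\<Sum>i<d. (cmod (X $$ (i, a)))\<^sup>2)"
proof -
  note Uc = unitary_matD[OF U]
  have n: "complex_of_real (\<Sum>i<d. (cmod (Y $$ (i, a)))\<^sup>2) = (adj Y * Y) $$ (a, a)"
    if "Y \<in> carrier_mat d d" for Y
    unfolding of_real_sum complex_norm_square mult_index[OF adj_carrier[OF that] that a a]
    using that a by (intro sum.cong refl) (simp add: mult.commute)
  have "adj (U * X) * (U * X) = adj X * X"
    using Uc(1) X unitary_cancel(1)[OF U X]
    by (simp only: adj_mult[OF Uc(1) X] square_assoc[of _ d] square_closed[of _ d] adj_carrier)
  then have "complex_of_real (\<Sum>i<d. (cmod ((U * X) $$ (i, a)))\<^sup>2) = complex_of_real (\<Sum>i<d. (cmod (X $$ (i, a)))\<^sup>2)"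
    using n[OF X] n[OF square_closed[OF Uc(1) X]] by simp
  then show ?thesis by (simp only: of_real_eq_iff)
qed

lemma row_norm_unitary:
  assumes U: "unitary_mat d U" and X: "X \<in> carrier_mat d d" and a: "a < d"
  shows "(\<Sum>j<d. (cmod ((X * U) $$ (a, j)))\<^sup>2) = (\<Sum>j<d. (cmod (X $$ (a, j)))\<^sup>2)"
proof -
  note Uc = unitary_matD(1)[OF U]
  have s: "(\<Sum>j<d. (cmod (Y $$ (a, j)))\<^sup>2) = (\<Sum>j<d. (cmod (adj Y $$ (j, a)))\<^sup>2)"
    if "Y \<in> carrier_mat d d" for Y
    using that a by (intro sum.cong refl) simp
  show ?thesis
    unfolding s[OF X] s[OF square_closed[OF X Uc]] adj_mult[OF X Uc]
    by (rule col_norm_unitary[OF unitary_mat_adj[OF U] adj_carrier[OF X] a])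
qed

text \<open>Only the inner factor \<open>adj U * U\<close> is cancelled. The outer unitaries stay,
  to be absorbed by column and row norms in the upper bound and by the test unitary in the lower
  one.\<close>

lemma fidelity_conj_diag:
  assumes U: "unitary_mat d U" and N: "unitary_mat d N" and p: "\<And>k. k < d \<Longrightarrow> 0 \<le> p k"
  defines "D \<equiv> mat_diag d (\<lambda>k. complex_of_real (sqrt (p k)))"
  shows "fidelity (conj_diag U (\<lambda>k. complex_of_real (p k))) (conj_diag (U * N) (\<lambda>k. complex_of_real (p k)))
    = trace_norm (U * D * (N * D * adj (U * N)))"
proof -
  note Uc = unitary_matD(1)[OF U] and Nc = unitary_matD(1)[OF N]
  have UN: "unitary_mat d (U * N)" by (rule unitary_mat_mult[OF U N])
  have Dc: "D \<in> carrier_mat d d" unfolding D_def by simp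
  have 1: "msqrt (conj_diag U (\<lambda>k. complex_of_real (p k))) = U * D * adj U"
    using msqrt_conj_diag[OF U p] Uc by (simp add: conj_diag_def D_def)
  have 2: "msqrt (conj_diag (U * N) (\<lambda>k. complex_of_real (p k))) = U * N * D * adj (U * N)"
    using msqrt_conj_diag[OF UN p] Nc by (simp add: conj_diag_def D_def)
  have "U * D * adj U * (U * N * D * adj (U * N)) = U * D * (N * D * adj (U * N))"
    using Uc Nc Dc unitary_cancel(1)[OF U, where m = d]
    by (simp only: square_assoc[of _ d] square_closed[of _ d] adj_carrier)
  then show ?thesis unfolding fidelity_def 1 2 by simp
qed

text \<open>The identity \<open>Q * adj Q\<close> is inserted between the two square roots and
  \<open>trace_norm_mult_le\<close> applied. The squared column and row norms are the outcome
  probabilities of the two states in the basis \<open>Q\<close>, so the right side is their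
  classical (Bhattacharyya) fidelity.\<close>

lemma fidelity_le_measurement:
  assumes U: "unitary_mat d U" and N: "unitary_mat d N" and Q: "unitary_mat d Q"
    and p: "\<And>k. k < d \<Longrightarrow> 0 \<le> p k"
  shows "fidelity (conj_diag U (\<lambda>k. complex_of_real (p k))) (conj_diag (U * N) (\<lambda>k. complex_of_real (p k)))
    \<le> (\<Sum>a<d. sqrt (\<Sum>i<d. p i * (cmod (Q $$ (i, a)))\<^sup>2)
        * sqrt (\<Sum>j<d. p j * (cmod ((adj Q * N) $$ (a, j)))\<^sup>2))"
proof -
  define D where "D = mat_diag d (\<lambda>k. complex_of_real (sqrt (p k)))"
  note Uc = unitary_matD(1)[OF U] and Nc = unitary_matD(1)[OF N] and Qc = unitary_matD(1)[OF Q]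
  have UN: "unitary_mat d (U * N)" by (rule unitary_mat_mult[OF U N])
  have Dc: "D \<in> carrier_mat d d" unfolding D_def by simp
  define B where "B = U * (D * Q)"
  define C where "C = adj Q * N * D * adj (U * N)"
  have Bc: "B \<in> carrier_mat d d" and Cc: "C \<in> carrier_mat d d"
    unfolding B_def C_def using Uc Nc Qc Dc by (simp_all only: square_closed adj_carrier)
  have "U * D * (N * D * adj (U * N)) = B * C"
    unfolding B_def C_def using Uc Nc Qc Dc unitary_cancel(2)[OF Q, where m = d]
    by (simp only: square_assoc[of _ d] square_closed[of _ d] adj_carrier)
  then have "fidelity (conj_diag U (\<lambda>k. complex_of_real (p k))) (conj_diag (U * N) (\<lambda>k. complex_of_real (p k)))
      = trace_norm (B * C)"
    using fidelity_conj_diag[OF U N p] by (simp only: D_def)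
  also have "\<dots> \<le> (\<Sum>a<d. sqrt (\<Sum>i<d. (cmod (B $$ (i, a)))\<^sup>2) * sqrt (\<Sum>j<d. (cmod (C $$ (a, j)))\<^sup>2))"
    by (rule trace_norm_mult_le[OF Bc Cc])
  also have "\<dots> = (\<Sum>a<d. sqrt (\<Sum>i<d. p i * (cmod (Q $$ (i, a)))\<^sup>2)
        * sqrt (\<Sum>j<d. p j * (cmod ((adj Q * N) $$ (a, j)))\<^sup>2))"
  proof (intro sum.cong refl)
    fix a assume "a \<in> {..<d}"
    hence a: "a < d" by simp
    have "(\<Sum>i<d. (cmod (B $$ (i, a)))\<^sup>2) = (\<Sum>i<d. (cmod ((D * Q) $$ (i, a)))\<^sup>2)"
      unfolding B_def by (rule col_norm_unitary[OF U square_closed[OF Dc Qc] a])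
    also have "\<dots> = (\<Sum>i<d. p i * (cmod (Q $$ (i, a)))\<^sup>2)"
      unfolding D_def mat_diag_mult_left[OF Qc] using a p
      by (intro sum.cong refl) (simp add: norm_mult power_mult_distrib)
    finally have 1: "(\<Sum>i<d. (cmod (B $$ (i, a)))\<^sup>2) = (\<Sum>i<d. p i * (cmod (Q $$ (i, a)))\<^sup>2)" .
    have QN: "adj Q * N \<in> carrier_mat d d" using Qc Nc by (simp only: square_closed adj_carrier)
    have "(\<Sum>j<d. (cmod (C $$ (a, j)))\<^sup>2) = (\<Sum>j<d. (cmod ((adj Q * N * D) $$ (a, j)))\<^sup>2)"
      unfolding C_def by (rule row_norm_unitary[OF unitary_mat_adj[OF UN] square_closed[OF QN Dc] a])
    also have "\<dots> = (\<Sum>j<d. p j * (cmod ((adj Q * N) $$ (a, j)))\<^sup>2)"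
      unfolding D_def mat_diag_mult_right[OF QN] using a p
      by (intro sum.cong refl) (simp add: norm_mult power_mult_distrib mult.commute del: index_mult_mat(1))
    finally show "sqrt (\<Sum>i<d. (cmod (B $$ (i, a)))\<^sup>2) * sqrt (\<Sum>j<d. (cmod (C $$ (a, j)))\<^sup>2)
      = sqrt (\<Sum>i<d. p i * (cmod (Q $$ (i, a)))\<^sup>2) * sqrt (\<Sum>j<d. p j * (cmod ((adj Q * N) $$ (a, j)))\<^sup>2)"
      unfolding 1 by simp
  qed
  finally show ?thesis .
qed

text \<open>The trace norm is tested against \<open>W = U * N * (Z * adj U)\<close>, which makes the
  outer unitaries cancel and leaves the trace of \<open>Z * D * (N * D)\<close>.\<close>

lemma fidelity_ge_unitary:
  assumes U: "unitary_mat d U" and N: "unitary_mat d N" and Z: "unitary_mat d Z"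
    and p: "\<And>k. k < d \<Longrightarrow> 0 \<le> p k"
  shows "(\<Sum>i<d. \<Sum>j<d. Re (Z $$ (i, j) * sqrt (p j) * (N $$ (j, i) * sqrt (p i))))
    \<le> fidelity (conj_diag U (\<lambda>k. complex_of_real (p k))) (conj_diag (U * N) (\<lambda>k. complex_of_real (p k)))"
proof -
  define D where "D = mat_diag d (\<lambda>k. complex_of_real (sqrt (p k)))"
  note Uc = unitary_matD(1)[OF U] and Nc = unitary_matD(1)[OF N] and Zc = unitary_matD(1)[OF Z]
  have UN: "unitary_mat d (U * N)" by (rule unitary_mat_mult[OF U N])
  have UNc: "U * N \<in> carrier_mat d d" by (rule square_closed[OF Uc Nc])
  have Dc: "D \<in> carrier_mat d d" unfolding D_def by simp
  define W where "W = U * N * (Z * adj U)"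
  have W: "unitary_mat d W" unfolding W_def
    by (intro unitary_mat_mult unitary_mat_adj U N Z)
  define X where "X = Z * D * (N * D)"
  have Xc: "X \<in> carrier_mat d d" unfolding X_def by (intro square_closed Zc Dc Nc)
  have "W * (U * D * (N * D * adj (U * N))) = U * N * X * adj (U * N)"
    unfolding W_def X_def using Uc Nc Zc Dc UNc unitary_cancel(1)[OF U, where m = d]
    by (simp only: square_assoc[of _ d] square_closed[of _ d] adj_carrier)
  then have "mtrace (W * (U * D * (N * D * adj (U * N)))) = mtrace X"
    using mtrace_unitary_conj[OF UN Xc] by simp
  also have "mtrace X = (\<Sum>i<d. \<Sum>j<d. (Z * D) $$ (i, j) * (N * D) $$ (j, i))"
    unfolding X_def by (rule mtrace_mult) (intro square_closed Zc Dc Nc)+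
  also have "\<dots> = (\<Sum>i<d. \<Sum>j<d. Z $$ (i, j) * sqrt (p j) * (N $$ (j, i) * sqrt (p i)))"
    unfolding D_def mat_diag_mult_right[OF Zc] mat_diag_mult_right[OF Nc] by simp
  finally have 1: "Re (mtrace (W * (U * D * (N * D * adj (U * N)))))
    = (\<Sum>i<d. \<Sum>j<d. Re (Z $$ (i, j) * sqrt (p j) * (N $$ (j, i) * sqrt (p i))))"
    by (simp only: Re_sum)
  have Yc: "U * D * (N * D * adj (U * N)) \<in> carrier_mat d d"
    by (intro square_closed Uc Dc Nc adj_carrier)
  have f: "fidelity (conj_diag U (\<lambda>k. complex_of_real (p k))) (conj_diag (U * N) (\<lambda>k. complex_of_real (p k)))
    = trace_norm (U * D * (N * D * adj (U * N)))"
    unfolding D_def by (rule fidelity_conj_diag[OF U N p])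
  show ?thesis using trace_norm_ge[OF Yc W] unfolding f 1 .
qed

section \<open>Evolved states as unitarily related pairs\<close>

lemma evolve_conj_diag:
  assumes K: "unitary_mat d K" and V: "V \<in> carrier_mat d d"
  shows "evolve (conj_diag K (\<lambda>k. complex_of_real (h k))) \<theta> (conj_diag V f)
    = conj_diag (conj_diag K (\<lambda>k. cis (- (\<theta> * h k))) * V) f"
proof -
  note Kc = unitary_matD(1)[OF K]
  let ?E = "conj_diag K (\<lambda>k. cis (- (\<theta> * h k)))"
  have 1: "mat_exp ((- \<i> * complex_of_real \<theta>) \<cdot>\<^sub>m conj_diag K (\<lambda>k. complex_of_real (h k))) = ?E"
    unfolding mat_exp_conj_diag[OF K] by (simp add: cis_conv_exp mult_ac)
  have 2: "mat_exp ((\<i> * complex_of_real \<theta>) \<cdot>\<^sub>m conj_diag K (\<lambda>k. complex_of_real (h k))) = adj ?E"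
    unfolding mat_exp_conj_diag[OF K] adj_conj_diag cis_cnj by (simp add: cis_conv_exp mult_ac)
  show ?thesis unfolding evolve_def 1 2
    by (rule conj_diag_conj[OF conj_diag_carrier[OF Kc] V])
qed

text \<open>The extra evolution by \<delta> is moved to the right of \<open>V\<close>, into the
  eigenbasis of the state. The pair of states then has eigenbases U and U N with N free of \<theta>,
  which is how \<theta> drops out.\<close>

lemma evolve_shift:
  assumes K: "unitary_mat d K" and V: "unitary_mat d V"
  shows "conj_diag K (\<lambda>k. cis (- ((\<theta> + \<delta>) * h k))) * V
    = conj_diag K (\<lambda>k. cis (- (\<theta> * h k))) * V * conj_diag (adj V * K) (\<lambda>k. cis (- (\<delta> * h k)))"
proof -
  note Kc = unitary_matD(1)[OF K] and Vc = unitary_matD(1)[OF V]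
  let ?E = "\<lambda>\<theta>. conj_diag K (\<lambda>k. cis (- (\<theta> * h k)))"
  have Ec: "?E \<theta> \<in> carrier_mat d d" for \<theta> using Kc by simp
  have "?E (\<theta> + \<delta>) = ?E \<theta> * ?E \<delta>"
    unfolding conj_diag_mult[OF K] cis_mult by (simp add: algebra_simps)
  moreover have "conj_diag (adj V * K) (\<lambda>k. cis (- (\<delta> * h k))) = adj V * ?E \<delta> * V"
    using conj_diag_conj[OF adj_carrier[OF Vc] Kc, of "\<lambda>k. cis (- (\<delta> * h k))"] by simp
  ultimately show ?thesis
    using Ec[of \<theta>] Ec[of \<delta>] Vc unitary_cancel(2)[OF V, where m = d]
    by (simp only: square_assoc[of _ d] square_closed[of _ d] adj_carrier)
qed

section \<open>Second-order expansion of the fidelities\<close>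

lemma hermitian_index:
  assumes "hermitian d A" "i < d" "j < d"
  shows "cnj (A $$ (i, j)) = A $$ (j, i)"
proof -
  have "A \<in> carrier_mat d d" "adj A $$ (j, i) = A $$ (j, i)" using assms(1) by (auto simp: hermitian_def)
  then show ?thesis using assms(2,3) by simp
qed

lemma cis_difference_quotient:
  "((\<lambda>\<delta>. (cis (- (\<delta> * h)) - 1) / complex_of_real \<delta>) \<longlongrightarrow> - \<i> * complex_of_real h) (at 0)"
proof -
  have "((\<lambda>\<delta>. cos (\<delta> * h)) has_real_derivative 0) (at 0)"
    by (auto intro!: derivative_eq_intros)
  hence c: "((\<lambda>\<delta>. (cos (\<delta> * h) - 1) / \<delta>) \<longlongrightarrow> 0) (at 0)"
    by (simp add: DERIV_def)
  have "((\<lambda>\<delta>. sin (\<delta> * h)) has_real_derivative h) (at 0)"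
    by (auto intro!: derivative_eq_intros)
  hence s: "((\<lambda>\<delta>. sin (\<delta> * h) / \<delta>) \<longlongrightarrow> h) (at 0)"
    by (simp add: DERIV_def)
  show ?thesis unfolding tendsto_complex_iff
    using c tendsto_minus[OF s] by (simp add: Re_divide_of_real Im_divide_of_real)
qed

lemma propagator_difference_quotient:
  assumes R: "unitary_mat d R" and ij: "i < d" "j < d"
  shows "((\<lambda>\<delta>. (conj_diag R (\<lambda>k. cis (- (\<delta> * h k))) $$ (i, j) - (if i = j then 1 else 0)) / complex_of_real \<delta>)
    \<longlongrightarrow> - \<i> * conj_diag R (\<lambda>k. complex_of_real (h k)) $$ (i, j)) (at 0)"
proof -
  note Rc = unitary_matD(1)[OF R]
  have "((\<lambda>\<delta>. \<Sum>k<d. R $$ (i, k) * ((cis (- (\<delta> * h k)) - 1) / complex_of_real \<delta>) * cnj (R $$ (j, k)))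
    \<longlongrightarrow> (\<Sum>k<d. R $$ (i, k) * (- \<i> * complex_of_real (h k)) * cnj (R $$ (j, k)))) (at 0)"
    by (intro tendsto_sum tendsto_mult tendsto_const cis_difference_quotient)
  also have "(\<lambda>\<delta>. \<Sum>k<d. R $$ (i, k) * ((cis (- (\<delta> * h k)) - 1) / complex_of_real \<delta>) * cnj (R $$ (j, k)))
    = (\<lambda>\<delta>. (conj_diag R (\<lambda>k. cis (- (\<delta> * h k))) $$ (i, j) - (if i = j then 1 else 0)) / complex_of_real \<delta>)"
    unfolding conj_diag_index[OF Rc ij] unitary_rows[OF R ij, symmetric] sum_subtractf[symmetric] sum_divide_distrib
    by (intro ext sum.cong refl) (simp add: algebra_simps diff_divide_distrib)
  also have "(\<Sum>k<d. R $$ (i, k) * (- \<i> * complex_of_real (h k)) * cnj (R $$ (j, k)))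
    = - \<i> * conj_diag R (\<lambda>k. complex_of_real (h k)) $$ (i, j)"
    unfolding conj_diag_index[OF Rc ij] sum_distrib_left by (intro sum.cong refl) simp
  finally show ?thesis .
qed

lemma unitary_row_norm:
  assumes "unitary_mat d N" "i < d"
  shows "(\<Sum>j<d. (cmod (N $$ (i, j)))\<^sup>2) = 1"
proof -
  have "complex_of_real (\<Sum>j<d. (cmod (N $$ (i, j)))\<^sup>2) = 1"
    unfolding of_real_sum complex_norm_square using unitary_rows[OF assms(1) assms(2,2)] by simp
  then show ?thesis by (simp only: of_real_eq_1_iff)
qed

lemma unitary_col_norm:
  assumes "unitary_mat d N" "j < d"
  shows "(\<Sum>i<d. (cmod (N $$ (i, j)))\<^sup>2) = 1"
proof -
  have "complex_of_real (\<Sum>i<d. (cmod (N $$ (i, j)))\<^sup>2) = (\<Sum>i<d. cnj (N $$ (i, j)) * N $$ (i, j))"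
    unfolding of_real_sum complex_norm_square by (intro sum.cong refl mult.commute)
  also have "\<dots> = 1" using unitary_cols[OF assms(1) assms(2,2)] by simp
  finally show ?thesis by (simp only: of_real_eq_1_iff)
qed

lemma mtrace_conj_diag_mult:
  assumes U: "unitary_mat d U" and N: "unitary_mat d N"
  shows "mtrace (conj_diag U (\<lambda>k. complex_of_real (f k)) * conj_diag (U * N) (\<lambda>k. complex_of_real (g k)))
    = complex_of_real (\<Sum>i<d. \<Sum>j<d. f i * g j * (cmod (N $$ (i, j)))\<^sup>2)"
proof -
  note Uc = unitary_matD(1)[OF U] and Nc = unitary_matD(1)[OF N]
  let ?F = "mat_diag d (\<lambda>k. complex_of_real (f k))"
  let ?G = "conj_diag N (\<lambda>k. complex_of_real (g k))"
  have Gc: "?G \<in> carrier_mat d d" using Nc by simp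
  have "conj_diag U (\<lambda>k. complex_of_real (f k)) * conj_diag (U * N) (\<lambda>k. complex_of_real (g k))
      = U * ?F * adj U * (U * ?G * adj U)"
    unfolding conj_diag_conj[OF Uc Nc, symmetric] using Uc by (simp only: conj_diag_def[of U] carrier_matD)
  also have "\<dots> = U * (?F * ?G) * adj U"
    using Uc Gc unitary_cancel(1)[OF U, where m = d]
    by (simp only: square_assoc[of _ d] square_closed[of _ d] adj_carrier mat_diag_dim)
  finally have "mtrace (conj_diag U (\<lambda>k. complex_of_real (f k)) * conj_diag (U * N) (\<lambda>k. complex_of_real (g k)))
      = mtrace (?F * ?G)"
    using mtrace_unitary_conj[OF U square_closed[OF mat_diag_dim Gc]] by simp
  also have "\<dots> = (\<Sum>i<d. complex_of_real (f i) * ?G $$ (i, i))"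
    unfolding mat_diag_mult_left[OF Gc] mtrace_def by simp
  also have "\<dots> = (\<Sum>i<d. \<Sum>j<d. complex_of_real (f i * g j) * (N $$ (i, j) * cnj (N $$ (i, j))))"
    using Nc by (intro sum.cong refl) (simp add: conj_diag_index[OF Nc] sum_distrib_left mult_ac)
  finally show ?thesis by (simp only: of_real_sum of_real_mult complex_norm_square)
qed

text \<open>The squared terms see only the marginals of the doubly stochastic
  \<open>N\<close>.\<close>

lemma weight_sum_sq_diff:
  fixes N :: "nat \<Rightarrow> nat \<Rightarrow> real"
  assumes r: "\<And>i. i < d \<Longrightarrow> (\<Sum>j<d. N i j) = 1" and c: "\<And>j. j < d \<Longrightarrow> (\<Sum>i<d. N i j) = 1"
  shows "(\<Sum>i<d. \<Sum>j<d. (p i - p j)\<^sup>2 * N i j)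
    = 2 * (\<Sum>i<d. (p i)\<^sup>2) - 2 * (\<Sum>i<d. \<Sum>j<d. p i * p j * N i j)"
proof -
  have 1: "(\<Sum>i<d. \<Sum>j<d. (p i)\<^sup>2 * N i j) = (\<Sum>i<d. (p i)\<^sup>2)"
    by (simp add: sum_distrib_left[symmetric] r)
  have 2: "(\<Sum>i<d. \<Sum>j<d. (p j)\<^sup>2 * N i j) = (\<Sum>i<d. (p i)\<^sup>2)"
    by (subst sum.swap) (simp add: sum_distrib_left[symmetric] c)
  have "(\<Sum>i<d. \<Sum>j<d. (p i - p j)\<^sup>2 * N i j)
     = (\<Sum>i<d. \<Sum>j<d. (p i)\<^sup>2 * N i j) + (\<Sum>i<d. \<Sum>j<d. (p j)\<^sup>2 * N i j) - 2 * (\<Sum>i<d. \<Sum>j<d. p i * p j * N i j)"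
    unfolding sum_distrib_left sum.distrib[symmetric] sum_subtractf[symmetric]
    by (intro sum.cong refl) (simp add: power2_eq_square algebra_simps)
  then show ?thesis unfolding 1 2 by simp
qed

text \<open>Both states have the same purity, so the square root in \<open>super_fidelity\<close>
  collapses and 1 - G is the purity minus the overlap.\<close>

lemma super_fidelity_conj_diag:
  assumes U: "unitary_mat d U" and N: "unitary_mat d N"
    and p: "\<And>k. k < d \<Longrightarrow> 0 \<le> p k" and p1: "(\<Sum>k<d. p k) = 1"
  defines "G \<equiv> super_fidelity (conj_diag U (\<lambda>k. complex_of_real (p k))) (conj_diag (U * N) (\<lambda>k. complex_of_real (p k)))"
  shows "1 - G = (\<Sum>i<d. \<Sum>j<d. (p i - p j)\<^sup>2 * (cmod (N $$ (i, j)))\<^sup>2) / 2" and "0 \<le> G"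
proof -
  have pur: "mtrace (conj_diag W (\<lambda>k. complex_of_real (p k)) * conj_diag W (\<lambda>k. complex_of_real (p k)))
      = complex_of_real (\<Sum>k<d. (p k)\<^sup>2)" if "unitary_mat d W" for W
    unfolding conj_diag_mult[OF that] mtrace_conj_diag[OF that] by (simp add: power2_eq_square)
  have UN: "unitary_mat d (U * N)" by (rule unitary_mat_mult[OF U N])
  have "p k \<le> 1" if "k < d" for k
    using member_le_sum[of k "{..<d}" p] p p1 that by auto
  hence "(\<Sum>k<d. (p k)\<^sup>2) \<le> (\<Sum>k<d. p k)"
    using p by (intro sum_mono) (simp add: power2_eq_square mult_left_le)
  hence pur1: "0 \<le> 1 - (\<Sum>k<d. (p k)\<^sup>2)" using p1 by simp
  have G: "G = (\<Sum>i<d. \<Sum>j<d. p i * p j * (cmod (N $$ (i, j)))\<^sup>2) + (1 - (\<Sum>k<d. (p k)\<^sup>2))"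
    unfolding G_def super_fidelity_def mtrace_conj_diag_mult[OF U N] pur[OF U] pur[OF UN] Re_complex_of_real
    using pur1 by simp
  show "1 - G = (\<Sum>i<d. \<Sum>j<d. (p i - p j)\<^sup>2 * (cmod (N $$ (i, j)))\<^sup>2) / 2"
    unfolding G
    by (subst weight_sum_sq_diff[of d "\<lambda>i j. (cmod (N $$ (i, j)))\<^sup>2"])
       (auto simp: unitary_row_norm[OF N] unitary_col_norm[OF N])
  show "0 \<le> G" unfolding G using pur1 p by (intro add_nonneg_nonneg sum_nonneg) auto
qed

text \<open>As 1 - sqrt G = (1 - G)/(1 + sqrt G) and G tends to 1, the square root halves the limit;
  with the 1/2 in \<open>super_fidelity_conj_diag\<close> and the prefactor 8 this leaves 2. The
  weight vanishes for i = j, so only entries of N of first order in \<delta> enter.\<close>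

lemma subQFI_eq:
  assumes K: "unitary_mat d K" and V: "unitary_mat d V"
    and p: "\<And>k. k < d \<Longrightarrow> 0 \<le> p k" and p1: "(\<Sum>k<d. p k) = 1"
  shows "subQFI (conj_diag K (\<lambda>k. complex_of_real (h k))) (conj_diag V (\<lambda>k. complex_of_real (p k))) \<theta>
    = 2 * (\<Sum>i<d. \<Sum>j<d. (p i - p j)\<^sup>2 * (cmod (conj_diag (adj V * K) (\<lambda>k. complex_of_real (h k)) $$ (i, j)))\<^sup>2)"
proof -
  define R where "R = adj V * K"
  have R: "unitary_mat d R" unfolding R_def by (rule unitary_mat_mult[OF unitary_mat_adj[OF V] K])
  define N where "N \<delta> = conj_diag R (\<lambda>k. cis (- (\<delta> * h k)))" for \<delta>
  have N: "unitary_mat d (N \<delta>)" for \<delta> unfolding N_def by (rule unitary_conj_diag[OF R]) simp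
  define H where "H = conj_diag R (\<lambda>k. complex_of_real (h k))"
  define U where "U = conj_diag K (\<lambda>k. cis (- (\<theta> * h k))) * V"
  have U: "unitary_mat d U" unfolding U_def by (rule unitary_mat_mult[OF unitary_conj_diag[OF K] V]) simp
  define G where "G \<delta> = super_fidelity (conj_diag U (\<lambda>k. complex_of_real (p k))) (conj_diag (U * N \<delta>) (\<lambda>k. complex_of_real (p k)))" for \<delta>
  have G: "1 - G \<delta> = (\<Sum>i<d. \<Sum>j<d. (p i - p j)\<^sup>2 * (cmod (N \<delta> $$ (i, j)))\<^sup>2) / 2" "0 \<le> G \<delta>" for \<delta>
    unfolding G_def by (rule super_fidelity_conj_diag[OF U N p p1], assumption)+
  define s where "s = (\<Sum>i<d. \<Sum>j<d. (p i - p j)\<^sup>2 * (cmod (H $$ (i, j)))\<^sup>2)"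
  have "((\<lambda>\<delta>. (\<Sum>i<d. \<Sum>j<d. (p i - p j)\<^sup>2 * ((cmod (N \<delta> $$ (i, j)))\<^sup>2 / \<delta>\<^sup>2))) \<longlongrightarrow> s) (at 0)"
    unfolding s_def
  proof (intro tendsto_sum)
    fix i j assume "i \<in> {..<d}" "j \<in> {..<d}"
    hence ij: "i < d" "j < d" by auto
    show "((\<lambda>\<delta>. (p i - p j)\<^sup>2 * ((cmod (N \<delta> $$ (i, j)))\<^sup>2 / \<delta>\<^sup>2)) \<longlongrightarrow> (p i - p j)\<^sup>2 * (cmod (H $$ (i, j)))\<^sup>2) (at 0)"
    proof (cases "i = j")
      case False
      have "((\<lambda>\<delta>. (cmod ((N \<delta> $$ (i, j) - 0) / complex_of_real \<delta>))\<^sup>2) \<longlongrightarrow> (cmod (- \<i> * H $$ (i, j)))\<^sup>2) (at 0)"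
        using propagator_difference_quotient[OF R ij, of h] False unfolding N_def H_def
        by (intro tendsto_intros) simp
      then show ?thesis
        by (intro tendsto_mult tendsto_const) (simp add: norm_divide norm_mult power_divide)
    qed simp
  qed
  hence "((\<lambda>\<delta>. (\<Sum>i<d. \<Sum>j<d. (p i - p j)\<^sup>2 * ((cmod (N \<delta> $$ (i, j)))\<^sup>2 / \<delta>\<^sup>2)) / 2) \<longlongrightarrow> s / 2) (at 0)"
    by (intro tendsto_divide tendsto_const) auto
  also have "(\<lambda>\<delta>. (\<Sum>i<d. \<Sum>j<d. (p i - p j)\<^sup>2 * ((cmod (N \<delta> $$ (i, j)))\<^sup>2 / \<delta>\<^sup>2)) / 2)
      = (\<lambda>\<delta>. (1 - G \<delta>) / \<delta>\<^sup>2)"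
    unfolding G(1) sum_divide_distrib by (intro ext sum.cong refl) simp
  finally have lim: "((\<lambda>\<delta>. (1 - G \<delta>) / \<delta>\<^sup>2) \<longlongrightarrow> s / 2) (at 0)" .
  have "((\<lambda>\<delta>. (1 - G \<delta>) / \<delta>\<^sup>2 * \<delta>\<^sup>2) \<longlongrightarrow> s / 2 * 0\<^sup>2) (at 0)"
    by (intro tendsto_mult lim tendsto_power tendsto_ident_at)
  hence "((\<lambda>\<delta>. (1 - G \<delta>) / \<delta>\<^sup>2 * \<delta>\<^sup>2) \<longlongrightarrow> 0) (at 0)"
    by (simp only: zero_power2 mult_zero_right)
  hence "((\<lambda>\<delta>. 1 - G \<delta>) \<longlongrightarrow> 0) (at 0)"
    by (rule Lim_transform_eventually) (auto simp: eventually_at_filter)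
  from tendsto_diff[OF tendsto_const[of 1] this] have G1: "(G \<longlongrightarrow> 1) (at 0)" by simp
  have "((\<lambda>\<delta>. (1 - G \<delta>) / \<delta>\<^sup>2 / (1 + sqrt (G \<delta>))) \<longlongrightarrow> s / 2 / (1 + sqrt 1)) (at 0)"
    by (intro tendsto_divide lim tendsto_add tendsto_const tendsto_real_sqrt G1) simp
  also have "(\<lambda>\<delta>. (1 - G \<delta>) / \<delta>\<^sup>2 / (1 + sqrt (G \<delta>))) = (\<lambda>\<delta>. (1 - sqrt (G \<delta>)) / \<delta>\<^sup>2)"
  proof
    fix \<delta>
    have e: "(1 - sqrt (G \<delta>)) * (1 + sqrt (G \<delta>)) = 1 - G \<delta>"
      using G(2)[of \<delta>] by (simp add: algebra_simps)
    have "1 + sqrt (G \<delta>) \<noteq> 0" using real_sqrt_ge_zero[OF G(2)[of \<delta>]] by linarith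
    then show "(1 - G \<delta>) / \<delta>\<^sup>2 / (1 + sqrt (G \<delta>)) = (1 - sqrt (G \<delta>)) / \<delta>\<^sup>2"
      unfolding e[symmetric] by simp
  qed
  finally have "Lim (at 0) (\<lambda>\<delta>. (1 - sqrt (G \<delta>)) / \<delta>\<^sup>2) = s / 4"
    by (intro tendsto_Lim) auto
  then show ?thesis
    unfolding subQFI_def evolve_conj_diag[OF K unitary_matD(1)[OF V]] evolve_shift[OF K V]
      R_def[symmetric] N_def[symmetric] U_def[symmetric] G_def[symmetric] H_def[symmetric] s_def[symmetric]
    by simp
qed


section \<open>The Uhlmann fidelity to second order, from both sides\<close>

lemma frobenius_unitary_conj:
  assumes S: "unitary_mat d S" and R: "unitary_mat d R" and X: "X \<in> carrier_mat d d"
  shows "(\<Sum>a<d. \<Sum>b<d. (cmod ((adj S * X * R) $$ (a, b)))\<^sup>2) = (\<Sum>i<d. \<Sum>j<d. (cmod (X $$ (i, j)))\<^sup>2)"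
proof -
  have SX: "adj S * X \<in> carrier_mat d d" by (intro square_closed adj_carrier unitary_matD(1)[OF S] X)
  have "(\<Sum>a<d. \<Sum>b<d. (cmod ((adj S * X * R) $$ (a, b)))\<^sup>2) = (\<Sum>a<d. \<Sum>b<d. (cmod ((adj S * X) $$ (a, b)))\<^sup>2)"
    by (intro sum.cong refl row_norm_unitary[OF R SX]) simp
  also have "\<dots> = (\<Sum>b<d. \<Sum>a<d. (cmod ((adj S * X) $$ (a, b)))\<^sup>2)" by (rule sum.swap)
  also have "\<dots> = (\<Sum>b<d. \<Sum>a<d. (cmod (X $$ (a, b)))\<^sup>2)"
    by (intro sum.cong refl col_norm_unitary[OF unitary_mat_adj[OF S] X]) simp
  finally show ?thesis by (subst (asm) (2) sum.swap)
qed

text \<open>Valid for all x, so the estimate of 1 - F built on it holds for each \<delta> without a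
  remainder term.\<close>

lemma one_minus_cos_le: "1 - cos x \<le> x\<^sup>2 / 2" for x :: real
proof -
  have "(sin (x / 2))\<^sup>2 \<le> (x / 2)\<^sup>2"
    using abs_sin_x_le_abs_x[of "x / 2"] unfolding abs_le_square_iff .
  moreover have "cos x = 1 - 2 * (sin (x / 2))\<^sup>2"
    using cos_double_sin[of "x / 2"] by simp
  ultimately show ?thesis by (simp add: power_divide)
qed

text \<open>The left side is the real part of a trace of two propagators separated by square roots
  of the state. Expanded in both eigenbases, each pair (a, b) contributes the phase
  \<open>cis (x a - y b)\<close> with weight |C_ab|^2, where \<open>C\<close> is the matrix of the
  square root between the two bases.\<close>

lemma conj_diag_trace_cos:
  fixes w x y :: "nat \<Rightarrow> real"
  assumes S: "S \<in> carrier_mat d d" and R: "R \<in> carrier_mat d d"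
  defines "C \<equiv> adj S * mat_diag d (\<lambda>k. complex_of_real (w k)) * R"
  shows "(\<Sum>i<d. \<Sum>j<d. Re (conj_diag S (\<lambda>k. cis (x k)) $$ (i, j) * w j * (conj_diag R (\<lambda>k. cis (- y k)) $$ (j, i) * w i)))
    = (\<Sum>a<d. \<Sum>b<d. cos (x a - y b) * (cmod (C $$ (a, b)))\<^sup>2)"
proof -
  let ?D = "mat_diag d (\<lambda>k. complex_of_real (w k))"
  have C: "C $$ (a, b) = (\<Sum>j<d. cnj (S $$ (j, a)) * w j * R $$ (j, b))" if "a < d" "b < d" for a b
  proof -
    have SD: "adj S * ?D \<in> carrier_mat d d" using S by (intro square_closed adj_carrier mat_diag_dim)
    have "(adj S * ?D) $$ (a, j) = cnj (S $$ (j, a)) * w j" if "j < d" for j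
      unfolding mat_diag_mult_right[OF adj_carrier[OF S]] using that \<open>a < d\<close> S by simp
    then show ?thesis unfolding C_def mult_index[OF SD R that] by simp
  qed
  have "(\<Sum>i<d. \<Sum>j<d. conj_diag S (\<lambda>k. cis (x k)) $$ (i, j) * w j * (conj_diag R (\<lambda>k. cis (- y k)) $$ (j, i) * w i))
      = (\<Sum>i<d. \<Sum>j<d. \<Sum>a<d. \<Sum>b<d. cis (x a) * cis (- y b) *
          ((cnj (S $$ (j, a)) * w j * R $$ (j, b)) * cnj (cnj (S $$ (i, a)) * w i * R $$ (i, b))))"
  proof (intro sum.cong refl)
    fix i j assume "i \<in> {..<d}" "j \<in> {..<d}"
    hence ij: "i < d" "j < d" by auto
    have "conj_diag S (\<lambda>k. cis (x k)) $$ (i, j) * w j * (conj_diag R (\<lambda>k. cis (- y k)) $$ (j, i) * w i)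
      = (conj_diag S (\<lambda>k. cis (x k)) $$ (i, j) * conj_diag R (\<lambda>k. cis (- y k)) $$ (j, i)) * (w j * w i)"
      by simp
    also have "\<dots> = (\<Sum>a<d. \<Sum>b<d. cis (x a) * cis (- y b) *
          ((cnj (S $$ (j, a)) * w j * R $$ (j, b)) * cnj (cnj (S $$ (i, a)) * w i * R $$ (i, b))))"
      unfolding conj_diag_index[OF S ij] conj_diag_index[OF R ij(2,1)] sum_product
      unfolding sum_distrib_right
      by (intro sum.cong refl) simp
    finally show "conj_diag S (\<lambda>k. cis (x k)) $$ (i, j) * w j * (conj_diag R (\<lambda>k. cis (- y k)) $$ (j, i) * w i)
      = (\<Sum>a<d. \<Sum>b<d. cis (x a) * cis (- y b) *
          ((cnj (S $$ (j, a)) * w j * R $$ (j, b)) * cnj (cnj (S $$ (i, a)) * w i * R $$ (i, b))))" .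
  qed
  also have "\<dots> = (\<Sum>a<d. \<Sum>b<d. \<Sum>j<d. \<Sum>i<d. cis (x a) * cis (- y b) *
          ((cnj (S $$ (j, a)) * w j * R $$ (j, b)) * cnj (cnj (S $$ (i, a)) * w i * R $$ (i, b))))"
    by (subst sum.swap) (rule sum_swap4)
  \<comment> \<open>With j outside i, the inner double sum factors into an entry of \<open>C\<close>
    times its conjugate.\<close>
  also have "\<dots> = (\<Sum>a<d. \<Sum>b<d. cis (x a - y b) * (C $$ (a, b) * cnj (C $$ (a, b))))"
    unfolding sum_distrib_left[symmetric]
    by (intro sum.cong refl) (simp only: C cnj_sum sum_distrib_right cis_mult lessThan_iff diff_conv_add_uminus)
  also have "\<dots> = (\<Sum>a<d. \<Sum>b<d. complex_of_real ((cmod (C $$ (a, b)))\<^sup>2) * cis (x a - y b))"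
    by (simp only: complex_norm_square mult.commute)
  finally have "(\<Sum>i<d. \<Sum>j<d. conj_diag S (\<lambda>k. cis (x k)) $$ (i, j) * w j * (conj_diag R (\<lambda>k. cis (- y k)) $$ (j, i) * w i))
      = (\<Sum>a<d. \<Sum>b<d. complex_of_real ((cmod (C $$ (a, b)))\<^sup>2) * cis (x a - y b))" .
  then have "Re (\<Sum>i<d. \<Sum>j<d. conj_diag S (\<lambda>k. cis (x k)) $$ (i, j) * w j * (conj_diag R (\<lambda>k. cis (- y k)) $$ (j, i) * w i))
      = Re (\<Sum>a<d. \<Sum>b<d. complex_of_real ((cmod (C $$ (a, b)))\<^sup>2) * cis (x a - y b))"
    by (rule arg_cong)
  moreover have e: "Re (complex_of_real r * cis t) = cos t * r" for r t by simp
  ultimately show ?thesis unfolding Re_sum e by - assumption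
qed

text \<open>This is \<open>tr(\<rho> L\<^sup>2)\<close> for \<open>L\<close> with \<open>\<rho> L + L \<rho> = - \<i> [H, \<rho>]\<close>, \<open>\<rho>\<close> diagonal with entries \<open>p\<close>. Pairs
  with \<open>p i = p j = 0\<close> do not contribute, since \<open>x / 0 = 0\<close>.\<close>

definition sld_weight :: "nat \<Rightarrow> (nat \<Rightarrow> real) \<Rightarrow> complex mat \<Rightarrow> real" where
  "sld_weight d p H = (\<Sum>i<d. \<Sum>j<d. p i * ((p i - p j) / (p i + p j))\<^sup>2 * (cmod (H $$ (i, j)))\<^sup>2)"

text \<open>The |C_ab|^2 sum to the trace of the state, 1. Hence 1 - F is at most the
  |C_ab|^2-average of 1 - cos(\<delta> (z_a - h_b)), which is at most \<delta>^2/2 times the squared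
  Frobenius norm of \<open>X\<close>; between the eigenbases of \<open>Z\<close> and
  \<open>H\<close> the entries of \<open>X\<close> are (z_a - h_b) C_ab.\<close>

lemma one_minus_fidelity_le:
  fixes p h :: "nat \<Rightarrow> real"
  assumes U: "unitary_mat d U" and R: "unitary_mat d R"
    and p: "\<And>k. k < d \<Longrightarrow> 0 \<le> p k" and p1: "(\<Sum>k<d. p k) = 1"
  defines "H \<equiv> conj_diag R (\<lambda>k. complex_of_real (h k))"
  shows "1 - fidelity (conj_diag U (\<lambda>k. complex_of_real (p k)))
        (conj_diag (U * conj_diag R (\<lambda>k. cis (- (\<delta> * h k)))) (\<lambda>k. complex_of_real (p k)))
    \<le> \<delta>\<^sup>2 / 2 * sld_weight d p H"
proof -
  note Rc = unitary_matD[OF R]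
  have Hc: "H \<in> carrier_mat d d" unfolding H_def using Rc(1) by simp
  have Hcnj: "cnj (H $$ (i, j)) = H $$ (j, i)" if "i < d" "j < d" for i j
    using hermitian_index[OF _ that] hermitian_conj_diag[OF Rc(1), of h] unfolding H_def by blast
  \<comment> \<open>Minimizing |Z_ij sqrt p_j - sqrt p_i H_ij|^2 + |Z_ij sqrt p_i - sqrt p_j
    H_ij|^2, the contribution of the positions (i,j) and (j,i) to the norm of \<open>X\<close>,
    gives (p_i + p_j) Z_ij = 2 sqrt(p_i p_j) H_ij. If p_i = p_j = 0, the entry is 0 by division by
    zero.\<close>
  define Z where "Z = mat d d (\<lambda>(i, j). complex_of_real (2 * sqrt (p i) * sqrt (p j) / (p i + p j)) * H $$ (i, j))"
  have Zc: "Z \<in> carrier_mat d d" by (simp add: Z_def)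
  have "adj Z = Z"
    by (rule eq_matI) (auto simp: Z_def Hcnj add.commute mult_ac)
  hence "hermitian d Z" using Zc by (simp add: hermitian_def)
  then obtain S z where S: "unitary_mat d S" and Zd: "Z = conj_diag S (\<lambda>k. complex_of_real (z k))"
    using hermitian_spectral by blast
  note Sc = unitary_matD[OF S]
  define D where "D = mat_diag d (\<lambda>k. complex_of_real (sqrt (p k)))"
  have Dc: "D \<in> carrier_mat d d" by (simp add: D_def)
  define C where "C = adj S * D * R"
  have Cc: "C \<in> carrier_mat d d" unfolding C_def by (intro square_closed adj_carrier Sc Dc Rc)
  define X where "X = Z * D - D * H"
  have Xc: "X \<in> carrier_mat d d" unfolding X_def by (intro minus_carrier_mat square_closed Dc Hc)
  have cC: "(\<Sum>a<d. \<Sum>b<d. (cmod (C $$ (a, b)))\<^sup>2) = 1"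
  proof -
    have "(\<Sum>a<d. \<Sum>b<d. (cmod (C $$ (a, b)))\<^sup>2) = (\<Sum>i<d. \<Sum>j<d. (cmod (D $$ (i, j)))\<^sup>2)"
      unfolding C_def by (rule frobenius_unitary_conj[OF S R Dc])
    also have "\<dots> = (\<Sum>i<d. \<Sum>j<d. if i = j then p i else 0)"
      using p by (intro sum.cong refl) (auto simp: D_def mat_diag_def)
    finally show ?thesis using p1 by simp
  qed
  have XC: "(adj S * X * R) $$ (a, b) = complex_of_real (z a - h b) * C $$ (a, b)" if "a < d" "b < d" for a b
  proof -
    let ?z = "mat_diag d (\<lambda>k. complex_of_real (z k))" and ?h = "mat_diag d (\<lambda>k. complex_of_real (h k))"
    have 1: "adj S * (Z * D) * R = ?z * C"
      unfolding Zd C_def conj_diag_def using Sc(1) Dc Rc(1) unitary_cancel(1)[OF S, where m = d]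
      by (simp only: carrier_matD square_assoc[of _ d] square_closed[of _ d] adj_carrier mat_diag_dim)
    have 2: "adj S * (D * H) * R = C * ?h"
      unfolding H_def C_def conj_diag_def using Sc(1) Dc Rc(1,2)
      by (simp only: carrier_matD square_assoc[of _ d] square_closed[of _ d] adj_carrier mat_diag_dim right_mult_one_mat[of _ d d])
    have "adj S * X * R = adj S * (Z * D) * R - adj S * (D * H) * R"
      unfolding X_def using Sc(1) Dc Rc(1) Zc Hc
      by (simp only: mult_minus_distrib_mat[of _ d d _ d] minus_mult_distrib_mat[of _ d d _ _ d] square_closed[of _ d] adj_carrier)
    also have "\<dots> = ?z * C - C * ?h" unfolding 1 2 ..
    finally show ?thesis
      using that Cc by (simp add: mat_diag_mult_left[OF Cc] mat_diag_mult_right[OF Cc] algebra_simps)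
  qed
  have sw: "(\<Sum>a<d. \<Sum>b<d. (z a - h b)\<^sup>2 * (cmod (C $$ (a, b)))\<^sup>2) = sld_weight d p H"
  proof -
    have "(\<Sum>a<d. \<Sum>b<d. (z a - h b)\<^sup>2 * (cmod (C $$ (a, b)))\<^sup>2) = (\<Sum>a<d. \<Sum>b<d. (cmod ((adj S * X * R) $$ (a, b)))\<^sup>2)"
      by (intro sum.cong refl) (simp add: XC norm_mult power_mult_distrib del: of_real_diff index_mult_mat(1))
    also have "\<dots> = (\<Sum>i<d. \<Sum>j<d. (cmod (X $$ (i, j)))\<^sup>2)" by (rule frobenius_unitary_conj[OF S R Xc])
    also have "\<dots> = sld_weight d p H" unfolding sld_weight_def
    proof (intro sum.cong refl)
      fix i j assume "i \<in> {..<d}" "j \<in> {..<d}"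
      hence ij: "i < d" "j < d" by auto
      have "X $$ (i, j) = Z $$ (i, j) * sqrt (p j) - sqrt (p i) * H $$ (i, j)"
        unfolding X_def D_def mat_diag_mult_left[OF Hc] mat_diag_mult_right[OF Zc] using ij by simp
      also have "\<dots> = complex_of_real (2 * sqrt (p i) * (sqrt (p j) * sqrt (p j)) / (p i + p j) - sqrt (p i)) * H $$ (i, j)"
        using ij by (simp add: Z_def algebra_simps del: real_sqrt_mult_self)
      also have "2 * sqrt (p i) * (sqrt (p j) * sqrt (p j)) / (p i + p j) - sqrt (p i) = - (sqrt (p i) * ((p i - p j) / (p i + p j)))"
      proof (cases "p i = 0")
        case False
        hence "p i + p j \<noteq> 0" using p[OF ij(1)] p[OF ij(2)] by linarith
        then show ?thesis using p[OF ij(2)] by (simp add: field_simps)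
      qed simp
      finally show "(cmod (X $$ (i, j)))\<^sup>2 = p i * ((p i - p j) / (p i + p j))\<^sup>2 * (cmod (H $$ (i, j)))\<^sup>2"
        using p[OF ij(1)] by (simp only: norm_mult norm_of_real abs_minus_cancel abs_mult power_mult_distrib power2_abs) simp
    qed
    finally show ?thesis .
  qed
  define N where "N = conj_diag R (\<lambda>k. cis (- (\<delta> * h k)))"
  have N: "unitary_mat d N" unfolding N_def by (rule unitary_conj_diag[OF R]) simp
  have SZ: "unitary_mat d (conj_diag S (\<lambda>k. cis (\<delta> * z k)))" by (rule unitary_conj_diag[OF S]) simp
  have "(\<Sum>a<d. \<Sum>b<d. cos (\<delta> * z a - \<delta> * h b) * (cmod (C $$ (a, b)))\<^sup>2)
    \<le> fidelity (conj_diag U (\<lambda>k. complex_of_real (p k))) (conj_diag (U * N) (\<lambda>k. complex_of_real (p k)))"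
    using fidelity_ge_unitary[where p = p, OF U N SZ p]
    unfolding N_def conj_diag_trace_cos[OF Sc(1) Rc(1)] D_def[symmetric] C_def[symmetric] .
  hence "1 - fidelity (conj_diag U (\<lambda>k. complex_of_real (p k))) (conj_diag (U * N) (\<lambda>k. complex_of_real (p k)))
    \<le> (\<Sum>a<d. \<Sum>b<d. (1 - cos (\<delta> * z a - \<delta> * h b)) * (cmod (C $$ (a, b)))\<^sup>2)"
    using cC by (simp add: left_diff_distrib sum_subtractf)
  also have "\<dots> \<le> (\<Sum>a<d. \<Sum>b<d. (\<delta> * z a - \<delta> * h b)\<^sup>2 / 2 * (cmod (C $$ (a, b)))\<^sup>2)"
    by (intro sum_mono mult_right_mono one_minus_cos_le) simp
  also have "\<dots> = (\<Sum>a<d. \<Sum>b<d. \<delta>\<^sup>2 / 2 * ((z a - h b)\<^sup>2 * (cmod (C $$ (a, b)))\<^sup>2))"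
    by (intro sum.cong refl) (simp add: right_diff_distrib[symmetric] power_mult_distrib)
  finally show ?thesis unfolding sw[symmetric] N_def sum_distrib_left .
qed

text \<open>The bound \<open>b\<close> comes from one fixed measurement, so it involves only
  \<open>R\<close>, \<open>h\<close> and \<open>p\<close> and serves every \<open>U\<close>. It is
  half the sum of squared difference quotients of square roots of outcome probabilities, a Hellinger
  distance, with limit half the Fisher information.\<close>

lemma one_minus_fidelity_ge_tendsto:
  fixes p h :: "nat \<Rightarrow> real"
  assumes R: "unitary_mat d R" and p: "\<And>k. k < d \<Longrightarrow> 0 \<le> p k" and p1: "(\<Sum>k<d. p k) = 1"
  defines "H \<equiv> conj_diag R (\<lambda>k. complex_of_real (h k))"
    and "N \<equiv> \<lambda>\<delta>. conj_diag R (\<lambda>k. cis (- (\<delta> * h k)))"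
  obtains b where "(b \<longlongrightarrow> sld_weight d p H / 2) (at 0)"
    "\<And>U \<delta>. unitary_mat d U \<Longrightarrow> b \<delta> \<le> (1 - fidelity (conj_diag U (\<lambda>k. complex_of_real (p k)))
        (conj_diag (U * N \<delta>) (\<lambda>k. complex_of_real (p k)))) / \<delta>\<^sup>2"
proof -
  note Rc = unitary_matD[OF R]
  have Hc: "H \<in> carrier_mat d d" unfolding H_def using Rc(1) by simp
  have Hcnj: "cnj (H $$ (i, j)) = H $$ (j, i)" if "i < d" "j < d" for i j
    using hermitian_index[OF _ that] hermitian_conj_diag[OF Rc(1), of h] unfolding H_def by blast
  have N: "unitary_mat d (N \<delta>)" for \<delta> unfolding N_def by (rule unitary_conj_diag[OF R]) simp
  note Nc = unitary_matD(1)[OF N]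
  \<comment> \<open>The symmetric logarithmic derivative; measuring in its eigenbasis
    \<open>Q\<close> makes the classical bound sharp.\<close>
  define L where "L = mat d d (\<lambda>(i, j). - \<i> * complex_of_real ((p j - p i) / (p i + p j)) * H $$ (i, j))"
  have Lc: "L \<in> carrier_mat d d" by (simp add: L_def)
  have "cnj (L $$ (j, i)) = L $$ (i, j)" if "i < d" "j < d" for i j
  proof -
    have "(p i - p j) / (p j + p i) = - ((p j - p i) / (p i + p j))"
      by (metis add.commute minus_diff_eq minus_divide_left)
    then show ?thesis using that by (simp add: L_def Hcnj del: of_real_divide of_real_diff of_real_add)
  qed
  hence "hermitian d L" using Lc unfolding hermitian_def by (auto intro!: eq_matI)
  then obtain Q l where Q: "unitary_mat d Q" and Ld: "L = conj_diag Q (\<lambda>k. complex_of_real (l k))"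
    using hermitian_spectral by blast
  note Qc = unitary_matD[OF Q]
  have LQ: "(\<Sum>j<d. L $$ (i, j) * Q $$ (j, a)) = complex_of_real (l a) * Q $$ (i, a)" if "i < d" "a < d" for i a
  proof -
    have "L * Q = Q * mat_diag d (\<lambda>k. complex_of_real (l k))"
      unfolding Ld conj_diag_def using Qc(1,2)
      by (simp only: carrier_matD square_assoc[of _ d] square_closed[of _ d] adj_carrier mat_diag_dim right_mult_one_mat[of _ d d])
    then have "(L * Q) $$ (i, a) = Q $$ (i, a) * complex_of_real (l a)"
      using that by (simp add: mat_diag_mult_right[OF Qc(1)])
    then show ?thesis unfolding mult_index[OF Lc Qc(1) that] by (simp only: mult.commute)
  qed
  have QL: "(\<Sum>i<d. cnj (Q $$ (i, a)) * L $$ (i, j)) = complex_of_real (l a) * cnj (Q $$ (j, a))" if "j < d" "a < d" for j a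
  proof -
    have "(\<Sum>i<d. cnj (Q $$ (i, a)) * L $$ (i, j)) = cnj (\<Sum>i<d. L $$ (j, i) * Q $$ (i, a))"
      unfolding cnj_sum using hermitian_index[OF \<open>hermitian d L\<close> \<open>j < d\<close>]
      by (intro sum.cong refl) (simp add: mult.commute)
    then show ?thesis unfolding LQ[OF that] by simp
  qed
  define q where "q a = (\<Sum>i<d. p i * (cmod (Q $$ (i, a)))\<^sup>2)" for a
  define r where "r a \<delta> = (\<Sum>j<d. p j * (cmod ((adj Q * N \<delta>) $$ (a, j)))\<^sup>2)" for a \<delta>
  have q0: "0 \<le> q a" if "a < d" for a unfolding q_def using p by (intro sum_nonneg) auto
  have r0: "0 \<le> r a \<delta>" if "a < d" for a \<delta> unfolding r_def using p by (intro sum_nonneg) auto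
  have q1: "(\<Sum>a<d. q a) = 1" unfolding q_def
    by (subst sum.swap) (simp add: sum_distrib_left[symmetric] unitary_row_norm[OF Q] p1)
  have r1: "(\<Sum>a<d. r a \<delta>) = 1" for \<delta> unfolding r_def
    by (subst sum.swap)
       (simp add: sum_distrib_left[symmetric] unitary_col_norm[OF unitary_mat_mult[OF unitary_mat_adj[OF Q] N]] p1
         del: index_mult_mat(1))
  \<comment> \<open>The derivative of the a-th outcome probability: with v the a-th column of
    \<open>Q\<close>, <v| -i[H,rho] |v> = <v| rho L + L rho |v> = 2 l_a <v|rho|v>. Below,
    \<open>w\<close> is one half of the commutator and \<open>cnj w\<close> the other.\<close>
  have key: "(\<Sum>j<d. p j * (2 * Re (Q $$ (j, a) * (- \<i> * (\<Sum>i<d. cnj (Q $$ (i, a)) * H $$ (i, j)))))) = 2 * l a * q a"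
    if a: "a < d" for a
  proof -
    define w where "w = (\<Sum>j<d. \<Sum>i<d. p j * (Q $$ (j, a) * (cnj (Q $$ (i, a)) * H $$ (i, j))))"
    have "(\<Sum>j<d. p j * (2 * Re (Q $$ (j, a) * (- \<i> * (\<Sum>i<d. cnj (Q $$ (i, a)) * H $$ (i, j))))))
        = 2 * Re (- \<i> * w)"
      unfolding w_def sum_distrib_left Re_sum
      by (intro sum.cong refl) (simp add: algebra_simps)
    also have "complex_of_real (2 * Re (- \<i> * w)) = - \<i> * (w - cnj w)"
      by (simp add: complex_eq_iff)
    also have "cnj w = (\<Sum>j<d. \<Sum>i<d. p i * (Q $$ (j, a) * (cnj (Q $$ (i, a)) * H $$ (i, j))))"
      unfolding w_def cnj_sum by (subst sum.swap, intro sum.cong refl) (simp add: Hcnj mult_ac)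
    also have "- \<i> * (w - (\<Sum>j<d. \<Sum>i<d. p i * (Q $$ (j, a) * (cnj (Q $$ (i, a)) * H $$ (i, j)))))
        = (\<Sum>j<d. \<Sum>i<d. Q $$ (j, a) * cnj (Q $$ (i, a)) * (- \<i> * complex_of_real (p j - p i) * H $$ (i, j)))"
      unfolding w_def sum_subtractf[symmetric] sum_distrib_left
      by (intro sum.cong refl) (simp add: algebra_simps)
    also have "\<dots> = (\<Sum>j<d. \<Sum>i<d. Q $$ (j, a) * cnj (Q $$ (i, a)) * (complex_of_real (p i + p j) * L $$ (i, j)))"
    proof (intro sum.cong refl)
      fix i j assume "i \<in> {..<d}" "j \<in> {..<d}"
      hence ij: "i < d" "j < d" by auto
      \<comment> \<open>If the denominator is 0, nonnegativity makes both eigenvalues 0 and the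
        numerator vanishes too.\<close>
      have "(p i + p j) * ((p j - p i) / (p i + p j)) = p j - p i"
        using p[OF ij(1)] p[OF ij(2)] by (cases "p i + p j = 0") auto
      then have "complex_of_real (p i + p j) * complex_of_real ((p j - p i) / (p i + p j)) = complex_of_real (p j - p i)"
        by (simp only: of_real_mult[symmetric])
      then have "- \<i> * complex_of_real (p j - p i) * H $$ (i, j) = complex_of_real (p i + p j) * L $$ (i, j)"
        using ij by (simp add: L_def mult_ac del: of_real_add of_real_diff of_real_divide)
      then show "Q $$ (j, a) * cnj (Q $$ (i, a)) * (- \<i> * complex_of_real (p j - p i) * H $$ (i, j))
        = Q $$ (j, a) * cnj (Q $$ (i, a)) * (complex_of_real (p i + p j) * L $$ (i, j))" by simp
    qed
    also have "\<dots> = (\<Sum>j<d. \<Sum>i<d. p i * cnj (Q $$ (i, a)) * (L $$ (i, j) * Q $$ (j, a)))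
        + (\<Sum>j<d. \<Sum>i<d. p j * Q $$ (j, a) * (cnj (Q $$ (i, a)) * L $$ (i, j)))"
      unfolding sum.distrib[symmetric] by (intro sum.cong refl) (simp add: algebra_simps)
    also have "(\<Sum>j<d. \<Sum>i<d. p i * cnj (Q $$ (i, a)) * (L $$ (i, j) * Q $$ (j, a)))
        = (\<Sum>i<d. p i * cnj (Q $$ (i, a)) * (complex_of_real (l a) * Q $$ (i, a)))"
      by (subst sum.swap, unfold sum_distrib_left[symmetric], intro sum.cong refl) (simp add: LQ a)
    also have "\<dots> = complex_of_real (l a * q a)"
      unfolding q_def sum_distrib_left of_real_sum
      by (intro sum.cong refl) (simp only: of_real_mult complex_norm_square mult_ac)
    also have "(\<Sum>j<d. \<Sum>i<d. p j * Q $$ (j, a) * (cnj (Q $$ (i, a)) * L $$ (i, j)))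
        = (\<Sum>j<d. p j * Q $$ (j, a) * (complex_of_real (l a) * cnj (Q $$ (j, a))))"
      by (unfold sum_distrib_left[symmetric], intro sum.cong refl) (simp add: QL a)
    also have "\<dots> = complex_of_real (l a * q a)"
      unfolding q_def sum_distrib_left of_real_sum
      by (intro sum.cong refl) (simp only: of_real_mult complex_norm_square mult_ac)
    also have "complex_of_real (l a * q a) + complex_of_real (l a * q a) = complex_of_real (2 * l a * q a)" by simp
    finally show ?thesis by (simp only: of_real_eq_iff)
  qed
  have rlim: "((\<lambda>\<delta>. (r a \<delta> - q a) / \<delta>) \<longlongrightarrow> 2 * l a * q a) (at 0)" if a: "a < d" for a
  proof -
    define y where "y j \<delta> = (adj Q * N \<delta>) $$ (a, j)" for j \<delta>
    have ydef: "y j \<delta> = (\<Sum>i<d. cnj (Q $$ (i, a)) * N \<delta> $$ (i, j))" if "j < d" for j \<delta>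
      unfolding y_def mult_index[OF adj_carrier[OF Qc(1)] Nc a that]
      using Qc(1) a by (intro sum.cong refl) simp
    define u where "u j \<delta> = (y j \<delta> - cnj (Q $$ (j, a))) / complex_of_real \<delta>" for j \<delta>
    define y' where "y' j = - \<i> * (\<Sum>i<d. cnj (Q $$ (i, a)) * H $$ (i, j))" for j
    have ulim: "(u j \<longlongrightarrow> y' j) (at 0)" if j: "j < d" for j
    proof -
      have "((\<lambda>\<delta>. \<Sum>i<d. cnj (Q $$ (i, a)) * ((N \<delta> $$ (i, j) - (if i = j then 1 else 0)) / complex_of_real \<delta>))
        \<longlongrightarrow> (\<Sum>i<d. cnj (Q $$ (i, a)) * (- \<i> * H $$ (i, j)))) (at 0)"
        unfolding N_def H_def using j
        by (intro tendsto_sum tendsto_mult tendsto_const propagator_difference_quotient[OF R]) auto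
      also have "(\<lambda>\<delta>. \<Sum>i<d. cnj (Q $$ (i, a)) * ((N \<delta> $$ (i, j) - (if i = j then 1 else 0)) / complex_of_real \<delta>)) = u j"
      proof
        fix \<delta>
        have "cnj (Q $$ (j, a)) = (\<Sum>i<d. cnj (Q $$ (i, a)) * (if i = j then 1 else 0))"
          using j by (simp add: if_distrib[of "\<lambda>x. _ * x"] cong: if_cong)
        then show "(\<Sum>i<d. cnj (Q $$ (i, a)) * ((N \<delta> $$ (i, j) - (if i = j then 1 else 0)) / complex_of_real \<delta>)) = u j \<delta>"
          unfolding u_def ydef[OF j]
          by (simp only: times_divide_eq_right sum_divide_distrib[symmetric] right_diff_distrib sum_subtractf)
      qed
      also have "(\<Sum>i<d. cnj (Q $$ (i, a)) * (- \<i> * H $$ (i, j))) = y' j"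
        unfolding y'_def sum_distrib_left by (intro sum.cong refl) simp
      finally show ?thesis .
    qed
    \<comment> \<open>With y = \<open>cnj\<close> Q + \<delta> u, the modulus expands exactly as
      |y|^2 = |Q|^2 + 2 \<delta> Re(Q u) + \<delta>^2 |u|^2, so the difference quotient of
      \<open>r\<close> carries no remainder to estimate.\<close>
    have "((\<lambda>\<delta>. \<Sum>j<d. p j * (2 * Re (Q $$ (j, a) * u j \<delta>) + (cmod (u j \<delta>))\<^sup>2 * \<delta>))
      \<longlongrightarrow> (\<Sum>j<d. p j * (2 * Re (Q $$ (j, a) * y' j) + (cmod (y' j))\<^sup>2 * 0))) (at 0)"
      by (intro tendsto_sum tendsto_mult tendsto_add tendsto_const tendsto_Re tendsto_power tendsto_norm
          tendsto_ident_at ulim) auto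
    also have "(\<Sum>j<d. p j * (2 * Re (Q $$ (j, a) * y' j) + (cmod (y' j))\<^sup>2 * 0)) = 2 * l a * q a"
      using key[OF a] unfolding y'_def by simp
    finally show ?thesis
    proof (rule Lim_transform_eventually)
      have "(\<Sum>j<d. p j * (2 * Re (Q $$ (j, a) * u j \<delta>) + (cmod (u j \<delta>))\<^sup>2 * \<delta>)) = (r a \<delta> - q a) / \<delta>"
        if "\<delta> \<noteq> 0" for \<delta>
      proof -
        have e: "2 * Re (Q $$ (j, a) * u j \<delta>) + (cmod (u j \<delta>))\<^sup>2 * \<delta>
          = ((cmod (y j \<delta>))\<^sup>2 - (cmod (Q $$ (j, a)))\<^sup>2) / \<delta>" for j
        proof -
          have y: "y j \<delta> = cnj (Q $$ (j, a)) + complex_of_real \<delta> * u j \<delta>"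
            using that by (simp add: u_def)
          have "(cmod (y j \<delta>))\<^sup>2 - (cmod (Q $$ (j, a)))\<^sup>2
            = (2 * Re (Q $$ (j, a) * u j \<delta>) + (cmod (u j \<delta>))\<^sup>2 * \<delta>) * \<delta>"
            unfolding y cmod_power2 by (simp add: power2_eq_square algebra_simps)
          then show ?thesis using that by simp
        qed
        show ?thesis
          unfolding e r_def q_def y_def[symmetric] sum_subtractf[symmetric] sum_divide_distrib
          by (simp only: right_diff_distrib times_divide_eq_right)
      qed
      then show "\<forall>\<^sub>F \<delta> in at 0. (\<Sum>j<d. p j * (2 * Re (Q $$ (j, a) * u j \<delta>) + (cmod (u j \<delta>))\<^sup>2 * \<delta>)) = (r a \<delta> - q a) / \<delta>"
        by (auto simp: eventually_at_filter)
    qed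
  qed
  \<comment> \<open>Outcomes with \<open>q a = 0\<close> are dropped, since the square root is not
    differentiable at 0. This only lowers \<open>b\<close>, and their share
    \<open>(l a)\<^sup>2 * q a\<close> of the limit is 0.\<close>
  define b where "b \<delta> = (\<Sum>a<d. if q a = 0 then 0 else ((sqrt (r a \<delta>) - sqrt (q a)) / \<delta>)\<^sup>2) / 2" for \<delta>
  have tlim: "((\<lambda>\<delta>. if q a = 0 then 0 else ((sqrt (r a \<delta>) - sqrt (q a)) / \<delta>)\<^sup>2) \<longlongrightarrow> (l a)\<^sup>2 * q a) (at 0)"
    if a: "a < d" for a
  proof (cases "q a = 0")
    case False
    hence qa: "q a > 0" using q0[OF a] by simp
    have "((\<lambda>\<delta>. (r a \<delta> - q a) / \<delta> * \<delta> + q a) \<longlongrightarrow> 2 * l a * q a * 0 + q a) (at 0)"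
      by (intro tendsto_add tendsto_mult tendsto_const tendsto_ident_at rlim[OF a])
    hence "((\<lambda>\<delta>. (r a \<delta> - q a) / \<delta> * \<delta> + q a) \<longlongrightarrow> q a) (at 0)" by (simp only: mult_zero_right add_0)
    hence rq: "(r a \<longlongrightarrow> q a) (at 0)"
      by (rule Lim_transform_eventually) (auto simp: eventually_at_filter)
    have "((\<lambda>\<delta>. ((r a \<delta> - q a) / \<delta> / (sqrt (r a \<delta>) + sqrt (q a)))\<^sup>2)
      \<longlongrightarrow> (2 * l a * q a / (sqrt (q a) + sqrt (q a)))\<^sup>2) (at 0)"
      using qa by (intro tendsto_power tendsto_divide tendsto_add tendsto_const tendsto_real_sqrt rlim[OF a] rq) auto
    also have "(2 * l a * q a / (sqrt (q a) + sqrt (q a)))\<^sup>2 = (l a)\<^sup>2 * q a"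
      using qa by (simp add: power_divide power_mult_distrib power2_eq_square field_simps)
    also have "(\<lambda>\<delta>. ((r a \<delta> - q a) / \<delta> / (sqrt (r a \<delta>) + sqrt (q a)))\<^sup>2)
      = (\<lambda>\<delta>. if q a = 0 then 0 else ((sqrt (r a \<delta>) - sqrt (q a)) / \<delta>)\<^sup>2)"
    proof
      fix \<delta>
      have e: "(sqrt (r a \<delta>) - sqrt (q a)) * (sqrt (r a \<delta>) + sqrt (q a)) = r a \<delta> - q a"
        using r0[OF a, of \<delta>] qa by (simp add: algebra_simps)
      have "sqrt (r a \<delta>) + sqrt (q a) \<noteq> 0"
        using real_sqrt_ge_zero[OF r0[OF a, of \<delta>]] real_sqrt_gt_zero[OF qa] by linarith
      then show "((r a \<delta> - q a) / \<delta> / (sqrt (r a \<delta>) + sqrt (q a)))\<^sup>2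
        = (if q a = 0 then 0 else ((sqrt (r a \<delta>) - sqrt (q a)) / \<delta>)\<^sup>2)"
        unfolding e[symmetric] using False by simp
    qed
    finally show ?thesis .
  qed simp
  \<comment> \<open>The number tr(rho L^2), evaluated first in the eigenbasis of \<open>L\<close>
    and then in that of the state.\<close>
  have lq: "(\<Sum>a<d. (l a)\<^sup>2 * q a) = sld_weight d p H"
  proof -
    have "(\<Sum>a<d. (l a)\<^sup>2 * q a) = (\<Sum>i<d. p i * (\<Sum>a<d. (cmod ((Q * mat_diag d (\<lambda>k. complex_of_real (l k))) $$ (i, a)))\<^sup>2))"
    proof -
      have "(l a)\<^sup>2 * (p i * (cmod (Q $$ (i, a)))\<^sup>2)
        = p i * (cmod ((Q * mat_diag d (\<lambda>k. complex_of_real (l k))) $$ (i, a)))\<^sup>2"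
        if "i \<in> {..<d}" "a \<in> {..<d}" for i a
        unfolding mat_diag_mult_right[OF Qc(1)] using that by (simp add: norm_mult power_mult_distrib)
      then show ?thesis unfolding q_def sum_distrib_left
        by (subst sum.swap) (intro sum.cong refl, assumption)
    qed
    also have "\<dots> = (\<Sum>i<d. p i * (\<Sum>j<d. (cmod (L $$ (i, j)))\<^sup>2))"
    proof -
      have "(\<Sum>a<d. (cmod ((Q * mat_diag d (\<lambda>k. complex_of_real (l k))) $$ (i, a)))\<^sup>2) = (\<Sum>j<d. (cmod (L $$ (i, j)))\<^sup>2)"
        if "i < d" for i
        using row_norm_unitary[OF unitary_mat_adj[OF Q] square_closed[OF Qc(1) mat_diag_dim] that, of "\<lambda>k. complex_of_real (l k)"] Qc(1)
        unfolding Ld conj_diag_def by simp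
      then show ?thesis by (intro sum.cong refl) simp
    qed
    also have "\<dots> = sld_weight d p H"
    proof -
      have "(cmod (L $$ (i, j)))\<^sup>2 = ((p i - p j) / (p i + p j))\<^sup>2 * (cmod (H $$ (i, j)))\<^sup>2"
        if "i < d" "j < d" for i j
      proof -
        have "L $$ (i, j) = \<i> * complex_of_real ((p i - p j) / (p i + p j)) * H $$ (i, j)"
          using that by (simp add: L_def minus_divide_left[symmetric] diff_divide_distrib algebra_simps)
        then show ?thesis
          by (simp only: norm_mult norm_of_real power_mult_distrib power2_abs) simp
      qed
      then show ?thesis unfolding sld_weight_def sum_distrib_left
        by (intro sum.cong refl) simp
    qed
    finally show ?thesis .
  qed
  have "(b \<longlongrightarrow> sld_weight d p H / 2) (at 0)"
    unfolding b_def lq[symmetric] by (intro tendsto_divide tendsto_sum tlim tendsto_const) auto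
  moreover have "b \<delta> \<le> (1 - fidelity (conj_diag U (\<lambda>k. complex_of_real (p k)))
        (conj_diag (U * N \<delta>) (\<lambda>k. complex_of_real (p k)))) / \<delta>\<^sup>2" if U: "unitary_mat d U" for U \<delta>
  proof -
    have "fidelity (conj_diag U (\<lambda>k. complex_of_real (p k))) (conj_diag (U * N \<delta>) (\<lambda>k. complex_of_real (p k)))
      \<le> (\<Sum>a<d. sqrt (q a) * sqrt (r a \<delta>))"
      unfolding q_def r_def by (rule fidelity_le_measurement[OF U N Q p])
    moreover have "(\<Sum>a<d. (sqrt (r a \<delta>) - sqrt (q a))\<^sup>2) = 2 - 2 * (\<Sum>a<d. sqrt (q a) * sqrt (r a \<delta>))"
    proof -
      have "(\<Sum>a<d. (sqrt (r a \<delta>) - sqrt (q a))\<^sup>2) = (\<Sum>a<d. r a \<delta> + q a - 2 * (sqrt (q a) * sqrt (r a \<delta>)))"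
        using r0 q0 by (intro sum.cong refl) (simp add: power2_diff)
      then show ?thesis by (simp add: sum_subtractf sum.distrib q1 r1 sum_distrib_left)
    qed
    moreover have "b \<delta> \<le> (\<Sum>a<d. (sqrt (r a \<delta>) - sqrt (q a))\<^sup>2) / 2 / \<delta>\<^sup>2"
    proof -
      have "(\<Sum>a<d. if q a = 0 then 0 else ((sqrt (r a \<delta>) - sqrt (q a)) / \<delta>)\<^sup>2)
        \<le> (\<Sum>a<d. (sqrt (r a \<delta>) - sqrt (q a))\<^sup>2 / \<delta>\<^sup>2)"
        by (intro sum_mono) (simp add: power_divide)
      then show ?thesis unfolding b_def by (simp add: sum_divide_distrib[symmetric])
    qed
    ultimately have "b \<delta> \<le> (2 - 2 * (\<Sum>a<d. sqrt (q a) * sqrt (r a \<delta>))) / 2 / \<delta>\<^sup>2"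
      and "(2 - 2 * (\<Sum>a<d. sqrt (q a) * sqrt (r a \<delta>))) / 2 \<le> 1 - fidelity (conj_diag U (\<lambda>k. complex_of_real (p k))) (conj_diag (U * N \<delta>) (\<lambda>k. complex_of_real (p k)))"
      by simp_all
    from order_trans[OF this(1) divide_right_mono[OF this(2)]] show ?thesis by simp
  qed
  ultimately show thesis by (rule that)
qed

text \<open>All factors except \<open>p i\<close> are symmetric in i and j, so \<open>p i\<close>
  may be averaged to (p_i + p_j)/2, which cancels one power of the denominator.\<close>

lemma sld_weight_eq:
  assumes p: "\<And>k. k < d \<Longrightarrow> 0 \<le> p k" and H: "hermitian d H"
  shows "2 * sld_weight d p H = (\<Sum>i<d. \<Sum>j<d. (p i - p j)\<^sup>2 / (p i + p j) * (cmod (H $$ (i, j)))\<^sup>2)"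
proof -
  have c: "(cmod (H $$ (j, i)))\<^sup>2 = (cmod (H $$ (i, j)))\<^sup>2" if "i < d" "j < d" for i j
    using hermitian_index[OF H that] by (metis complex_mod_cnj)
  define X where "X i j = ((p i - p j) / (p i + p j))\<^sup>2 * (cmod (H $$ (i, j)))\<^sup>2" for i j
  have Xc: "X j i = X i j" if "i < d" "j < d" for i j
    unfolding X_def by (simp add: c[OF that] power_divide power2_commute[of "p j" "p i"] add.commute)
  have 1: "sld_weight d p H = (\<Sum>i<d. \<Sum>j<d. p i * X i j)"
    by (simp add: sld_weight_def X_def mult.assoc)
  have "(\<Sum>i<d. \<Sum>j<d. p j * X i j) = (\<Sum>i<d. \<Sum>j<d. p i * X j i)"
    by (rule sum.swap)
  also have "\<dots> = (\<Sum>i<d. \<Sum>j<d. p i * X i j)"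
    by (intro sum.cong refl) (simp add: Xc)
  finally have "2 * sld_weight d p H = (\<Sum>i<d. \<Sum>j<d. (p i + p j) * X i j)"
    using 1 by (simp add: distrib_right sum.distrib)
  also have "\<dots> = (\<Sum>i<d. \<Sum>j<d. (p i - p j)\<^sup>2 / (p i + p j) * (cmod (H $$ (i, j)))\<^sup>2)"
    by (intro sum.cong refl) (simp add: X_def power_divide power2_eq_square)
  finally show ?thesis .
qed

text \<open>The quotient is squeezed between \<open>b\<close> and the constant
  \<open>sld_weight d p H / 2\<close>; the prefactor 8 then gives four times
  \<open>sld_weight\<close>, the double of its symmetric form.\<close>

lemma QFI_eq:
  assumes K: "unitary_mat d K" and V: "unitary_mat d V"
    and p: "\<And>k. k < d \<Longrightarrow> 0 \<le> p k" and p1: "(\<Sum>k<d. p k) = 1"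
  shows "QFI (conj_diag K (\<lambda>k. complex_of_real (h k))) (conj_diag V (\<lambda>k. complex_of_real (p k))) \<theta>
    = 2 * (\<Sum>i<d. \<Sum>j<d. (p i - p j)\<^sup>2 / (p i + p j) * (cmod (conj_diag (adj V * K) (\<lambda>k. complex_of_real (h k)) $$ (i, j)))\<^sup>2)"
proof -
  define R where "R = adj V * K"
  have R: "unitary_mat d R" unfolding R_def by (rule unitary_mat_mult[OF unitary_mat_adj[OF V] K])
  define N where "N \<delta> = conj_diag R (\<lambda>k. cis (- (\<delta> * h k)))" for \<delta>
  define H where "H = conj_diag R (\<lambda>k. complex_of_real (h k))"
  have H: "hermitian d H" unfolding H_def by (rule hermitian_conj_diag[OF unitary_matD(1)[OF R]])
  define U where "U = conj_diag K (\<lambda>k. cis (- (\<theta> * h k))) * V"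
  have U: "unitary_mat d U" unfolding U_def by (rule unitary_mat_mult[OF unitary_conj_diag[OF K] V]) simp
  define F where "F \<delta> = fidelity (conj_diag U (\<lambda>k. complex_of_real (p k))) (conj_diag (U * N \<delta>) (\<lambda>k. complex_of_real (p k)))" for \<delta>
  obtain b where b1: "(b \<longlongrightarrow> sld_weight d p H / 2) (at 0)"
    and b2: "\<And>U \<delta>. unitary_mat d U \<Longrightarrow> b \<delta> \<le> (1 - fidelity (conj_diag U (\<lambda>k. complex_of_real (p k)))
        (conj_diag (U * N \<delta>) (\<lambda>k. complex_of_real (p k)))) / \<delta>\<^sup>2"
    unfolding N_def H_def
  proof (rule one_minus_fidelity_ge_tendsto[where p = p and h = h, OF R p p1], goal_cases)
    case (2 b)
    show ?case by (rule 2(1)[OF 2(2) 2(3)])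
  qed
  have "((\<lambda>\<delta>. (1 - F \<delta>) / \<delta>\<^sup>2) \<longlongrightarrow> sld_weight d p H / 2) (at 0)"
  proof (rule tendsto_sandwich[OF _ _ b1 tendsto_const])
    show "\<forall>\<^sub>F \<delta> in at 0. b \<delta> \<le> (1 - F \<delta>) / \<delta>\<^sup>2" 
      unfolding F_def by (intro always_eventually allI b2 U)
    have "(1 - F \<delta>) / \<delta>\<^sup>2 \<le> sld_weight d p H / 2" if "\<delta> \<noteq> 0" for \<delta>
      using one_minus_fidelity_le[where p = p and h = h and \<delta> = \<delta>, OF U R p p1] that
      unfolding F_def N_def H_def by (simp add: divide_le_eq mult.commute)
    then show "\<forall>\<^sub>F \<delta> in at 0. (1 - F \<delta>) / \<delta>\<^sup>2 \<le> sld_weight d p H / 2"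
      by (auto simp: eventually_at_filter)
  qed
  hence "Lim (at 0) (\<lambda>\<delta>. (1 - F \<delta>) / \<delta>\<^sup>2) = sld_weight d p H / 2"
    by (intro tendsto_Lim) auto
  then have "QFI (conj_diag K (\<lambda>k. complex_of_real (h k))) (conj_diag V (\<lambda>k. complex_of_real (p k))) \<theta>
    = 2 * (2 * sld_weight d p H)"
    unfolding QFI_def evolve_conj_diag[OF K unitary_matD(1)[OF V]] evolve_shift[OF K V]
      R_def[symmetric] N_def[symmetric] U_def[symmetric] F_def[symmetric]
    by simp
  moreover have e: "2 * sld_weight d p H = (\<Sum>i<d. \<Sum>j<d. (p i - p j)\<^sup>2 / (p i + p j) * (cmod (H $$ (i, j)))\<^sup>2)"
    by (rule sld_weight_eq[OF p H])
  ultimately show ?thesis unfolding e unfolding H_def R_def by simp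
qed

section \<open>The optimal state preparation\<close>

text \<open>Adapts \<open>weighted_offdiag_le\<close> to a symmetric weight: |H_ij|^2 is symmetric,
  so the full sum is twice that over the upper triangle. The second conclusion lets the value at a
  candidate be read off in the same form.\<close>

lemma conj_diag_offdiag_le:
  fixes f :: "nat \<Rightarrow> nat \<Rightarrow> real" and h :: "nat \<Rightarrow> real"
  assumes R: "unitary_mat d R"
    and sym: "\<And>i j. f i j = f j i" and diag: "\<And>i. f i i = 0" and nonneg: "\<And>i. Suc i < d \<Longrightarrow> 0 \<le> f i (Suc i)"
    and monge: "\<And>k l. k < l \<Longrightarrow> Suc l < d \<Longrightarrow> f k l + f (Suc k) (Suc l) \<le> f k (Suc l) + f (Suc k) l"
    and h: "\<And>i j. i \<le> j \<Longrightarrow> j < d \<Longrightarrow> h j \<le> h i"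
  shows "(\<Sum>i<d. \<Sum>j<d. f i j * (cmod (conj_diag R (\<lambda>k. complex_of_real (h k)) $$ (i, j)))\<^sup>2)
    \<le> 2 * (\<Sum>i<d. (if i < d - 1 - i then f i (d - 1 - i) else 0) * ((h i - h (d - 1 - i))\<^sup>2 / 4))"
    and "(\<Sum>i<d. \<Sum>j<d. f i j * (cmod (conj_diag R (\<lambda>k. complex_of_real (h k)) $$ (i, j)))\<^sup>2) = 2 * (\<Sum>i<d. \<Sum>j<d. (if i < j then f i j else 0) * (cmod (conj_diag R (\<lambda>k. complex_of_real (h k)) $$ (i, j)))\<^sup>2)"
proof -
  note Rc = unitary_matD(1)[OF R]
  define H where "H = conj_diag R (\<lambda>k. complex_of_real (h k))"
  have H: "hermitian d H" unfolding H_def by (rule hermitian_conj_diag[OF Rc])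
  define w where "w i j = (if i < j then f i j else 0)" for i j
  have f: "f i j = w i j + w j i" for i j
    by (cases i j rule: linorder_cases) (auto simp: w_def diag sym)
  have c: "(cmod (H $$ (i, j)))\<^sup>2 = (cmod (H $$ (j, i)))\<^sup>2" if "i < d" "j < d" for i j
    using hermitian_index[OF H that] by (metis complex_mod_cnj)
  have "(\<Sum>i<d. \<Sum>j<d. w j i * (cmod (H $$ (i, j)))\<^sup>2) = (\<Sum>i<d. \<Sum>j<d. w j i * (cmod (H $$ (j, i)))\<^sup>2)"
    by (intro sum.cong refl) (simp add: c)
  also have "\<dots> = (\<Sum>i<d. \<Sum>j<d. w i j * (cmod (H $$ (i, j)))\<^sup>2)" by (rule sum.swap)
  finally have L: "(\<Sum>i<d. \<Sum>j<d. f i j * (cmod (H $$ (i, j)))\<^sup>2) = 2 * (\<Sum>i<d. \<Sum>j<d. w i j * (cmod (H $$ (i, j)))\<^sup>2)"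
    by (simp add: f distrib_right sum.distrib)
  then show "(\<Sum>i<d. \<Sum>j<d. f i j * (cmod (conj_diag R (\<lambda>k. complex_of_real (h k)) $$ (i, j)))\<^sup>2) = 2 * (\<Sum>i<d. \<Sum>j<d. (if i < j then f i j else 0) * (cmod (conj_diag R (\<lambda>k. complex_of_real (h k)) $$ (i, j)))\<^sup>2)"
    unfolding H_def w_def .
  \<comment> \<open>Conjugate transpose of \<open>R\<close>: then \<open>m\<close> runs over the
    eigenbasis of the Hamiltonian and \<open>i\<close> over that of the state.\<close>
  define G where "G m i = cnj (R $$ (i, m))" for m i
  have "orthonormal_cols d G"
    unfolding orthonormal_cols_def G_def
    using unitary_rows[OF R] by (auto simp: mult.commute)
  moreover have "orthonormal_cols d (\<lambda>i m. G m i)"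
    unfolding orthonormal_cols_def G_def using unitary_cols[OF R] by auto
  ultimately have "(\<Sum>i<d. \<Sum>j<d. w i j * (cmod (\<Sum>m<d. h m * cnj (G m i) * G m j))\<^sup>2)
    \<le> (\<Sum>i<d. w i (d - 1 - i) * ((h i - h (d - 1 - i))\<^sup>2 / 4))"
  proof (rule weighted_offdiag_le[OF _ _ _ _ h])
    show "w i j = 0" if "j \<le> i" for i j using that by (simp add: w_def)
    show "w k l + w (Suc k) (Suc l) \<le> w k (Suc l) + w (Suc k) l" if "k \<le> l" "Suc l < d" for k l
    proof (cases "k = l")
      \<comment> \<open>On the diagonal, cutting off the lower triangle reduces the Monge inequality
        to \<open>0 \<le> f l (Suc l)\<close>.\<close>
      case True
      then show ?thesis using nonneg[of l] that by (simp add: w_def)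
    next
      case False
      hence kl: "k < l" using that by simp
      have "w (Suc k) l = f (Suc k) l"
        using kl diag by (cases "Suc k = l") (auto simp: w_def)
      then show ?thesis using monge[OF kl that(2)] kl by (simp add: w_def)
    qed
  qed
  also have "(\<Sum>i<d. \<Sum>j<d. w i j * (cmod (\<Sum>m<d. h m * cnj (G m i) * G m j))\<^sup>2)
      = (\<Sum>i<d. \<Sum>j<d. w i j * (cmod (H $$ (i, j)))\<^sup>2)"
    unfolding H_def G_def by (intro sum.cong refl) (simp add: conj_diag_index[OF Rc] mult_ac)
  finally show "(\<Sum>i<d. \<Sum>j<d. f i j * (cmod (conj_diag R (\<lambda>k. complex_of_real (h k)) $$ (i, j)))\<^sup>2) \<le> 2 * (\<Sum>i<d. (if i < d - 1 - i then f i (d - 1 - i) else 0) * ((h i - h (d - 1 - i))\<^sup>2 / 4))"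
    using L unfolding H_def w_def by linarith
qed

text \<open>The columns are \<open>(e\<^sub>i \<plusminus> e\<^bsub>d-1-i\<^esub>) / sqrt 2\<close>, and the middle basis vector if \<open>d\<close> is odd.\<close>

definition pairing_mat :: "nat \<Rightarrow> complex mat" where
  "pairing_mat d = mat d d (\<lambda>(i, j). complex_of_real
     ((if j = i then (if i < d - 1 - i then 1 / sqrt 2 else if d - 1 - i < i then - 1 / sqrt 2 else 1) else 0)
      + (if j = d - 1 - i then (if i = d - 1 - i then 0 else 1 / sqrt 2) else 0)))"

text \<open>A row has at most two nonzero entries, at i and d-1-i. In the middle row of odd
  \<open>d\<close> these positions coincide, and the second coefficient is set to 0 to avoid
  counting twice.\<close>

lemma pairing_mat_sum:
  assumes "i < d"
  shows "(\<Sum>j<d. pairing_mat d $$ (i, j) * x j)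
    = complex_of_real (if i < d - 1 - i then 1 / sqrt 2 else if d - 1 - i < i then - 1 / sqrt 2 else 1) * x i
      + complex_of_real (if i = d - 1 - i then 0 else 1 / sqrt 2) * x (d - 1 - i)"
proof -
  define \<alpha> where "\<alpha> = complex_of_real (if i < d - 1 - i then 1 / sqrt 2 else if d - 1 - i < i then - 1 / sqrt 2 else 1)"
  define \<beta> where "\<beta> = complex_of_real (if i = d - 1 - i then 0 else 1 / sqrt 2)"
  have "(\<Sum>j<d. pairing_mat d $$ (i, j) * x j)
    = (\<Sum>j<d. (if j = i then \<alpha> * x j else 0) + (if j = d - 1 - i then \<beta> * x j else 0))"
  proof (intro sum.cong refl)
    fix j assume "j \<in> {..<d}"
    then have "pairing_mat d $$ (i, j) = (if j = i then \<alpha> else 0) + (if j = d - 1 - i then \<beta> else 0)"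
      using assms unfolding pairing_mat_def \<alpha>_def \<beta>_def by simp
    then show "pairing_mat d $$ (i, j) * x j = (if j = i then \<alpha> * x j else 0) + (if j = d - 1 - i then \<beta> * x j else 0)"
      by (simp add: distrib_right)
  qed
  also have "\<dots> = \<alpha> * x i + \<beta> * x (d - 1 - i)"
    using assms by (simp add: sum.distrib)
  finally show ?thesis unfolding \<alpha>_def \<beta>_def .
qed

lemma sqrt2_inverse_sq: "complex_of_real (1 / sqrt 2) * complex_of_real (1 / sqrt 2) = 1 / 2"
  by (simp flip: of_real_mult)

text \<open>Up to reordering, a direct sum of 2 x 2 Hadamard blocks on {i, d-1-i}, hence real
  symmetric and its own inverse.\<close>

lemma pairing_mat_unitary: "unitary_mat d (pairing_mat d)" and adj_pairing_mat: "adj (pairing_mat d) = pairing_mat d"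
proof -
  have Tc: "pairing_mat d \<in> carrier_mat d d" by (simp add: pairing_mat_def)
  show a: "adj (pairing_mat d) = pairing_mat d"
    by (rule eq_matI) (auto simp: pairing_mat_def)
  have "pairing_mat d * pairing_mat d = 1\<^sub>m d"
  proof (rule eq_matI)
    fix i j assume "i < dim_row (1\<^sub>m d)" "j < dim_col (1\<^sub>m d)"
    hence ij: "i < d" "j < d" by auto
    have "(pairing_mat d * pairing_mat d) $$ (i, j) = (\<Sum>k<d. pairing_mat d $$ (i, k) * pairing_mat d $$ (k, j))"
      by (rule mult_index[OF Tc Tc ij])
    also have "\<dots> = 1\<^sub>m d $$ (i, j)"
      unfolding pairing_mat_sum[OF ij(1)]
      using ij sqrt2_inverse_sq
      by (cases i "d - 1 - i" rule: linorder_cases) (auto simp: pairing_mat_def)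
    finally show "(pairing_mat d * pairing_mat d) $$ (i, j) = 1\<^sub>m d $$ (i, j)" .
  qed (use Tc in auto)
  then show "unitary_mat d (pairing_mat d)" using Tc a by (simp add: unitary_mat_def)
qed

text \<open>Conjugating diag(a, b) by a Hadamard block gives the off-diagonal entry (a-b)/2; its
  square is the (h_i - h_{d-1-i})^2 / 4 of the upper bound.\<close>

lemma conj_diag_pairing_mat:
  assumes "i < d - 1 - i"
  shows "conj_diag (pairing_mat d) (\<lambda>k. complex_of_real (h k)) $$ (i, d - 1 - i)
    = complex_of_real ((h i - h (d - 1 - i)) / 2)"
proof -
  have Tc: "pairing_mat d \<in> carrier_mat d d" by (simp add: pairing_mat_def)
  have ij: "i < d" "d - 1 - i < d" using assms by auto
  have "conj_diag (pairing_mat d) (\<lambda>k. complex_of_real (h k)) $$ (i, d - 1 - i)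
    = (\<Sum>k<d. pairing_mat d $$ (i, k) * (complex_of_real (h k) * cnj (pairing_mat d $$ (d - 1 - i, k))))"
    unfolding conj_diag_index[OF Tc ij] by (simp only: mult.assoc)
  also have "\<dots> = complex_of_real (1 / sqrt 2) * complex_of_real (1 / sqrt 2) * complex_of_real (h i)
      - complex_of_real (1 / sqrt 2) * complex_of_real (1 / sqrt 2) * complex_of_real (h (d - 1 - i))"
    unfolding pairing_mat_sum[OF ij(1)] using assms ij by (simp add: pairing_mat_def)
  also have "\<dots> = complex_of_real ((h i - h (d - 1 - i)) / 2)"
    unfolding sqrt2_inverse_sq by (simp add: diff_divide_distrib)
  finally show ?thesis .
qed

text \<open>The upper bound equals the antidiagonal part of the value at
  \<open>pairing_mat d\<close>. The other entries contribute nonnegative terms, so comparing row by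
  row with a single summand suffices.\<close>

lemma conj_diag_pairing_mat_max:
  fixes f :: "nat \<Rightarrow> nat \<Rightarrow> real" and h :: "nat \<Rightarrow> real"
  assumes R: "unitary_mat d R"
    and sym: "\<And>i j. f i j = f j i" and diag: "\<And>i. f i i = 0" and nonneg: "\<And>i j. i < d \<Longrightarrow> j < d \<Longrightarrow> 0 \<le> f i j"
    and monge: "\<And>k l. k < l \<Longrightarrow> Suc l < d \<Longrightarrow> f k l + f (Suc k) (Suc l) \<le> f k (Suc l) + f (Suc k) l"
    and h: "\<And>i j. i \<le> j \<Longrightarrow> j < d \<Longrightarrow> h j \<le> h i"
  shows "(\<Sum>i<d. \<Sum>j<d. f i j * (cmod (conj_diag R (\<lambda>k. complex_of_real (h k)) $$ (i, j)))\<^sup>2)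
    \<le> (\<Sum>i<d. \<Sum>j<d. f i j * (cmod (conj_diag (pairing_mat d) (\<lambda>k. complex_of_real (h k)) $$ (i, j)))\<^sup>2)"
proof -
  define P where "P = conj_diag (pairing_mat d) (\<lambda>k. complex_of_real (h k))"
  have n: "0 \<le> f i (Suc i)" if "Suc i < d" for i using nonneg that by simp
  have "(\<Sum>i<d. \<Sum>j<d. f i j * (cmod (conj_diag R (\<lambda>k. complex_of_real (h k)) $$ (i, j)))\<^sup>2)
    \<le> 2 * (\<Sum>i<d. (if i < d - 1 - i then f i (d - 1 - i) else 0) * ((h i - h (d - 1 - i))\<^sup>2 / 4))"
    by (rule conj_diag_offdiag_le(1)[where f = f and h = h, OF R sym diag n monge h])
  also have "\<dots> \<le> 2 * (\<Sum>i<d. \<Sum>j<d. (if i < j then f i j else 0) * (cmod (P $$ (i, j)))\<^sup>2)"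
  proof (intro mult_left_mono sum_mono)
    fix i assume "i \<in> {..<d}"
    hence i: "i < d" by simp
    have "(if i < d - 1 - i then f i (d - 1 - i) else 0) * ((h i - h (d - 1 - i))\<^sup>2 / 4)
      = (if i < d - 1 - i then f i (d - 1 - i) else 0) * (cmod (P $$ (i, d - 1 - i)))\<^sup>2"
    proof (cases "i < d - 1 - i")
      case True
      show ?thesis
        unfolding P_def conj_diag_pairing_mat[OF True] norm_of_real power2_abs power_divide by simp
    qed simp
    also have "\<dots> \<le> (\<Sum>j<d. (if i < j then f i j else 0) * (cmod (P $$ (i, j)))\<^sup>2)"
      by (rule member_le_sum[of "d - 1 - i" "{..<d}" "\<lambda>j. (if i < j then f i j else 0) * (cmod (P $$ (i, j)))\<^sup>2"])
         (use i nonneg in auto)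
    finally show "(if i < d - 1 - i then f i (d - 1 - i) else 0) * ((h i - h (d - 1 - i))\<^sup>2 / 4)
      \<le> (\<Sum>j<d. (if i < j then f i j else 0) * (cmod (P $$ (i, j)))\<^sup>2)" .
  qed simp
  also have "\<dots> = (\<Sum>i<d. \<Sum>j<d. f i j * (cmod (P $$ (i, j)))\<^sup>2)"
    unfolding P_def by (rule conj_diag_offdiag_le(2)[where f = f and h = h, OF pairing_mat_unitary sym diag n monge h, symmetric])
  finally show ?thesis unfolding P_def .
qed


section \<open>Both maximizations at once\<close>

lemma density_op_eigenvalues:
  assumes "density_op d (conj_diag V (\<lambda>k. complex_of_real (p k)))" "unitary_mat d V"
  shows "\<And>k. k < d \<Longrightarrow> 0 \<le> p k" "(\<Sum>k<d. p k) = 1"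
proof -
  show "0 \<le> p k" if "k < d" for k
    using assms psd_conj_diag_nonneg[of d V p k] that by (simp add: density_op_def)
  have "complex_of_real (\<Sum>k<d. p k) = 1"
    using assms(1) unfolding density_op_def mtrace_conj_diag[OF assms(2)] of_real_sum by blast
  then show "(\<Sum>k<d. p k) = 1" by (simp only: of_real_eq_1_iff)
qed

text \<open>Both quantities depend on \<open>U\<close> only through the unitary
  \<open>adj (U * V) * K\<close> and not on \<theta>. For either weight the best value of this
  unitary is \<open>pairing_mat d\<close>, which involves neither \<open>p\<close> nor
  \<open>h\<close>, so one \<open>U\<close> serves both.\<close>

lemma subQFI_QFI_common_maximizer:
  assumes rho: "density_op d \<rho>" and H: "hermitian d H"
  shows "\<exists>U\<^sub>s. unitary_mat d U\<^sub>s \<and>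
     (\<forall>U \<theta>. unitary_mat d U \<longrightarrow>
        subQFI H (U * \<rho> * adj U) \<theta> \<le> subQFI H (U\<^sub>s * \<rho> * adj U\<^sub>s) \<theta> \<and>
        QFI H (U * \<rho> * adj U) \<theta> \<le> QFI H (U\<^sub>s * \<rho> * adj U\<^sub>s) \<theta>)"
proof -
  have "hermitian d \<rho>" using rho by (simp add: density_op_def psd_def)
  then obtain V p where V: "unitary_mat d V" and rhod: "\<rho> = conj_diag V (\<lambda>k. complex_of_real (p k))"
    and pa: "antimono_on {..<d} p"
    by (rule hermitian_spectral_sorted)
  obtain K h where K: "unitary_mat d K" and Hd: "H = conj_diag K (\<lambda>k. complex_of_real (h k))"
    and ha: "antimono_on {..<d} h"
    using H by (rule hermitian_spectral_sorted)
  have pmono: "p j \<le> p i" if "i \<le> j" "j < d" for i j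
    using monotone_onD[OF pa, of i j] that by auto
  have hmono: "h j \<le> h i" if "i \<le> j" "j < d" for i j
    using monotone_onD[OF ha, of i j] that by auto
  note Vc = unitary_matD(1)[OF V] and Kc = unitary_matD(1)[OF K]
  note p0 = density_op_eigenvalues(1)[OF rho[unfolded rhod] V]
    and p1 = density_op_eigenvalues(2)[OF rho[unfolded rhod] V]
  let ?T = "pairing_mat d"
  note T = pairing_mat_unitary[of d]
  note Tc = unitary_matD(1)[OF T]
  define E where "E f W = (\<Sum>i<d. \<Sum>j<d. f i j * (cmod (conj_diag W (\<lambda>k. complex_of_real (h k)) $$ (i, j)))\<^sup>2)"
    for f :: "nat \<Rightarrow> nat \<Rightarrow> real" and W
  define fs where "fs i j = (p i - p j)\<^sup>2" for i j
  define fq where "fq i j = (p i - p j)\<^sup>2 / (p i + p j)" for i j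
  have s: "subQFI H (U * \<rho> * adj U) \<theta> = 2 * E fs (adj (U * V) * K)" if U: "unitary_mat d U" for U \<theta>
    unfolding Hd rhod conj_diag_conj[OF unitary_matD(1)[OF U] Vc] E_def fs_def
    by (rule subQFI_eq[OF K unitary_mat_mult[OF U V] p0 p1])
  have q: "QFI H (U * \<rho> * adj U) \<theta> = 2 * E fq (adj (U * V) * K)" if U: "unitary_mat d U" for U \<theta>
    unfolding Hd rhod conj_diag_conj[OF unitary_matD(1)[OF U] Vc] E_def fq_def
    by (rule QFI_eq[OF K unitary_mat_mult[OF U V] p0 p1])
  have ms: "E fs W \<le> E fs ?T" if W: "unitary_mat d W" for W
    unfolding E_def
  proof (rule conj_diag_pairing_mat_max[OF W _ _ _ _ hmono])
    show "fs k l + fs (Suc k) (Suc l) \<le> fs k (Suc l) + fs (Suc k) l" if "k < l" "Suc l < d" for k l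
    proof -
      have "0 \<le> 2 * (p k - p (Suc k)) * (p l - p (Suc l))"
        using pmono[of k "Suc k"] pmono[of l "Suc l"] that by simp
      then show ?thesis by (simp add: fs_def power2_eq_square algebra_simps)
    qed
  qed (auto simp: fs_def power2_commute)
  have mq: "E fq W \<le> E fq ?T" if W: "unitary_mat d W" for W
    unfolding E_def
  proof (rule conj_diag_pairing_mat_max[OF W _ _ _ _ hmono])
    show "fq k l + fq (Suc k) (Suc l) \<le> fq k (Suc l) + fq (Suc k) l" if "k < l" "Suc l < d" for k l
      unfolding fq_def
      by (rule qfi_weight_monge) (use that pmono p0 in auto)
    show "fq i j = fq j i" for i j unfolding fq_def by (simp add: power2_commute add.commute)
    show "0 \<le> fq i j" if "i < d" "j < d" for i j
      unfolding fq_def using p0 that by simp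
  qed (auto simp: fq_def)
  \<comment> \<open>The solution of \<open>adj (Us * V) * K = ?T\<close>, using that
    \<open>?T\<close> is self-adjoint.\<close>
  define Us where "Us = K * ?T * adj V"
  have Us: "unitary_mat d Us" unfolding Us_def
    by (intro unitary_mat_mult K T unitary_mat_adj V)
  have "Us * V = K * ?T * (adj V * V)"
    unfolding Us_def using Kc Tc Vc by (simp only: square_assoc[of _ d] square_closed[of _ d] adj_carrier)
  also have "\<dots> = K * ?T" using unitary_matD(2)[OF V] Kc Tc by simp
  finally have "adj (Us * V) * K = ?T * (adj K * K)"
    using Kc Tc by (simp only: adj_mult[OF Kc Tc] adj_pairing_mat square_assoc[of _ d] adj_carrier)
  also have "\<dots> = ?T" using unitary_matD(2)[OF K] Tc by simp
  finally have UsT: "adj (Us * V) * K = ?T" .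
  show ?thesis
  proof (intro exI[of _ Us] conjI allI impI Us)
    fix U \<theta> assume U: "unitary_mat d U"
    have W: "unitary_mat d (adj (U * V) * K)"
      by (intro unitary_mat_mult unitary_mat_adj U V K)
    show "subQFI H (U * \<rho> * adj U) \<theta> \<le> subQFI H (Us * \<rho> * adj Us) \<theta>"
      unfolding s[OF U] s[OF Us] UsT using ms[OF W] by simp
    show "QFI H (U * \<rho> * adj U) \<theta> \<le> QFI H (Us * \<rho> * adj Us) \<theta>"
      unfolding q[OF U] q[OF Us] UsT using mq[OF W] by simp
  qed
qed

theorem theorem2:
  fixes n :: nat and \<rho> H :: "complex mat"
  assumes "density_op (2 ^ n) \<rho>"
    and "hermitian (2 ^ n) H"
  shows "\<exists>U\<^sub>s. unitary_mat (2 ^ n) U\<^sub>s \<and>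
     (\<forall>U \<theta>. unitary_mat (2 ^ n) U \<longrightarrow>
        subQFI H (U * \<rho> * adj U) \<theta> \<le> subQFI H (U\<^sub>s * \<rho> * adj U\<^sub>s) \<theta> \<and>
        QFI H (U * \<rho> * adj U) \<theta> \<le> QFI H (U\<^sub>s * \<rho> * adj U\<^sub>s) \<theta>)"
  using assms by (rule subQFI_QFI_common_maximizer)

end
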